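(* Let $\sigma,\theta\in(0,1)$ and let $x>0$. Then for every non-negative integer $k$, $$\frac{\partial^{2k}}{\partial\sigma^{k}\partial\theta^{k}}\Bigg\{{\sum_{mn\leq x}}^{\prime}mn\sin(2\pi m\sigma)\sin(2\pi n\theta)\Bigg\}$$ $$=\frac{x\sqrt{x}}{4}\sum_{m=0}^{\infty}\sum_{n=0}^{\infty}\frac{\partial^{2k}}{\partial\sigma^{k}\partial\theta^{k}}\Bigg\{\frac{T_{3/2}(4\pi^2(m+\sigma)(n+\theta)x)}{\sqrt{(m+\sigma)(n+\theta)}}-\frac{T_{3/2}(4\pi^2(m+1-\sigma)(n+\theta)x)}{\sqrt{(m+1-\sigma)(n+\theta)}}$$ $$-\frac{T_{3/2}(4\pi^2(m+\sigma)(n+1-\theta)x)}{\sqrt{(m+\sigma)(n+1-\theta)}}+\frac{T_{3/2}(4\pi^2(m+1-\sigma)(n+1-\theta)x)}{\sqrt{(m+1-\sigma)(n+1-\theta)}}\Bigg\}.$$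
   Context: For $y>0$, $T_{3/2}(y):=\int_0^\infty J_{1/2}(u)\,J_{3/2}\!\left(\frac{y}{u}\right)du$, where $J_\nu$ is the ordinary Bessel function (of the first kind) of order $\nu$. The sum ${\sum}^{\prime}_{mn\le x}$ runs over pairs of positive integers $m,n$ with $mn\le x$; the prime means that if $x$ is an integer, the terms with $mn=x$ are multiplied by $\tfrac12$. The double series on the right is an iterated series, with inner sum over $n$ and outer sum over $m$; for each $(m,n)$ the four-term bracket is taken as a single summand. *)

theory Defs
  imports "HOL-Analysis.Analysis"
begin

text \<open>
  Bessel function of the first kind by its power series, intended for real arguments
  \<open>z > 0\<close> (the non-integral power \<open>powr\<close> is only meaningful there).  \<open>rGamma\<close> is the entire
  function \<open>1 / Gamma\<close>.
\<close>
definition bessel_J :: "real \<Rightarrow> real \<Rightarrow> real" where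
  "bessel_J \<nu> z =
     (\<Sum>j. (-1) ^ j * rGamma (\<nu> + real j + 1) / fact j * (z / 2) powr (2 * real j + \<nu>))"

text \<open>
  For \<open>y > 0\<close> the integrand is bounded near \<open>0\<close> and \<open>O(1/u\<^sup>2)\<close> at infinity, so the integral
  converges absolutely and the Lebesgue integral is the improper integral.
\<close>
definition T32 :: "real \<Rightarrow> real" where
  "T32 y = (LBINT u:{0<..}. bessel_J (1/2) u * bessel_J (3/2) (y / u))"

definition primed_sum :: "real \<Rightarrow> (nat \<Rightarrow> nat \<Rightarrow> real) \<Rightarrow> real" where
  "primed_sum x f =
     (\<Sum>(m, n) \<in> {(m, n). 1 \<le> m \<and> 1 \<le> n \<and> real (m * n) \<le> x}.
        (if real (m * n) = x then 1/2 else 1) * f m n)"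

text \<open>\<open>\<partial>\<^sup>2\<^sup>k F / \<partial>\<sigma>\<^sup>k \<partial>\<theta>\<^sup>k\<close>: first \<open>k\<close> times in \<open>\<theta>\<close>, then \<open>k\<close> times in \<open>\<sigma>\<close>.\<close>
definition mixed_deriv :: "nat \<Rightarrow> (real \<Rightarrow> real \<Rightarrow> real) \<Rightarrow> real \<Rightarrow> real \<Rightarrow> real" where
  "mixed_deriv k F \<sigma> \<theta> = (deriv ^^ k) (\<lambda>s. (deriv ^^ k) (\<lambda>t. F s t) \<theta>) \<sigma>"

text \<open>
  \<open>deriv\<close> is a total operator with an arbitrary value where no derivative exists.  The
  following predicate says that every single derivative taken in \<open>mixed_deriv k F\<close> exists at
  every point of \<open>A \<times> B\<close>, where \<open>A\<close> and \<open>B\<close> are meant to be open.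
\<close>
definition mixed_deriv_exists_on ::
    "nat \<Rightarrow> (real \<Rightarrow> real \<Rightarrow> real) \<Rightarrow> real set \<Rightarrow> real set \<Rightarrow> bool" where
  "mixed_deriv_exists_on k F A B \<longleftrightarrow>
     (\<forall>s\<in>A. \<forall>t\<in>B. \<forall>j<k.
        (deriv ^^ j) (\<lambda>t'. F s t') field_differentiable at t \<and>
        (deriv ^^ j) (\<lambda>s'. (deriv ^^ k) (\<lambda>t'. F s' t') t) field_differentiable at s)"

definition lhs_sum :: "real \<Rightarrow> real \<Rightarrow> real \<Rightarrow> real" where
  "lhs_sum x \<sigma> \<theta> =
     primed_sum x (\<lambda>m n. real m * real n * sin (2 * pi * real m * \<sigma>) * sin (2 * pi * real n * \<theta>))"

definition T_quot :: "real \<Rightarrow> real \<Rightarrow> real \<Rightarrow> real" where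
  "T_quot x a b = T32 (4 * pi\<^sup>2 * a * b * x) / sqrt (a * b)"

definition bracket :: "real \<Rightarrow> nat \<Rightarrow> nat \<Rightarrow> real \<Rightarrow> real \<Rightarrow> real" where
  "bracket x m n \<sigma> \<theta> =
     T_quot x (real m + \<sigma>) (real n + \<theta>)
   - T_quot x (real m + 1 - \<sigma>) (real n + \<theta>)
   - T_quot x (real m + \<sigma>) (real n + 1 - \<theta>)
   + T_quot x (real m + 1 - \<sigma>) (real n + 1 - \<theta>)"

end

theory Submission
  imports Defs
begin

text \<open>
The Bessel functions of order \<open>1/2\<close> and \<open>3/2\<close> are elementary, and with them
\<open>x \<surd>x / 4 * T_quot x s t\<close> becomes the sine transform of \<open>u v\<close> over the region under a hyperbola,
  \<open>\<integral>\<^bsub>v > 0\<^esub> v sin (2 \<pi> t v) (\<integral>\<^bsub>0 < u < x / v\<^esub> u sin (2 \<pi> s u) du) dv\<close>.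
The four terms of the bracket are its values at \<open>s \<in> {m + \<sigma>, \<sigma> - 1 - m}\<close> and \<open>t \<in> {n + \<theta>, \<theta> - 1 - n}\<close>, up to
the sign produced by oddness. The theorem is therefore Poisson summation in both variables for the function
\<open>u v\<close> cut off at \<open>u v = x\<close>, and the jump at the hyperbola produces the weight \<open>1/2\<close>. Formally the operator
\<open>\<partial>\<^sup>2/\<partial>s \<partial>t\<close> multiplies the integrand by \<open>4 \<pi>\<^sup>2 u v\<close> and shifts both sines by a quarter period. Two things have to be
overcome: the transform obtained after \<open>k\<close> such steps need not converge absolutely, and neither do the series.

Derivatives. Dirichlet's hyperbola method gives a meaning to the \<open>k\<close>-th transform: the region is covered
by \<open>v \<le> V\<close> and \<open>u \<le> x / V\<close>, which overlap in a rectangle, and each of the resulting integrals has a bounded integrand on a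
bounded interval (\<open>hyp_int\<close>). The derivative of the combination with respect to \<open>V\<close> vanishes, so that it does not
depend on \<open>V\<close>, and rescaling shows that it is a function \<open>f\<^sub>k (s t)\<close> of the product (\<open>hyp_int_prod\<close>). By Fubini the
second difference of \<open>f\<^sub>k (s t)\<close> over a rectangle is the integral of \<open>4 \<pi>\<^sup>2 f\<^sub>k\<^sub>+\<^sub>1 (s t)\<close>. For
continuous functions this already forces \<open>(p f\<^sub>k' (p))' = 4 \<pi>\<^sup>2 f\<^sub>k\<^sub>+\<^sub>1 (p)\<close>
(\<open>product_kernel_ode\<close>), whence \<open>f\<^sub>0\<close> is smooth and its mixed derivative of order \<open>(k, k)\<close> is
\<open>(4 \<pi>\<^sup>2)\<^sup>k f\<^sub>k (s t)\<close> (\<open>bracket_mixed_deriv\<close>).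

Inner series. Take \<open>V = 1/2\<close>. Summation over \<open>n\<close> turns the sines in \<open>v\<close> into a Dirichlet kernel. The strip
\<open>v \<le> 1/2\<close> contains no positive integer and contributes nothing in the limit. In the other part the partial sums converge pointwise
to half-weighted sums over \<open>n \<le> x / u\<close>, and an estimate that is uniform in the number of terms
(\<open>wave_bound\<close>) permits dominated convergence (\<open>inner_limit\<close>).

Outer series. Summation over \<open>m\<close> produces a Dirichlet kernel in \<open>u\<close> against \<open>\<Sum>\<^bsub>n \<le> x / u\<^esub>\<close>. Away from \<open>u = 0\<close>
this is a finite combination of the same limits and yields the primed sum (\<open>outer_limit\<close>).

In both steps the one delicate point is the origin, where for odd \<open>k\<close> the kernel behaves like \<open>sin (2 \<pi> M u) / u\<close> and
is integrated against a function that keeps oscillating in \<open>1 / u\<close> without decay. The two phases resonate at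
\<open>u \<approx> M\<^sup>-\<^sup>1\<^sup>/\<^sup>2\<close>, and there neither absolute estimates nor bounded variation
suffice. The limit is nevertheless zero (\<open>osc_limit\<close>), because the oscillating function is multiplied by a constant
when \<open>1 / u\<close> grows by \<open>1\<close>, while the phase of the kernel rotates under the same shift by a factor that equals this
constant only on a null set.
\<close>

section \<open>Shifted sines and their truncated moments\<close>

text \<open>
The \<open>k\<close>-th derivative of the sine, as a phase shift. In this form the even and the odd orders of differentiation
need no separate treatment.
\<close>

definition dsin :: "nat \<Rightarrow> real \<Rightarrow> real" where
  "dsin k z = sin (z + real k * pi / 2)"

lemma dsin_bound: "\<bar>dsin k z\<bar> \<le> 1"
  by (simp add: dsin_def)

lemma dsin_0 [simp]: "dsin 0 z = sin z"
  by (simp add: dsin_def)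

lemma dsin_Suc_Suc: "dsin (Suc (Suc k)) z = - dsin k z"
proof -
  have "z + real (Suc (Suc k)) * pi / 2 = (z + real k * pi / 2) + pi"
    by (simp add: field_simps)
  then show ?thesis unfolding dsin_def by (metis sin_periodic_pi)
qed

lemma dsin_Suc: "dsin (Suc k) z = cos (z + real k * pi / 2)"
proof -
  have "z + real (Suc k) * pi / 2 = (z + real k * pi / 2) + pi / 2"
    by (simp add: field_simps)
  then show ?thesis unfolding dsin_def by (simp only: sin_add cos_pi_half sin_pi_half)
qed

lemma dsin_deriv: "(dsin k has_real_derivative dsin (Suc k) z) (at z within A)"
  unfolding dsin_Suc unfolding dsin_def[abs_def]
  by (auto intro!: derivative_eq_intros)

lemma dsin_deriv' [derivative_intros]:
  assumes "(f has_real_derivative f') (at u within A)"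
  shows "((\<lambda>u. dsin k (f u)) has_real_derivative dsin (Suc k) (f u) * f') (at u within A)"
  using DERIV_chain2[OF dsin_deriv assms] by simp

lemma continuous_on_dsin [continuous_intros]:
  fixes f :: "'a::t2_space \<Rightarrow> real"
  shows "continuous_on A f \<Longrightarrow> continuous_on A (\<lambda>u. dsin k (f u))"
  unfolding dsin_def by (rule continuous_on_sin) (rule continuous_on_add, auto)

lemma borel_measurable_dsin [measurable]: "dsin k \<in> borel_measurable borel"
  by (intro borel_measurable_continuous_onI continuous_on_dsin continuous_on_id)

lemma dsin_minus: "dsin k (- z) = (-1) ^ Suc k * dsin k z"
proof (induction k rule: induct_nat_012)
  case 1
  show ?case using dsin_Suc[of 0] by simp
next
  case 0
  show ?case by simp
next
  case (ge2 n)
  then show ?case by (simp add: dsin_Suc_Suc)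
qed

lemma dsin_lipschitz: "\<bar>dsin k a - dsin k b\<bar> \<le> \<bar>a - b\<bar>"
proof -
  have "norm (dsin k a - dsin k b) \<le> 1 * norm (a - b)"
    by (rule field_differentiable_bound[of UNIV])
       (use dsin_deriv dsin_bound in auto)
  then show ?thesis by simp
qed

lemma dsin_sum_to_product: "dsin k a + dsin k b = 2 * dsin k ((a + b) / 2) * cos ((a - b) / 2)"
proof -
  have *: "dsin k a = sin ((a + b) / 2 + real k * pi / 2 + (a - b) / 2)"
    "dsin k b = sin ((a + b) / 2 + real k * pi / 2 - (a - b) / 2)"
    by (simp_all add: dsin_def add_divide_distrib diff_divide_distrib)
  show ?thesis
    unfolding * sin_add[of "_ + _" "(a - b) / 2"] sin_diff[of "_ + _" "(a - b) / 2"] by (simp add: dsin_def)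
qed

lemma dsin_add_pi: "dsin k (z + pi * real n) = (-1) ^ n * dsin k z"
proof -
  have "z + pi * real n + real k * pi / 2 = (z + real k * pi / 2) + real n * pi"
    by (simp add: field_simps)
  moreover have "sin (y + real n * pi) = (-1) ^ n * sin y" for y
    by (simp add: sin_add)
  ultimately show ?thesis
    unfolding dsin_def by metis
qed

lemma bounded_borel_integrable:
  fixes f :: "real \<Rightarrow> 'a::euclidean_space"
  assumes "f \<in> borel_measurable borel" and "\<And>u. u \<in> {a..b} \<Longrightarrow> norm (f u) \<le> K"
  shows "f absolutely_integrable_on {a..b}"
proof (rule measurable_bounded_by_integrable_imp_absolutely_integrable)
  show "f \<in> borel_measurable (lebesgue_on {a..b})"
    using assms(1) by (intro measurable_restrict_space1 measurable_completion) simp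
  show "(\<lambda>u. K) integrable_on {a..b}" by auto
qed (use assms(2) in auto)

lemma bounded_borel_integrable':
  fixes f :: "real \<Rightarrow> 'a::euclidean_space"
  assumes "f \<in> borel_measurable borel" and "\<And>u. u \<in> {a..b} \<Longrightarrow> norm (f u) \<le> K"
  shows "f integrable_on {a..b}"
  using bounded_borel_integrable[OF assms] set_lebesgue_integral_eq_integral(1) by blast

text \<open>
The power moments on the unit interval carry the whole dependence of a truncated sine transform on its
frequency; the length of the interval enters by homogeneity only. This makes \<open>cut_sine\<close> below jointly continuous and
measurable at once.
\<close>

definition unit_sine :: "nat \<Rightarrow> nat \<Rightarrow> real \<Rightarrow> real" where
  "unit_sine j l z = integral {0..1} (\<lambda>r. r ^ j * dsin l (2 * pi * z * r))"

lemma unit_sine_integrable: "(\<lambda>r. r ^ j * dsin l (2 * pi * z * r)) integrable_on {0..1}"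
  by (intro integrable_continuous_real continuous_intros)

lemma unit_sine_deriv: "(unit_sine j l has_real_derivative 2 * pi * unit_sine (Suc j) (Suc l) z) (at z)"
proof -
  have "((\<lambda>z. integral (cbox 0 1) (\<lambda>r. r ^ j * dsin l (2 * pi * z * r))) has_field_derivative
      integral (cbox 0 1) (\<lambda>r. r ^ j * (dsin (Suc l) (2 * pi * z * r) * (2 * pi * r)))) (at z within UNIV)"
  proof (rule leibniz_rule_field_derivative)
    show "continuous_on (UNIV \<times> cbox 0 1)
        (\<lambda>(z, r). r ^ j * (dsin (Suc l) (2 * pi * z * r) * (2 * pi * r)))"
      unfolding case_prod_unfold by (intro continuous_intros)
  qed (use unit_sine_integrable[of j l] in \<open>auto intro!: derivative_eq_intros\<close>)
  moreover have "(\<lambda>r. r ^ j * (dsin (Suc l) (2 * pi * z * r) * (2 * pi * r)))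
      = (\<lambda>r. 2 * pi * (r ^ Suc j * dsin (Suc l) (2 * pi * z * r)))"
    by (auto simp: algebra_simps)
  ultimately show ?thesis
    by (simp add: unit_sine_def[abs_def])
qed

lemma continuous_on_unit_sine: "continuous_on A (unit_sine j l)"
  using unit_sine_deriv by (meson DERIV_continuous continuous_at_imp_continuous_on)

lemma borel_measurable_unit_sine [measurable]: "unit_sine j l \<in> borel_measurable borel"
  by (intro borel_measurable_continuous_onI continuous_on_unit_sine)

lemma unit_sine_Suc_Suc: "unit_sine j (Suc (Suc l)) z = - unit_sine j l z"
  by (simp add: unit_sine_def dsin_Suc_Suc)

lemma unit_sine_minus: "unit_sine j l (- z) = (-1) ^ Suc l * unit_sine j l z"
proof -
  have "r ^ j * dsin l (2 * pi * (- z) * r) = (-1) ^ Suc l * (r ^ j * dsin l (2 * pi * z * r))" for r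
    using dsin_minus[of l "2 * pi * z * r"] by simp
  then show ?thesis by (simp only: unit_sine_def integral_mult_right)
qed

lemma unit_sine_bound: "\<bar>unit_sine j l z\<bar> \<le> 1 / real (Suc j)"
proof -
  have "norm (unit_sine j l z) \<le> integral {0..1} (\<lambda>r. r ^ j)"
    unfolding unit_sine_def
  proof (rule integral_norm_bound_integral[OF unit_sine_integrable])
    fix r :: real assume "r \<in> {0..1}"
    then show "norm (r ^ j * dsin l (2 * pi * z * r)) \<le> r ^ j"
      using mult_left_mono[OF dsin_bound[of l "2 * pi * z * r"], of "r ^ j"] by (simp add: abs_mult)
  qed (intro integrable_continuous_real continuous_intros)
  also have "((\<lambda>r::real. r ^ j) has_integral (1 ^ Suc j / real (Suc j) - 0 ^ Suc j / real (Suc j))) {0..1}"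
  proof (rule fundamental_theorem_of_calculus)
    fix r :: real
    show "((\<lambda>r. r ^ Suc j / real (Suc j)) has_vector_derivative r ^ j) (at r within {0..1})"
      unfolding has_real_derivative_iff_has_vector_derivative[symmetric]
      using DERIV_cdivide[OF DERIV_pow[of "Suc j" r "{0..1}"], of "real (Suc j)"] by simp
  qed simp
  then have "integral {0..1} (\<lambda>r::real. r ^ j) = 1 / real (Suc j)"
    by (simp add: integral_unique)
  finally show ?thesis by simp
qed

text \<open>
Integration of the derivative of \<open>r\<^sup>j\<^sup>+\<^sup>1 S\<^sub>l (2 \<pi> z r)\<close> over the unit interval.
\<close>

lemma unit_sine_rec: "real (Suc j) * unit_sine j l z + 2 * pi * z * unit_sine (Suc j) (Suc l) z = dsin l (2 * pi * z)"
proof -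
  have "((\<lambda>r. real (Suc j) * (r ^ j * dsin l (2 * pi * z * r))
      + 2 * pi * z * (r ^ Suc j * dsin (Suc l) (2 * pi * z * r)))
      has_integral (1 ^ Suc j * dsin l (2 * pi * z * 1) - 0 ^ Suc j * dsin l (2 * pi * z * 0))) {0..1}"
  proof (rule fundamental_theorem_of_calculus)
    fix r :: real
    show "((\<lambda>r. r ^ Suc j * dsin l (2 * pi * z * r)) has_vector_derivative
       real (Suc j) * (r ^ j * dsin l (2 * pi * z * r))
      + 2 * pi * z * (r ^ Suc j * dsin (Suc l) (2 * pi * z * r))) (at r within {0..1})"
      unfolding has_real_derivative_iff_has_vector_derivative[symmetric]
      by (rule derivative_eq_intros refl | simp)+
  qed simp
  moreover have "((\<lambda>r. real (Suc j) * (r ^ j * dsin l (2 * pi * z * r))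
      + 2 * pi * z * (r ^ Suc j * dsin (Suc l) (2 * pi * z * r)))
      has_integral (real (Suc j) * unit_sine j l z + 2 * pi * z * unit_sine (Suc j) (Suc l) z)) {0..1}"
    unfolding unit_sine_def
    by (intro has_integral_add has_integral_mult_right integrable_integral unit_sine_integrable)
  ultimately show ?thesis
    by (simp add: has_integral_unique)
qed

lemma unit_sine_parts:
  assumes "z \<noteq> 0"
  shows "unit_sine (Suc j) l z = (real (Suc j) * unit_sine j (Suc l) z - dsin (Suc l) (2 * pi * z)) / (2 * pi * z)"
  using unit_sine_rec[of j "Suc l" z] assms by (simp add: unit_sine_Suc_Suc field_simps)

text \<open>
One integration by parts. The boundary term and the remaining moment each contribute at most half of the bound.
\<close>

lemma unit_sine_decay:
  assumes "z \<noteq> 0"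
  shows "\<bar>unit_sine j l z\<bar> \<le> 1 / (pi * \<bar>z\<bar>)"
proof (cases j)
  case 0
  have "((\<lambda>r. dsin l (2 * pi * z * r)) has_integral
      (- dsin (Suc l) (2 * pi * z * 1) / (2 * pi * z) - - dsin (Suc l) (2 * pi * z * 0) / (2 * pi * z))) {0..1}"
  proof (rule fundamental_theorem_of_calculus)
    fix r :: real
    show "((\<lambda>r. - dsin (Suc l) (2 * pi * z * r) / (2 * pi * z)) has_vector_derivative
       dsin l (2 * pi * z * r)) (at r within {0..1})"
      unfolding has_real_derivative_iff_has_vector_derivative[symmetric]
      using assms by (auto intro!: derivative_eq_intros simp: dsin_Suc_Suc)
  qed simp
  then have "unit_sine j l z = (dsin (Suc l) 0 - dsin (Suc l) (2 * pi * z)) / (2 * pi * z)"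
    using 0 by (simp add: unit_sine_def integral_unique diff_divide_distrib)
  moreover have "\<bar>dsin (Suc l) 0 - dsin (Suc l) (2 * pi * z)\<bar> \<le> 2"
    using dsin_bound[of "Suc l" 0] dsin_bound[of "Suc l" "2 * pi * z"] by linarith
  ultimately show ?thesis
    using assms by (simp add: abs_divide abs_mult field_simps)
next
  case (Suc i)
  have "\<bar>real (Suc i) * unit_sine i (Suc l) z\<bar> \<le> 1"
    using mult_left_mono[OF unit_sine_bound[of i "Suc l" z], of "real (Suc i)"] unfolding abs_mult by simp
  then have "\<bar>real (Suc i) * unit_sine i (Suc l) z - dsin (Suc l) (2 * pi * z)\<bar> \<le> 2"
    using dsin_bound[of "Suc l" "2 * pi * z"] by linarith
  then show ?thesis
    unfolding Suc unit_sine_parts[OF assms] using assms by (simp add: abs_divide abs_mult field_simps)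
qed

text \<open>
The transform \<open>\<integral> u\<^sup>k\<^sup>+\<^sup>1 S\<^sub>k (2 \<pi> s u) du\<close> over \<open>0 < u < X\<close>, see \<open>cut_sine_integral\<close>, in homogeneous form.
\<close>

definition cut_sine :: "nat \<Rightarrow> real \<Rightarrow> real \<Rightarrow> real" where
  "cut_sine k s X = X ^ (k + 2) * unit_sine (Suc k) k (s * X)"

lemma cut_sine_0 [simp]: "cut_sine k s 0 = 0"
  by (simp add: cut_sine_def)

lemma cut_sine_minus: "cut_sine k (- s) X = (-1) ^ Suc k * cut_sine k s X"
  using unit_sine_minus[of "Suc k" k "s * X"] by (simp add: cut_sine_def)

lemma cut_sine_scale: "a \<noteq> 0 \<Longrightarrow> cut_sine k (a * s) X = cut_sine k s (a * X) / a ^ (k + 2)"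
  by (simp add: cut_sine_def field_simps)

lemma borel_measurable_cut_sine [measurable]:
  assumes [measurable]: "f \<in> borel_measurable M" "g \<in> borel_measurable M"
  shows "(\<lambda>u. cut_sine k (f u) (g u)) \<in> borel_measurable M"
  unfolding cut_sine_def by measurable

lemma continuous_on_cut_sine [continuous_intros]:
  fixes f g :: "'a::t2_space \<Rightarrow> real"
  assumes "continuous_on A f" "continuous_on A g"
  shows "continuous_on A (\<lambda>u. cut_sine k (f u) (g u))"
  unfolding cut_sine_def
  by (intro continuous_intros assms continuous_on_compose2[OF continuous_on_unit_sine[of UNIV]]) auto

lemma cut_sine_deriv_X: "((\<lambda>X. cut_sine k s X) has_real_derivative X ^ Suc k * dsin k (2 * pi * s * X)) (at X within A)"
proof -
  have "((\<lambda>X. X ^ (k + 2) * unit_sine (Suc k) k (s * X)) has_real_derivative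
      X ^ (k + 2) * (2 * pi * unit_sine (Suc (Suc k)) (Suc k) (s * X) * s)
      + real (k + 2) * X ^ Suc k * unit_sine (Suc k) k (s * X)) (at X within A)"
  proof -
    have 1: "((\<lambda>X. X ^ (k + 2)) has_real_derivative real (k + 2) * X ^ Suc k) (at X within A)"
      using DERIV_pow[of "k + 2" X A] by simp
    have 2: "((\<lambda>X. unit_sine (Suc k) k (s * X)) has_real_derivative
        2 * pi * unit_sine (Suc (Suc k)) (Suc k) (s * X) * s) (at X within A)"
      by (rule DERIV_chain2[OF unit_sine_deriv]) (auto intro!: derivative_eq_intros)
    show ?thesis using DERIV_mult'[OF 1 2] by simp
  qed
  also have "X ^ (k + 2) * (2 * pi * unit_sine (Suc (Suc k)) (Suc k) (s * X) * s)
      + real (k + 2) * X ^ Suc k * unit_sine (Suc k) k (s * X)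
      = X ^ Suc k * dsin k (2 * pi * s * X)"
    using arg_cong[OF unit_sine_rec[of "Suc k" k "s * X"], of "\<lambda>c. X ^ Suc k * c"] by (simp add: algebra_simps)
  finally show ?thesis unfolding cut_sine_def .
qed

lemma cut_sine_deriv_s: "((\<lambda>s. cut_sine k s X) has_real_derivative 2 * pi * cut_sine (Suc k) s X) (at s within A)"
  unfolding cut_sine_def
  by (rule derivative_eq_intros DERIV_chain2[OF unit_sine_deriv] refl | simp)+

lemma cut_sine_integral:
  assumes "0 \<le> X"
  shows "((\<lambda>u. u ^ Suc k * dsin k (2 * pi * s * u)) has_integral cut_sine k s X) {0..X}"
  using fundamental_theorem_of_calculus[of 0 X "cut_sine k s" "\<lambda>u. u ^ Suc k * dsin k (2 * pi * s * u)"]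
    cut_sine_deriv_X assms by (simp add: has_real_derivative_iff_has_vector_derivative)

lemma cut_sine_bound:
  assumes "s \<noteq> 0" "0 \<le> X"
  shows "\<bar>cut_sine k s X\<bar> \<le> X ^ Suc k / (pi * \<bar>s\<bar>)"
proof (cases "X = 0")
  case False
  have "\<bar>cut_sine k s X\<bar> \<le> X ^ (k + 2) * (1 / (pi * \<bar>s * X\<bar>))"
    using mult_left_mono[OF unit_sine_decay[of "s * X" "Suc k" k], of "X ^ (k + 2)"] assms False
    unfolding cut_sine_def abs_mult[of "X ^ _"] by simp
  also have "\<dots> = X ^ Suc k / (pi * \<bar>s\<bar>)"
    using assms False by (simp add: abs_mult field_simps)
  finally show ?thesis .
qed simp

section \<open>The resonant range of a chirp integral\<close>

lemma norm_integral_le: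
  fixes f :: "real \<Rightarrow> 'a::euclidean_space"
  assumes "f \<in> borel_measurable borel" "\<And>u. u \<in> {a..b} \<Longrightarrow> norm (f u) \<le> K" "a \<le> b"
  shows "norm (integral {a..b} f) \<le> K * (b - a)"
proof -
  have "norm (integral {a..b} f) \<le> integral {a..b} (\<lambda>u. K)"
    by (rule integral_norm_bound_integral[OF bounded_borel_integrable'[OF assms(1,2)]]) (use assms in auto)
  then show ?thesis using assms(3) by (simp add: mult.commute)
qed

lemma norm_cis_diff_le: "norm (cis a - cis b) \<le> \<bar>a - b\<bar>"
proof -
  have "cis a - cis b = cis b * (cis (a - b) - 1)"
    by (simp add: right_diff_distrib cis_mult)
  then have "norm (cis a - cis b) = norm (cis (a - b) - 1)"
    by (simp add: norm_mult)
  also have "\<dots> = sqrt ((2 * sin ((a - b) / 2))\<^sup>2)"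
  proof -
    have "cos (a - b) = 1 - 2 * (sin ((a - b) / 2))\<^sup>2"
      using cos_double_sin[of "(a - b) / 2"] by (simp only: mult_2 field_sum_of_halves)
    moreover have "(sin (a - b))\<^sup>2 = 1 - (cos (a - b))\<^sup>2"
      by (simp add: sin_squared_eq)
    ultimately have "(cos (a - b) - 1)\<^sup>2 + (sin (a - b))\<^sup>2 = (2 * sin ((a - b) / 2))\<^sup>2"
      by (simp add: power2_eq_square algebra_simps)
    then show ?thesis by (simp add: norm_complex_def)
  qed
  also have "\<dots> = 2 * \<bar>sin ((a - b) / 2)\<bar>" by (simp only: real_sqrt_abs abs_mult abs_numeral)
  also have "\<dots> \<le> \<bar>a - b\<bar>" using abs_sin_x_le_abs_x[of "(a - b) / 2"] by simp
  finally show ?thesis .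
qed

lemma cis_has_vector_derivative:
  "((\<lambda>u. cis (a * u)) has_vector_derivative of_real a * \<i> * cis (a * u)) (at u within S)"
proof -
  have "((\<lambda>z. exp (\<i> * (of_real a * z))) has_field_derivative of_real a * \<i> * exp (\<i> * (of_real a * of_real u))) (at (of_real u))"
    by (auto intro!: derivative_eq_intros)
  from has_vector_derivative_real_field[OF this] show ?thesis by (simp add: cis_conv_exp)
qed

lemma borel_measurable_cis [measurable (raw)]:
  "f \<in> borel_measurable M \<Longrightarrow> (\<lambda>u. cis (f u)) \<in> borel_measurable M"
  by (rule borel_measurable_continuous_on[OF continuous_on_cis]) auto

text \<open>
Two points of the set have phases \<open>1 / w\<^sup>2\<close> that differ by a multiple of \<open>2 \<pi>\<close>, so the set is countable.
\<close>

lemma resonance_set_null: "negligible {w::real. w > 0 \<and> \<omega> * cis (- 1 / w\<^sup>2) = 1}"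
proof (cases "\<exists>w0>0. \<omega> * cis (- 1 / w0\<^sup>2) = 1")
  case False
  then have "{w::real. w > 0 \<and> \<omega> * cis (- 1 / w\<^sup>2) = 1} = {}" by blast
  then show ?thesis by (simp only: negligible_empty)
next
  case True
  then obtain w0 :: real where w0: "w0 > 0" "\<omega> * cis (- 1 / w0\<^sup>2) = 1" by auto
  have "{w::real. w > 0 \<and> \<omega> * cis (- 1 / w\<^sup>2) = 1}
      \<subseteq> range (\<lambda>n::int. 1 / sqrt (1 / w0\<^sup>2 + of_int n * 2 * pi))"
  proof safe
    fix w :: real assume w: "w > 0" "\<omega> * cis (- 1 / w\<^sup>2) = 1"
    from w(2) w0(2) have "cis (- 1 / w\<^sup>2) = cis (- 1 / w0\<^sup>2)"
      by (metis mult_cancel_left mult_zero_left zero_neq_one)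
    then have "cis (1 / w\<^sup>2 - 1 / w0\<^sup>2) = 1"
      by (metis cis_mult cis_zero add.commute add.right_inverse diff_conv_add_uminus minus_divide_left add.left_inverse minus_minus)
    then have "cos (1 / w\<^sup>2 - 1 / w0\<^sup>2) = 1"
      by (metis cis.sel(1) one_complex.sel(1))
    then obtain n :: int where "1 / w\<^sup>2 - 1 / w0\<^sup>2 = of_int n * 2 * pi"
      using cos_one_2pi_int by metis
    then have *: "1 / w\<^sup>2 = 1 / w0\<^sup>2 + of_int n * 2 * pi" by simp
    have "w = 1 / sqrt (1 / w\<^sup>2)" using w(1) by (simp add: real_sqrt_divide)
    then show "w \<in> range (\<lambda>n::int. 1 / sqrt (1 / w0\<^sup>2 + of_int n * 2 * pi))"
      unfolding * by blast
  qed
  then show ?thesis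
    unfolding negligible_iff_null_sets
    by (intro null_sets_completionI countable_imp_null_set_lborel) (rule countable_subset, auto)
qed

text \<open>
A van der Corput shift. Put \<open>h w = cis (\<mu> / w) \<psi> (\<mu> w)\<close>. Moving \<open>w\<close> by \<open>1 / \<mu>\<close> multiplies \<open>\<psi> (\<mu> w)\<close> by
\<open>\<omega>\<close> and \<open>cis (\<mu> / w)\<close> by approximately \<open>cis (- 1 / w\<^sup>2)\<close>, hence multiplies \<open>h\<close> by about \<open>1 + z w\<close> with
\<open>z w = \<omega> cis (- 1 / w\<^sup>2) - 1\<close>. Integrals of \<open>h z q\<close> with continuous \<open>q\<close> are thus differences of an integral and its
translate, and tend to \<open>0\<close>. As \<open>z\<close> vanishes on a null set only, \<open>1 / w\<close> can be approximated in mean by such products \<open>z q\<close>.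
The bound is uniform in the end points, which the application moves with \<open>\<mu>\<close>.
\<close>

lemma resonant_range:
  fixes \<psi> :: "real \<Rightarrow> complex"
  assumes [measurable]: "\<psi> \<in> borel_measurable borel"
    and \<psi>1: "\<And>y. norm (\<psi> y) \<le> 1"
    and shift: "\<And>y. y \<ge> 0 \<Longrightarrow> \<psi> (y + 1) = \<omega> * \<psi> y"
    and \<omega>: "norm \<omega> = 1" and "0 < \<delta>" "\<delta> \<le> K" "0 < e"
  shows "\<exists>\<mu>0>0. \<forall>\<mu>\<ge>\<mu>0. \<forall>\<alpha> \<beta>. \<delta> \<le> \<alpha> \<longrightarrow> \<alpha> \<le> \<beta> \<longrightarrow> \<beta> \<le> K \<longrightarrow>
    norm (integral {\<alpha>..\<beta>} (\<lambda>w. cis (\<mu> / w) * \<psi> (\<mu> * w) / of_real w)) \<le> e"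
proof -
  define z where "z = (\<lambda>w::real. \<omega> * cis (- 1 / w\<^sup>2) - 1)"
  have [measurable]: "z \<in> borel_measurable borel" unfolding z_def by measurable
  \<comment> \<open>\<open>q\<close> is a regularised inverse of \<open>w z w\<close> and \<open>r\<close> the resulting defect: \<open>1 / w = q z + r\<close>,
    where \<open>r\<close> tends to \<open>0\<close> with \<open>\<eta>\<close> wherever \<open>z\<close> does not vanish.\<close>
  define r where "r = (\<lambda>\<eta> w. \<eta> / ((norm (z w))\<^sup>2 + \<eta>) / w)"
  define q where "q = (\<lambda>\<eta> w. cnj (z w) / of_real ((norm (z w))\<^sup>2 + \<eta>) / of_real w)"
  have [measurable]: "r \<eta> \<in> borel_measurable borel" for \<eta> unfolding r_def by measurable
  have r01: "0 \<le> r \<eta> w \<and> r \<eta> w \<le> 1 / \<delta>" if "w \<in> {\<delta>..K}" "\<eta> > 0" for w \<eta>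
  proof -
    have "0 \<le> \<eta> / ((norm (z w))\<^sup>2 + \<eta>)" "\<eta> / ((norm (z w))\<^sup>2 + \<eta>) \<le> 1"
      using that by (auto simp: divide_le_eq_1 add_nonneg_pos)
    moreover from this have "\<eta> / ((norm (z w))\<^sup>2 + \<eta>) / w \<le> 1 / \<delta>"
      using that \<open>0 < \<delta>\<close> by (intro frac_le) auto
    ultimately show ?thesis using that \<open>0 < \<delta>\<close> unfolding r_def by simp
  qed
  obtain \<eta> where \<eta>: "\<eta> > 0" "integral {\<delta>..K} (r \<eta>) \<le> e / 2"
  proof -
    define g where "g = (\<lambda>w::real. if z w = 0 then 1 / w else 0)"
    have "(\<lambda>j. integral {\<delta>..K} (r (1 / real (Suc j)))) \<longlonglongrightarrow> integral {\<delta>..K} g"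
    proof (rule dominated_convergence(2))
      show "r (1 / real (Suc j)) integrable_on {\<delta>..K}" for j
        by (rule bounded_borel_integrable'[where K="1/\<delta>"]) (use r01 in auto)
      show "(\<lambda>_. 1 / \<delta>) integrable_on {\<delta>..K}" by auto
      show "norm (r (1 / real (Suc j)) w) \<le> 1 / \<delta>" if "w \<in> {\<delta>..K}" for j w
        using r01[OF that, of "1 / real (Suc j)"] by simp
      show "(\<lambda>j. r (1 / real (Suc j)) w) \<longlonglongrightarrow> g w" if "w \<in> {\<delta>..K}" for w
      proof (cases "z w = 0")
        case True then show ?thesis by (simp add: r_def g_def)
      next
        case False
        have *: "(\<lambda>j. 1 / real (Suc j)) \<longlonglongrightarrow> 0" by (rule LIMSEQ_Suc[OF lim_1_over_n])
        have "(\<lambda>j. r (1 / real (Suc j)) w) \<longlonglongrightarrow> 0 / ((norm (z w))\<^sup>2 + 0) / w"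
          unfolding r_def by (intro tendsto_intros *) (use that \<open>0<\<delta>\<close> False in auto)
        then show ?thesis using False by (simp add: g_def)
      qed
    qed
    moreover have "integral {\<delta>..K} g = 0"
    proof (rule integral_unique, rule has_integral_negligible[OF resonance_set_null[of \<omega>]])
      show "g w = 0" if "w \<in> {\<delta>..K} - {w. 0 < w \<and> \<omega> * cis (- 1 / w\<^sup>2) = 1}" for w
        using that \<open>0<\<delta>\<close> by (auto simp: g_def z_def)
    qed
    ultimately have "(\<lambda>j. integral {\<delta>..K} (r (1 / real (Suc j)))) \<longlonglongrightarrow> 0" by simp
    then have "eventually (\<lambda>j. integral {\<delta>..K} (r (1 / real (Suc j))) < e / 2) sequentially"
      by (rule order_tendstoD(2)) (use \<open>0<e\<close> in auto)
    then obtain j where "integral {\<delta>..K} (r (1 / real (Suc j))) < e / 2"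
      by (auto simp: eventually_sequentially)
    then show ?thesis using that[of "1 / real (Suc j)"] by simp
  qed
  have qz: "1 / of_real w = q \<eta> w * z w + of_real (r \<eta> w)" for w
  proof -
    have "cnj (z w) * z w = of_real ((norm (z w))\<^sup>2)"
      using complex_norm_square[of "z w"] by (simp only: mult.commute)
    then have "q \<eta> w * z w = of_real ((norm (z w))\<^sup>2 / ((norm (z w))\<^sup>2 + \<eta>) / w)"
      unfolding q_def by (simp add: field_simps)
    moreover have "(norm (z w))\<^sup>2 / ((norm (z w))\<^sup>2 + \<eta>) / w + r \<eta> w = 1 / w"
      using \<eta>(1) add_nonneg_pos[of "(norm (z w))\<^sup>2" \<eta>]
      unfolding r_def add_divide_distrib[symmetric] by simp
    ultimately show ?thesis
      by (metis of_real_1 of_real_add of_real_divide)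
  qed
  have [measurable]: "q \<eta> \<in> borel_measurable borel" unfolding q_def
    by (intro borel_measurable_divide borel_measurable_of_real borel_measurable_continuous_on[OF continuous_on_cnj[OF continuous_on_id]]) measurable
  define Q where "Q = 2 / \<eta> / \<delta>"
  have Q: "norm (q \<eta> w) \<le> Q" if "w \<ge> \<delta>" for w
  proof -
    have "norm (z w) \<le> 2" unfolding z_def
      by (rule order_trans[OF norm_triangle_ineq4]) (use \<omega> in \<open>simp add: norm_mult\<close>)
    then have "norm (z w) / ((norm (z w))\<^sup>2 + \<eta>) \<le> 2 / \<eta>"
      using \<eta>(1) by (intro frac_le) auto
    then have "norm (z w) / ((norm (z w))\<^sup>2 + \<eta>) / w \<le> 2 / \<eta> / \<delta>"
      using that \<open>0<\<delta>\<close> \<eta>(1) by (rule_tac frac_le) auto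
    then show ?thesis
      using that \<open>0<\<delta>\<close> \<eta>(1) unfolding q_def Q_def norm_divide norm_of_real complex_mod_cnj
      by (simp only: abs_of_nonneg abs_of_pos add_nonneg_pos zero_le_power2 less_le_trans)
  qed
  have "Q \<ge> 0" using \<eta> \<open>0<\<delta>\<close> by (simp add: Q_def)
  have K0: "K > 0" using \<open>0 < \<delta>\<close> \<open>\<delta> \<le> K\<close> by simp
  define \<epsilon> where "\<epsilon> = e / (8 * K)"
  have "\<epsilon> > 0" using K0 \<open>0<e\<close> by (simp add: \<epsilon>_def)
  have "uniformly_continuous_on {\<delta>..K} (q \<eta>)"
  proof (rule compact_uniformly_continuous)
    have nz: "complex_of_real ((norm (z w))\<^sup>2 + \<eta>) \<noteq> 0" for w
      using \<eta>(1) by (metis add_nonneg_pos less_irrefl of_real_eq_0_iff zero_le_power2)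
    show "continuous_on {\<delta>..K} (q \<eta>)"
      unfolding q_def z_def using nz[unfolded z_def] \<open>0<\<delta>\<close>
      by (intro continuous_intros) auto
  qed auto
  then obtain d where d: "d > 0" "\<And>u v. u \<in> {\<delta>..K} \<Longrightarrow> v \<in> {\<delta>..K} \<Longrightarrow> dist v u < d \<Longrightarrow> dist (q \<eta> v) (q \<eta> u) < \<epsilon>"
    using \<open>\<epsilon> > 0\<close> unfolding uniformly_continuous_on_def by metis
  define H0 where "H0 = Min {d / 2, e / (8 * (Q / \<delta> ^ 3 * K + 1)), e / (8 * (2 * Q + 1)), e * \<delta>}"
  have pos: "Q / \<delta> ^ 3 * K + 1 > 0" "2 * Q + 1 > 0"
    using \<open>Q \<ge> 0\<close> K0 \<open>0<\<delta>\<close> by (auto intro!: add_nonneg_pos mult_nonneg_nonneg divide_nonneg_pos)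
  have "H0 > 0" unfolding H0_def using d \<open>0<e\<close> \<open>0<\<delta>\<close> pos by simp
  have H0: "H0 \<le> d / 2" "H0 \<le> e / (8 * (Q / \<delta> ^ 3 * K + 1))" "H0 \<le> e / (8 * (2 * Q + 1))" "H0 \<le> e * \<delta>"
    unfolding H0_def by (rule Min_le, blast, blast)+
  show ?thesis
  proof (intro exI[of _ "1 / H0"] conjI allI impI)
    show "1 / H0 > 0" using \<open>H0 > 0\<close> by simp
    fix \<mu> \<alpha> \<beta> :: real
    assume \<mu>: "1 / H0 \<le> \<mu>" and ab: "\<delta> \<le> \<alpha>" "\<alpha> \<le> \<beta>" "\<beta> \<le> K"
    define H where "H = 1 / \<mu>"
    have \<mu>0: "\<mu> > 0" using \<mu> \<open>H0 > 0\<close> by (smt (verit) zero_less_divide_1_iff)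
    have H: "H > 0" "H \<le> H0" unfolding H_def using \<mu> \<open>H0>0\<close> \<mu>0 by (auto simp: field_simps)
    define h where "h = (\<lambda>w. cis (\<mu> / w) * \<psi> (\<mu> * w))"
    have [measurable]: "h \<in> borel_measurable borel" unfolding h_def by measurable
    have h1: "norm (h w) \<le> 1" for w unfolding h_def using \<psi>1 by (simp add: norm_mult)
    let ?I = "integral {\<alpha>..\<beta>} (\<lambda>w. h w / of_real w)"
    have "norm ?I \<le> e"
    \<comment> \<open>An interval shorter than the shift cannot be compared with its translate, but is negligible.\<close>
    proof (cases "\<beta> - \<alpha> \<le> H")
      case True
      have "norm ?I \<le> (1 / \<delta>) * (\<beta> - \<alpha>)"
      proof (rule norm_integral_le)
        show "norm (h w / of_real w) \<le> 1 / \<delta>" if "w \<in> {\<alpha>..\<beta>}" for w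
          using h1[of w] that ab \<open>0<\<delta>\<close> by (simp add: norm_divide frac_le)
      qed (use ab in measurable)
      also have "\<dots> \<le> (1 / \<delta>) * (e * \<delta>)"
        using True H H0 \<open>0<\<delta>\<close> by (intro mult_left_mono) auto
      finally show ?thesis using \<open>0<\<delta>\<close> by simp
    next
      case False
      let ?A = "\<lambda>w. \<omega> * cis (- 1 / w\<^sup>2) * h w * q \<eta> w"
      have int: "f integrable_on {a..b}" if "f \<in> borel_measurable borel" "\<And>u. u \<in> {a..b} \<Longrightarrow> norm (f u) \<le> B"
        for f :: "real \<Rightarrow> complex" and a b B using bounded_borel_integrable'[OF that] .
      have b1: "norm (?A w) \<le> Q" if "w \<ge> \<delta>" for w
        using mult_mono[OF h1[of w] Q[OF that]] \<omega> \<open>Q\<ge>0\<close> by (simp add: norm_mult)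
      have b2: "norm (h w * q \<eta> w) \<le> Q" if "w \<ge> \<delta>" for w
        using mult_mono[OF h1[of w] Q[OF that]] \<open>Q\<ge>0\<close> by (simp add: norm_mult)
      have b3: "norm (h (w + H) * q \<eta> w) \<le> Q" if "w \<ge> \<delta>" for w
        using mult_mono[OF h1[of "w + H"] Q[OF that]] \<open>Q\<ge>0\<close> by (simp add: norm_mult)
      have b4: "norm (h w * q \<eta> (w - H)) \<le> Q" if "w - H \<ge> \<delta>" for w
        using mult_mono[OF h1[of w] Q[OF that]] \<open>Q\<ge>0\<close> by (simp add: norm_mult)
      have b5: "norm (h w * of_real (r \<eta> w)) \<le> r \<eta> w" if "w \<in> {\<delta>..K}" for w
        using mult_mono[OF h1[of w], of "r \<eta> w" "r \<eta> w"] r01[OF that \<eta>(1)] by (simp add: norm_mult)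
      have i1: "?A integrable_on {\<alpha>..\<beta>}" by (rule int[where B=Q]) (use b1 ab in auto)
      have i2: "(\<lambda>w. h w * q \<eta> w) integrable_on {\<alpha>..\<beta>}" by (rule int[where B=Q]) (use b2 ab in auto)
      have i3: "(\<lambda>w. h (w + H) * q \<eta> w) integrable_on {\<alpha>..\<beta>}" by (rule int[where B=Q]) (use b3 ab in auto)
      have i4: "(\<lambda>w. h w * q \<eta> (w - H)) integrable_on {\<alpha> + H..\<beta> + H}" by (rule int[where B=Q]) (use b4 ab in auto)
      have i5: "(\<lambda>w. h w * of_real (r \<eta> w)) integrable_on {\<alpha>..\<beta>}"
      proof (rule int[where B="1/\<delta>"])
        show "norm (h w * of_real (r \<eta> w)) \<le> 1 / \<delta>" if "w \<in> {\<alpha>..\<beta>}" for w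
          using b5[of w] r01[OF _ \<eta>(1), of w] that ab by auto
      qed measurable
      have "(\<lambda>w. h w / of_real w) = (\<lambda>w. ?A w - h w * q \<eta> w + h w * of_real (r \<eta> w))"
      proof
        fix w
        have "h w / of_real w = h w * (1 / of_real w)" by simp
        also have "\<dots> = ?A w - h w * q \<eta> w + h w * of_real (r \<eta> w)"
          unfolding qz z_def by (simp add: algebra_simps)
        finally show "h w / of_real w = ?A w - h w * q \<eta> w + h w * of_real (r \<eta> w)" .
      qed
      then have I: "?I = integral {\<alpha>..\<beta>} ?A - integral {\<alpha>..\<beta>} (\<lambda>w. h w * q \<eta> w)
           + integral {\<alpha>..\<beta>} (\<lambda>w. h w * of_real (r \<eta> w))"
        by (simp only: integral_add[OF integrable_diff[OF i1 i2] i5] integral_diff[OF i1 i2])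
      have e5: "norm (integral {\<alpha>..\<beta>} (\<lambda>w. h w * of_real (r \<eta> w))) \<le> e / 2"
      proof -
        have ri: "r \<eta> integrable_on {a..b}" if "\<delta> \<le> a" "b \<le> K" for a b
          by (rule bounded_borel_integrable'[where K="1/\<delta>"]) (use r01[OF _ \<eta>(1)] that in auto)
        have "norm (integral {\<alpha>..\<beta>} (\<lambda>w. h w * of_real (r \<eta> w))) \<le> integral {\<alpha>..\<beta>} (r \<eta>)"
          by (rule integral_norm_bound_integral[OF i5 ri]) (use b5 ab in auto)
        also have "\<dots> \<le> integral {\<delta>..K} (r \<eta>)"
          by (rule integral_subset_le) (use ri ab r01[OF _ \<eta>(1)] in auto)
        finally show ?thesis using \<eta> by simp
      qed
      have e1: "norm (integral {\<alpha>..\<beta>} (\<lambda>w. ?A w - h (w + H) * q \<eta> w)) \<le> e / 8"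
      proof -
        have "norm (integral {\<alpha>..\<beta>} (\<lambda>w. ?A w - h (w + H) * q \<eta> w)) \<le> (H / \<delta> ^ 3 * Q) * (\<beta> - \<alpha>)"
        proof (rule norm_integral_le)
          fix w assume w: "w \<in> {\<alpha>..\<beta>}"
          then have w0: "w \<ge> \<delta>" "w > 0" using ab \<open>0<\<delta>\<close> by auto
          have muH: "\<mu> * H = 1" using \<mu>0 by (simp add: H_def)
          have "\<psi> (\<mu> * (w + H)) = \<omega> * \<psi> (\<mu> * w)"
            using shift[of "\<mu> * w"] w0 \<mu>0 muH by (simp add: distrib_left)
          then have "?A w - h (w + H) * q \<eta> w
             = \<omega> * \<psi> (\<mu> * w) * q \<eta> w * (cis (\<mu> / w - 1 / w\<^sup>2) - cis (\<mu> / (w + H)))"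
            using cis_mult[of "\<mu> / w" "- 1 / w\<^sup>2"] by (simp add: h_def algebra_simps)
          moreover have "norm (\<omega> * \<psi> (\<mu> * w) * q \<eta> w) \<le> Q"
            using mult_mono[OF \<psi>1[of "\<mu> * w"] Q[OF w0(1)]] \<omega> \<open>Q \<ge> 0\<close> by (simp add: norm_mult)
          moreover have "norm (cis (\<mu> / w - 1 / w\<^sup>2) - cis (\<mu> / (w + H))) \<le> H / \<delta> ^ 3"
          proof -
            have "\<mu> / w - \<mu> / (w + H) = \<mu> * H / (w * (w + H))"
              using w0 H(1) by (simp add: field_simps)
            then have "\<mu> / w - 1 / w\<^sup>2 - \<mu> / (w + H) = \<mu> * H / (w * (w + H)) - 1 / w\<^sup>2"
              by linarith
            also have "\<dots> = - H / (w\<^sup>2 * (w + H))"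
              using w0 H(1) unfolding muH by (simp add: divide_simps power2_eq_square)
            finally have "\<bar>\<mu> / w - 1 / w\<^sup>2 - \<mu> / (w + H)\<bar> = H / (w\<^sup>2 * (w + H))"
              using w0 H(1) by simp
            also have "\<dots> \<le> H / (\<delta>\<^sup>2 * \<delta>)"
              using w0 H(1) \<open>0<\<delta>\<close> by (intro divide_left_mono mult_mono power_mono) auto
            also have "\<dots> = H / \<delta> ^ 3" by (simp add: power2_eq_square power3_eq_cube)
            finally show ?thesis using norm_cis_diff_le order_trans by blast
          qed
          ultimately show "norm (?A w - h (w + H) * q \<eta> w) \<le> H / \<delta> ^ 3 * Q"
            using \<open>Q\<ge>0\<close> H(1) \<open>0<\<delta>\<close> mult_mono[of "norm (\<omega> * \<psi> (\<mu> * w) * q \<eta> w)" Q "norm (cis (\<mu> / w - 1 / w\<^sup>2) - cis (\<mu> / (w + H)))" "H / \<delta> ^ 3"]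
            by (simp only: norm_mult) (simp add: mult.commute)
        qed (use ab in measurable)
        also have "\<dots> \<le> (H / \<delta> ^ 3 * Q) * K"
          using ab H \<open>0<\<delta>\<close> \<open>Q\<ge>0\<close> by (intro mult_left_mono) auto
        also have "\<dots> = H * (Q / \<delta> ^ 3 * K)" by simp
        also have "\<dots> \<le> H0 * (Q / \<delta> ^ 3 * K + 1)"
          using H K0 \<open>0<\<delta>\<close> \<open>Q\<ge>0\<close> \<open>H0>0\<close> by (intro mult_mono) auto
        also have "\<dots> \<le> e / 8" using mult_right_mono[OF H0(2), of "Q / \<delta> ^ 3 * K + 1"] pos(1) by (simp del: distrib_left_numeral)
        finally show ?thesis .
      qed
      have "integral {\<alpha>..\<beta>} (\<lambda>w. h (w + H) * q \<eta> w) = integral {\<alpha> + H..\<beta> + H} (\<lambda>w. h w * q \<eta> (w - H))"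
        using integral_shift_real_ivl[of "\<alpha> + H" H "\<beta> + H" "\<lambda>w. h w * q \<eta> (w - H)"] by simp
      also have "\<dots> = integral {\<alpha> + H..\<beta>} (\<lambda>w. h w * q \<eta> (w - H)) + integral {\<beta>..\<beta> + H} (\<lambda>w. h w * q \<eta> (w - H))"
        by (rule Henstock_Kurzweil_Integration.integral_combine[symmetric, OF _ _ i4]) (use False H in auto)
      finally have s1: "integral {\<alpha>..\<beta>} (\<lambda>w. h (w + H) * q \<eta> w)
        = integral {\<alpha> + H..\<beta>} (\<lambda>w. h w * q \<eta> (w - H)) + integral {\<beta>..\<beta> + H} (\<lambda>w. h w * q \<eta> (w - H))" .
      have s2: "integral {\<alpha>..\<beta>} (\<lambda>w. h w * q \<eta> w)
        = integral {\<alpha>..\<alpha> + H} (\<lambda>w. h w * q \<eta> w) + integral {\<alpha> + H..\<beta>} (\<lambda>w. h w * q \<eta> w)"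
        by (rule Henstock_Kurzweil_Integration.integral_combine[symmetric, OF _ _ i2]) (use False H in auto)
      have e2: "norm (integral {\<beta>..\<beta> + H} (\<lambda>w. h w * q \<eta> (w - H))) \<le> Q * (\<beta> + H - \<beta>)"
        by (rule norm_integral_le) (use b4 ab False H in auto)
      have e3: "norm (integral {\<alpha>..\<alpha> + H} (\<lambda>w. h w * q \<eta> w)) \<le> Q * (\<alpha> + H - \<alpha>)"
        by (rule norm_integral_le) (use b2 ab H in auto)
      have e4: "norm (integral {\<alpha> + H..\<beta>} (\<lambda>w. h w * q \<eta> (w - H) - h w * q \<eta> w)) \<le> \<epsilon> * (\<beta> - (\<alpha> + H))"
      proof (rule norm_integral_le)
        fix w assume w: "w \<in> {\<alpha> + H..\<beta>}"
        have "dist (q \<eta> (w - H)) (q \<eta> w) < \<epsilon>"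
          by (rule d(2)) (use w ab H H0 d(1) in \<open>auto simp: dist_real_def\<close>)
        then have "norm (q \<eta> (w - H) - q \<eta> w) \<le> \<epsilon>" by (simp add: dist_norm)
        then show "norm (h w * q \<eta> (w - H) - h w * q \<eta> w) \<le> \<epsilon>"
          using mult_mono[OF h1[of w], of "norm (q \<eta> (w - H) - q \<eta> w)" \<epsilon>]
          by (simp add: norm_mult flip: right_diff_distrib)
      qed (measurable, use False in linarith)
      have i6: "(\<lambda>w. h w * q \<eta> (w - H)) integrable_on {\<alpha> + H..\<beta>}"
        "(\<lambda>w. h w * q \<eta> w) integrable_on {\<alpha> + H..\<beta>}"
        by (rule int[where B=Q]; use b4 b2 ab H in auto)+
      have Isplit: "?I = integral {\<alpha>..\<beta>} (\<lambda>w. ?A w - h (w + H) * q \<eta> w)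
         + integral {\<alpha> + H..\<beta>} (\<lambda>w. h w * q \<eta> (w - H) - h w * q \<eta> w)
         + integral {\<beta>..\<beta> + H} (\<lambda>w. h w * q \<eta> (w - H)) - integral {\<alpha>..\<alpha> + H} (\<lambda>w. h w * q \<eta> w)
         + integral {\<alpha>..\<beta>} (\<lambda>w. h w * of_real (r \<eta> w))"
        unfolding I integral_diff[OF i1 i3] integral_diff[OF i6] s1 s2 by simp
      have tri: "norm i \<le> a1 + a2 + a3 + a4 + a5"
        if "i = v1 + v2 + v3 - v4 + v5" "norm v1 \<le> a1" "norm v2 \<le> a2" "norm v3 \<le> a3" "norm v4 \<le> a4" "norm v5 \<le> a5"
        for i v1 v2 v3 v4 v5 :: complex and a1 a2 a3 a4 a5
      proof -
        have "norm i \<le> norm v1 + norm v2 + norm v3 + norm v4 + norm v5"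
          unfolding that(1) by (smt (verit) norm_triangle_ineq norm_triangle_ineq4)
        then show ?thesis using that by linarith
      qed
      have "norm ?I \<le> e / 8 + \<epsilon> * (\<beta> - (\<alpha> + H)) + Q * (\<beta> + H - \<beta>) + Q * (\<alpha> + H - \<alpha>) + e / 2"
        by (rule tri[OF Isplit e1 e4 e2 e3 e5])
      moreover have "Q * (\<beta> + H - \<beta>) + Q * (\<alpha> + H - \<alpha>) = 2 * Q * H" by (simp add: algebra_simps)
      moreover have "\<epsilon> * (\<beta> - (\<alpha> + H)) \<le> \<epsilon> * K"
        using ab H \<open>0<\<delta>\<close> \<open>\<epsilon> > 0\<close> by (intro mult_left_mono) auto
      moreover have "\<epsilon> * K = e / 8" using K0 by (simp add: \<epsilon>_def)
      moreover have "2 * Q * H \<le> e / 8"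
      proof -
        have "2 * Q * H \<le> (2 * Q + 1) * H0" using H \<open>Q\<ge>0\<close> by (intro mult_mono) auto
        also have "\<dots> \<le> e / 8" using mult_right_mono[OF H0(3), of "2 * Q + 1"] pos(2) by (simp add: mult.commute del: distrib_left_numeral distrib_right_numeral)
        finally show ?thesis .
      qed
      ultimately show ?thesis using \<open>0<e\<close> by linarith
    qed
    then show "norm (integral {\<alpha>..\<beta>} (\<lambda>w. cis (\<mu> / w) * \<psi> (\<mu> * w) / of_real w)) \<le> e"
      by (simp add: h_def)
  qed
qed

section \<open>The Riemann-Lebesgue lemma along the frequencies \<open>2 \<pi> N\<close>\<close>

lemma integral_split:
  fixes f :: "real \<Rightarrow> 'a::euclidean_space"
  assumes "a \<le> c" "c \<le> b" "f integrable_on {a..b}"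
  shows "integral {a..b} f = integral {a..c} f + integral {c..b} f"
  using Henstock_Kurzweil_Integration.integral_combine[OF assms] by simp

lemma sin_orthogonal:
  assumes "m \<noteq> 0" "n \<noteq> 0"
  shows "((\<lambda>u. sin (2 * pi * real m * u) * sin (2 * pi * real n * u)) has_integral
    (if m = n then real L / 2 else 0)) {0..real L}"
proof (cases "m = n")
  case True
  define w where "w = 2 * pi * real m"
  have w: "w \<noteq> 0" using assms by (simp add: w_def)
  have "((\<lambda>u. sin (w * u) * sin (w * u)) has_integral
     (real L / 2 - sin (2 * w * real L) / (4 * w) - (0 / 2 - sin (2 * w * 0) / (4 * w)))) {0..real L}"
  proof (rule fundamental_theorem_of_calculus)
    fix u :: real
    have "cos (2 * w * u) = 1 - 2 * (sin (w * u) * sin (w * u))"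
      using cos_double_sin[of "w * u"] by (simp add: power2_eq_square mult.assoc)
    then have e: "1 / 2 - cos (2 * w * u) / 2 = sin (w * u) * sin (w * u)" by (simp add: diff_divide_distrib)
    have "((\<lambda>u. u / 2 - sin (2 * w * u) / (4 * w)) has_real_derivative
       1 / 2 - cos (2 * w * u) / 2) (at u within {0..real L})"
      using w by (auto intro!: derivative_eq_intros)
    then show "((\<lambda>u. u / 2 - sin (2 * w * u) / (4 * w))
        has_vector_derivative sin (w * u) * sin (w * u)) (at u within {0..real L})"
      unfolding has_real_derivative_iff_has_vector_derivative e .
  qed simp
  moreover have "sin (2 * w * real L) = 0"
  proof -
    have "2 * w * real L = of_int (4 * int m * int L) * pi" by (simp add: w_def)
    then show ?thesis by (simp only: sin_zero_iff_int2) blast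
  qed
  ultimately show ?thesis using True by (simp add: w_def)
next
  case False
  define a where "a = 2 * pi * (real m - real n)"
  define b where "b = 2 * pi * (real m + real n)"
  have ab: "a \<noteq> 0" "b \<noteq> 0" using False assms by (auto simp: a_def b_def)
  have "((\<lambda>u. sin (2 * pi * real m * u) * sin (2 * pi * real n * u)) has_integral
     (sin (a * real L) / (2 * a) - sin (b * real L) / (2 * b)
     - (sin (a * 0) / (2 * a) - sin (b * 0) / (2 * b)))) {0..real L}"
  proof (rule fundamental_theorem_of_calculus)
    fix u :: real
    have "sin (2 * pi * real m * u) * sin (2 * pi * real n * u) = cos (a * u) / 2 - cos (b * u) / 2"
      unfolding sin_times_sin a_def b_def by (simp add: algebra_simps diff_divide_distrib)
    then show "((\<lambda>u. sin (a * u) / (2 * a) - sin (b * u) / (2 * b))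
        has_vector_derivative sin (2 * pi * real m * u) * sin (2 * pi * real n * u)) (at u within {0..real L})"
      unfolding has_real_derivative_iff_has_vector_derivative[symmetric] using ab
      by (auto intro!: derivative_eq_intros)
  qed simp
  moreover have "sin (a * real L) = 0"
  proof -
    have "a * real L = of_int ((int m - int n) * 2 * int L) * pi" by (simp add: a_def algebra_simps)
    then show ?thesis by (simp only: sin_zero_iff_int2) blast
  qed
  moreover have "sin (b * real L) = 0"
  proof -
    have "b * real L = of_int ((int m + int n) * 2 * int L) * pi" by (simp add: b_def algebra_simps)
    then show ?thesis by (simp only: sin_zero_iff_int2) blast
  qed
  ultimately show ?thesis using False by simp
qed

text \<open>
Bessel's inequality for the orthogonal system \<open>sin (2 \<pi> n u)\<close>. Restricting to integer frequencies avoids any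
approximation of \<open>f\<close>; it is enough because Dirichlet kernels contain only these frequencies.
\<close>

lemma riemann_lebesgue_sin_unit:
  fixes f :: "real \<Rightarrow> real"
  assumes [measurable]: "f \<in> borel_measurable borel" and fK: "\<And>u. \<bar>f u\<bar> \<le> K" and "L > 0"
  shows "(\<lambda>N. integral {0..real L} (\<lambda>u. f u * sin (2 * pi * real N * u))) \<longlonglongrightarrow> 0"
proof -
  define s where "s = (\<lambda>n u. sin (2 * pi * real (Suc n) * u))"
  have [measurable]: "s n \<in> borel_measurable borel" for n unfolding s_def by measurable
  define c where "c = (\<lambda>n. integral {0..real L} (\<lambda>u. f u * s n u))"
  \<comment> \<open>The remainder after projection onto the first \<open>N\<close> sines.\<close>
  define R where "R = (\<lambda>N u. f u - 2 / real L * (\<Sum>n<N. c n * s n u))"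
  have [measurable]: "R N \<in> borel_measurable borel" for N unfolding R_def by measurable
  have Rb: "\<bar>R N u\<bar> \<le> K + 2 / real L * (\<Sum>n<N. \<bar>c n\<bar>)" for N u
  proof -
    have "\<bar>\<Sum>n<N. c n * s n u\<bar> \<le> (\<Sum>n<N. \<bar>c n\<bar>)"
    proof (rule order_trans[OF sum_abs], rule sum_mono)
      show "\<bar>c n * s n u\<bar> \<le> \<bar>c n\<bar>" for n
        unfolding abs_mult s_def by (intro mult_left_le) auto
    qed
    then have "\<bar>2 / real L * (\<Sum>n<N. c n * s n u)\<bar> \<le> 2 / real L * (\<Sum>n<N. \<bar>c n\<bar>)"
      unfolding abs_mult using \<open>L>0\<close> by (simp add: divide_right_mono)
    then show ?thesis using fK[of u] unfolding R_def by linarith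
  qed
  have int: "g integrable_on {0..real L}" if "g \<in> borel_measurable borel" "\<And>u. \<bar>g u\<bar> \<le> B" for g and B :: real
    by (rule bounded_borel_integrable'[where K=B]) (use that in auto)
  have iRs: "(\<lambda>u. R N u * s m u) integrable_on {0..real L}" for N m
  proof (rule int)
    show "\<bar>R N u * s m u\<bar> \<le> (K + 2 / real L * (\<Sum>n<N. \<bar>c n\<bar>)) * 1" for u
      unfolding abs_mult using Rb[of N u] by (intro mult_mono) (auto simp: s_def)
  qed measurable
  have iRR: "(\<lambda>u. (R N u)\<^sup>2) integrable_on {0..real L}" for N
  proof (rule int)
    show "\<bar>(R N u)\<^sup>2\<bar> \<le> (K + 2 / real L * (\<Sum>n<N. \<bar>c n\<bar>))\<^sup>2" for u
      using power_mono[OF Rb[of N u], of 2] by simp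
  qed measurable
  have ss: "((\<lambda>u. s n u * s m u) has_integral (if n = m then real L / 2 else 0)) {0..real L}" for n m
    using sin_orthogonal[of "Suc n" "Suc m" L] by (simp add: s_def)
  have RSuc: "R (Suc N) u = R N u - 2 / real L * c N * s N u" for N u
    by (simp add: R_def algebra_simps add_divide_distrib)
  have Rs: "N \<le> m \<Longrightarrow> integral {0..real L} (\<lambda>u. R N u * s m u) = c m" for N m
  proof (induction N)
    case 0 then show ?case by (simp add: R_def c_def)
  next
    case (Suc N)
    have "((\<lambda>u. R N u * s m u - 2 / real L * c N * (s N u * s m u)) has_integral
        (integral {0..real L} (\<lambda>u. R N u * s m u) - 2 / real L * c N * (if N = m then real L / 2 else 0))) {0..real L}"
      by (intro has_integral_diff has_integral_mult_right ss integrable_integral iRs)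
    then have "integral {0..real L} (\<lambda>u. R (Suc N) u * s m u) = integral {0..real L} (\<lambda>u. R N u * s m u)"
      using Suc.prems by (simp add: integral_unique RSuc algebra_simps)
    then show ?case using Suc by simp
  qed
  have bessel: "integral {0..real L} (\<lambda>u. (R N u)\<^sup>2) = integral {0..real L} (\<lambda>u. (f u)\<^sup>2) - 2 / real L * (\<Sum>n<N. (c n)\<^sup>2)" for N
  proof (induction N)
    case 0 then show ?case by (simp add: R_def)
  next
    case (Suc N)
    have "((\<lambda>u. (R N u)\<^sup>2 - 2 * (2 / real L * c N) * (R N u * s N u) + (2 / real L * c N)\<^sup>2 * (s N u * s N u)) has_integral
        (integral {0..real L} (\<lambda>u. (R N u)\<^sup>2) - 2 * (2 / real L * c N) * c N + (2 / real L * c N)\<^sup>2 * (if N = N then real L / 2 else 0))) {0..real L}"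
      using Rs[of N N]
      by (intro has_integral_add has_integral_diff has_integral_mult_right ss integrable_integral iRR)
         (use integrable_integral[OF iRs[of N N]] in simp)
    moreover have "(\<lambda>u. (R (Suc N) u)\<^sup>2)
       = (\<lambda>u. (R N u)\<^sup>2 - 2 * (2 / real L * c N) * (R N u * s N u) + (2 / real L * c N)\<^sup>2 * (s N u * s N u))"
      unfolding RSuc by (auto simp: power2_eq_square algebra_simps)
    ultimately have "integral {0..real L} (\<lambda>u. (R (Suc N) u)\<^sup>2)
       = integral {0..real L} (\<lambda>u. (R N u)\<^sup>2) - 2 * (2 / real L * c N) * c N + (2 / real L * c N)\<^sup>2 * (real L / 2)"
      by (simp add: integral_unique)
    also have "\<dots> = integral {0..real L} (\<lambda>u. (R N u)\<^sup>2) - 2 / real L * (c N)\<^sup>2"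
      using \<open>L > 0\<close> by (simp add: power2_eq_square field_simps)
    finally show ?case using Suc by (simp add: algebra_simps add_divide_distrib)
  qed
  have "summable (\<lambda>n. (c n)\<^sup>2)"
  proof (rule bounded_imp_summable)
    fix N
    have "0 \<le> integral {0..real L} (\<lambda>u. (R (Suc N) u)\<^sup>2)" by (rule integral_nonneg[OF iRR]) simp
    then have "2 / real L * (\<Sum>n<Suc N. (c n)\<^sup>2) \<le> integral {0..real L} (\<lambda>u. (f u)\<^sup>2)"
      unfolding bessel by simp
    then show "(\<Sum>n\<le>N. (c n)\<^sup>2) \<le> real L / 2 * integral {0..real L} (\<lambda>u. (f u)\<^sup>2)"
      using \<open>L > 0\<close> by (simp add: field_simps lessThan_Suc_atMost del: sum.lessThan_Suc)
  qed simp
  then have "(\<lambda>n. (c n)\<^sup>2) \<longlonglongrightarrow> 0" by (rule summable_LIMSEQ_zero)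
  then have "(\<lambda>n. sqrt ((c n)\<^sup>2)) \<longlonglongrightarrow> sqrt 0" by (rule tendsto_real_sqrt)
  then have "c \<longlonglongrightarrow> 0" by (simp add: tendsto_rabs_zero_iff)
  then show ?thesis
    unfolding c_def s_def by (subst filterlim_sequentially_Suc[symmetric])
qed

lemma riemann_lebesgue_sin:
  fixes f :: "real \<Rightarrow> real"
  assumes [measurable]: "f \<in> borel_measurable borel" and fK: "\<And>u. u \<in> {a..b} \<Longrightarrow> \<bar>f u\<bar> \<le> K" and "0 \<le> a"
  shows "(\<lambda>N. integral {a..b} (\<lambda>u. f u * sin (2 * pi * real N * u))) \<longlonglongrightarrow> 0"
proof -
  define L where "L = Suc (nat \<lceil>b\<rceil>)"
  have L: "L > 0" "b \<le> real L" unfolding L_def by linarith+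
  define g where "g = (\<lambda>u. if u \<in> {a..b} then f u else 0)"
  have [measurable]: "g \<in> borel_measurable borel" unfolding g_def by measurable
  have "(\<lambda>N. integral {0..real L} (\<lambda>u. g u * sin (2 * pi * real N * u))) \<longlonglongrightarrow> 0"
    by (rule riemann_lebesgue_sin_unit[where K="max K 0"]) (use fK L in \<open>auto simp: g_def le_max_iff_disj\<close>)
  moreover have "integral {0..real L} (\<lambda>u. g u * sin (2 * pi * real N * u)) = integral {a..b} (\<lambda>u. f u * sin (2 * pi * real N * u))" for N
  proof -
    have "(\<lambda>u. g u * sin (2 * pi * real N * u)) = (\<lambda>u. if u \<in> {a..b} then f u * sin (2 * pi * real N * u) else 0)"
      by (auto simp: g_def)
    moreover have "{a..b} \<inter> {0..real L} = {a..b}" using L \<open>0 \<le> a\<close> by auto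
    ultimately show ?thesis by (simp only: integral_restrict_Int)
  qed
  ultimately show ?thesis by simp
qed

lemma riemann_lebesgue_sin_complex:
  fixes f :: "real \<Rightarrow> complex"
  assumes [measurable]: "f \<in> borel_measurable borel" and fK: "\<And>u. u \<in> {a..b} \<Longrightarrow> norm (f u) \<le> K" and "0 \<le> a"
  shows "(\<lambda>N. integral {a..b} (\<lambda>u. f u * of_real (sin (2 * pi * real N * u)))) \<longlonglongrightarrow> 0"
proof -
  have int: "(\<lambda>u. f u * of_real (sin (2 * pi * real N * u))) integrable_on {a..b}" for N
  proof (rule bounded_borel_integrable'[where K="K * 1"])
    show "norm (f u * of_real (sin (2 * pi * real N * u))) \<le> K * 1" if "u \<in> {a..b}" for u
      unfolding norm_mult using fK[OF that] by (intro mult_mono) (auto intro: order_trans[OF norm_ge_zero])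
  qed measurable
  have 1: "(\<lambda>N. integral {a..b} (\<lambda>u. Re (f u) * sin (2 * pi * real N * u))) \<longlonglongrightarrow> 0"
    by (rule riemann_lebesgue_sin[where K=K])
       (use fK \<open>0\<le>a\<close> abs_Re_le_cmod in \<open>auto intro: order_trans\<close>)
  have 2: "(\<lambda>N. integral {a..b} (\<lambda>u. Im (f u) * sin (2 * pi * real N * u))) \<longlonglongrightarrow> 0"
    by (rule riemann_lebesgue_sin[where K=K])
       (use fK \<open>0\<le>a\<close> abs_Im_le_cmod in \<open>auto intro: order_trans\<close>)
  have R: "Re (integral {a..b} (\<lambda>u. f u * of_real (sin (2 * pi * real N * u)))) = integral {a..b} (\<lambda>u. Re (f u) * sin (2 * pi * real N * u))" for N
    using integral_linear[OF int[of N] bounded_linear_Re] by (simp add: o_def)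
  have I: "Im (integral {a..b} (\<lambda>u. f u * of_real (sin (2 * pi * real N * u)))) = integral {a..b} (\<lambda>u. Im (f u) * sin (2 * pi * real N * u))" for N
    using integral_linear[OF int[of N] bounded_linear_Im] by (simp add: o_def)
  show ?thesis
    by (rule tendsto_complex_iff[THEN iffD2]) (use 1 2 in \<open>simp add: R I\<close>)
qed

section \<open>Chirps away from resonance\<close>

text \<open>
A common form of the two oscillating factors that occur: \<open>\<omega>\<^sup>\<lfloor>\<^sup>y\<^sup>\<rfloor>\<close> for \<open>c = 0\<close>, which comes from partial sums
of \<open>\<omega>\<^sup>n\<close>, and the pure exponential \<open>cis y\<close> for \<open>\<omega> = cis 1\<close>, \<open>c = 1\<close>. All that matters is
\<open>chirp (y + 1) = \<omega> chirp y\<close> and smoothness between consecutive integers.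
\<close>

definition chirp :: "complex \<Rightarrow> real \<Rightarrow> real \<Rightarrow> complex" where
  "chirp \<omega> c y = \<omega> ^ nat \<lfloor>y\<rfloor> * cis (c * (y - real (nat \<lfloor>y\<rfloor>)))"

lemma norm_chirp: "norm \<omega> = 1 \<Longrightarrow> norm (chirp \<omega> c y) = 1"
  by (simp add: chirp_def norm_mult norm_power)

lemma chirp_shift: "y \<ge> 0 \<Longrightarrow> chirp \<omega> c (y + 1) = \<omega> * chirp \<omega> c y"
  by (simp add: chirp_def nat_add_distrib algebra_simps)

lemma cnj_chirp: "cnj (chirp \<omega> c y) = chirp (cnj \<omega>) (- c) y"
  by (simp add: chirp_def cis_cnj)

lemma borel_measurable_chirp [measurable]: "chirp \<omega> c \<in> borel_measurable borel"
proof -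
  have "(\<lambda>y::real. nat \<lfloor>y\<rfloor>) \<in> measurable borel (count_space UNIV)" by measurable
  from measurable_compose[OF this, of "\<lambda>n. \<omega> ^ n" borel]
  have [measurable]: "(\<lambda>y::real. \<omega> ^ nat \<lfloor>y\<rfloor>) \<in> borel_measurable borel" by simp
  show ?thesis unfolding chirp_def[abs_def] by measurable
qed

lemma chirp_on: "real n \<le> y \<Longrightarrow> y < real n + 1 \<Longrightarrow> chirp \<omega> c y = \<omega> ^ n * cis (c * (y - real n))"
proof -
  assume "real n \<le> y" "y < real n + 1"
  then have "\<lfloor>y\<rfloor> = int n" by linarith
  then show ?thesis by (simp add: chirp_def)
qed

text \<open>
The factor \<open>sin (2 \<pi> M u) / u\<close> together with the measure, after the substitution \<open>u = x / y\<close>, with \<open>L = 2 \<pi> M x\<close>.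
\<close>

definition osc_kernel :: "real \<Rightarrow> real \<Rightarrow> real" where
  "osc_kernel L y = sin (L / y) / y"

lemma borel_measurable_osc_kernel [measurable]: "osc_kernel L \<in> borel_measurable borel"
  unfolding osc_kernel_def[abs_def] by measurable

lemma osc_kernel_bound: "y > 0 \<Longrightarrow> \<bar>osc_kernel L y\<bar> \<le> 1 / y"
  by (simp add: osc_kernel_def abs_divide divide_right_mono)

lemma osc_integrand_bound:
  assumes "norm \<omega> = 1" "u \<in> {a..b}" "a > 0"
  shows "norm (of_real (osc_kernel L u) * chirp \<omega> c u) \<le> 1 / a"
proof -
  have "norm (of_real (osc_kernel L u) * chirp \<omega> c u) \<le> 1 / u"
    using osc_kernel_bound[of u L] assms by (simp add: norm_mult norm_chirp)
  also have "\<dots> \<le> 1 / a" using assms by (intro frac_le) auto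
  finally show ?thesis .
qed

lemma osc_integrable:
  assumes "norm \<omega> = 1" "a > 0"
  shows "(\<lambda>y. of_real (osc_kernel L y) * chirp \<omega> c y) integrable_on {a..b}"
  by (rule bounded_borel_integrable'[where K="1/a"]) (use osc_integrand_bound assms in auto)

definition osc_piece :: "real \<Rightarrow> real \<Rightarrow> nat \<Rightarrow> complex" where
  "osc_piece c L n = integral {0..1} (\<lambda>\<tau>. of_real (osc_kernel L (real n + \<tau>)) * cis (c * \<tau>))"

lemma osc_piece_integral:
  "integral {real n..real (Suc n)} (\<lambda>y. of_real (osc_kernel L y) * chirp \<omega> c y) = \<omega> ^ n * osc_piece c L n"
proof -
  have "integral {real n..real (Suc n)} (\<lambda>y. of_real (osc_kernel L y) * chirp \<omega> c y)
     = integral {0..1} (\<lambda>\<tau>. of_real (osc_kernel L (\<tau> + real n)) * chirp \<omega> c (\<tau> + real n))"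
    using integral_shift_real_ivl[of "real n" "real n" "real (Suc n)" "\<lambda>y. of_real (osc_kernel L y) * chirp \<omega> c y"]
    by simp
  also have "\<dots> = integral {0..1} (\<lambda>\<tau>. \<omega> ^ n * (of_real (osc_kernel L (real n + \<tau>)) * cis (c * \<tau>)))"
  proof (rule integral_spike[of "{1}"])
    show "\<omega> ^ n * (of_real (osc_kernel L (real n + \<tau>)) * cis (c * \<tau>)) = of_real (osc_kernel L (\<tau> + real n)) * chirp \<omega> c (\<tau> + real n)"
      if "\<tau> \<in> {0..1} - {1}" for \<tau>
      using chirp_on[of n "\<tau> + real n" \<omega> c] that by (simp add: add.commute)
  qed simp
  finally show ?thesis by (simp add: osc_piece_def)
qed

lemma osc_integral_sum:
  assumes "norm \<omega> = 1" "1 \<le> p" "p \<le> q"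
  shows "integral {real p..real q} (\<lambda>y. of_real (osc_kernel L y) * chirp \<omega> c y) = (\<Sum>n=p..<q. \<omega> ^ n * osc_piece c L n)"
  using assms(3)
proof (induction q rule: dec_induct)
  case base then show ?case by simp
next
  case (step q)
  have "integral {real p..real (Suc q)} (\<lambda>y. of_real (osc_kernel L y) * chirp \<omega> c y)
     = integral {real p..real q} (\<lambda>y. of_real (osc_kernel L y) * chirp \<omega> c y)
     + integral {real q..real (Suc q)} (\<lambda>y. of_real (osc_kernel L y) * chirp \<omega> c y)"
    by (rule integral_split) (use step assms in \<open>auto intro!: osc_integrable\<close>)
  then show ?case using step by (simp only: osc_piece_integral sum.atLeastLessThan_Suc)
qed

lemma osc_piece_integrable:
  assumes "n \<ge> 1"
  shows "(\<lambda>\<tau>. of_real (osc_kernel L (real n + \<tau>)) * cis (c * \<tau>)) integrable_on {0..1}"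
proof (rule bounded_borel_integrable'[where K=1])
  show "norm (of_real (osc_kernel L (real n + \<tau>)) * cis (c * \<tau>)) \<le> 1" if "\<tau> \<in> {0..1}" for \<tau>
  proof -
    have "\<bar>osc_kernel L (real n + \<tau>)\<bar> \<le> 1 / (real n + \<tau>)"
      using osc_kernel_bound[of "real n + \<tau>" L] that assms by simp
    also have "\<dots> \<le> 1" using that assms by simp
    finally show ?thesis by (simp add: norm_mult)
  qed
qed measurable

lemma osc_piece_le: "n \<ge> 1 \<Longrightarrow> norm (osc_piece c L n) \<le> 1 / real n"
proof -
  assume n: "n \<ge> 1"
  have "norm (osc_piece c L n) \<le> 1 / real n * (1 - 0)"
    unfolding osc_piece_def
  proof (rule norm_integral_le)
    fix \<tau> :: real assume t: "\<tau> \<in> {0..1}"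
    have "\<bar>osc_kernel L (real n + \<tau>)\<bar> \<le> 1 / (real n + \<tau>)"
      using osc_kernel_bound[of "real n + \<tau>" L] t n by simp
    also have "\<dots> \<le> 1 / real n" using t n by (intro frac_le) auto
    finally show "norm (of_real (osc_kernel L (real n + \<tau>)) * cis (c * \<tau>)) \<le> 1 / real n"
      by (simp add: norm_mult)
  qed auto
  then show ?thesis by simp
qed

text \<open>
For \<open>y\<close> well below \<open>\<surd>L\<close> the kernel oscillates faster than the chirp: it is almost the derivative of
\<open>(y / L) cos (L / y)\<close>, and integration by parts leaves terms of size \<open>n / L\<close>.
\<close>

lemma osc_piece_low:
  assumes "n \<ge> 1" "L > 0"
  shows "norm (osc_piece c L n) \<le> (3 + \<bar>c\<bar>) * real (Suc n) / L"
proof -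
  define h where "h = (\<lambda>\<tau>::real. of_real ((real n + \<tau>) / L * cos (L / (real n + \<tau>))) * cis (c * \<tau>))"
  define k where "k = (\<lambda>\<tau>::real. of_real (cos (L / (real n + \<tau>)) / L) * cis (c * \<tau>)
      + of_real ((real n + \<tau>) / L * cos (L / (real n + \<tau>))) * (of_real c * \<i> * cis (c * \<tau>)))"
  have "((\<lambda>\<tau>. of_real (osc_kernel L (real n + \<tau>)) * cis (c * \<tau>) + k \<tau>) has_integral (h 1 - h 0)) {0..1}"
  proof (rule fundamental_theorem_of_calculus)
    fix \<tau> :: real assume t: "\<tau> \<in> {0..1}"
    have nt: "real n + \<tau> > 0" using t assms by simp
    have 1: "((\<lambda>\<tau>. (real n + \<tau>) / L * cos (L / (real n + \<tau>))) has_real_derivative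
       cos (L / (real n + \<tau>)) / L + osc_kernel L (real n + \<tau>)) (at \<tau> within {0..1})"
    proof -
      have "((\<lambda>\<tau>. (real n + \<tau>) / L * cos (L / (real n + \<tau>))) has_real_derivative
         (1 / L) * cos (L / (real n + \<tau>)) + (- sin (L / (real n + \<tau>)) * (- L / (real n + \<tau>)\<^sup>2)) * ((real n + \<tau>) / L)) (at \<tau> within {0..1})"
        using nt assms by (auto intro!: derivative_eq_intros simp: power2_eq_square add_divide_distrib)
      also have "(1 / L) * cos (L / (real n + \<tau>)) + (- sin (L / (real n + \<tau>)) * (- L / (real n + \<tau>)\<^sup>2)) * ((real n + \<tau>) / L)
         = cos (L / (real n + \<tau>)) / L + osc_kernel L (real n + \<tau>)"
      proof -
        have "(1 / L) * C + (- S * (- L / X\<^sup>2)) * (X / L) = C / L + S / X" if "X > 0" for C S X :: real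
          using that assms by (simp add: power2_eq_square add_divide_distrib)
        from this[OF nt] show ?thesis by (simp only: osc_kernel_def)
      qed
      finally show ?thesis .
    qed
    have 2: "((\<lambda>\<tau>. of_real ((real n + \<tau>) / L * cos (L / (real n + \<tau>))) :: complex) has_vector_derivative
        of_real (cos (L / (real n + \<tau>)) / L + osc_kernel L (real n + \<tau>))) (at \<tau> within {0..1})"
      by (rule has_vector_derivative_of_real[OF 1])
    have 3: "((\<lambda>\<tau>. cis (c * \<tau>)) has_vector_derivative of_real c * \<i> * cis (c * \<tau>)) (at \<tau> within {0..1})"
      by (rule cis_has_vector_derivative)
    show "(h has_vector_derivative of_real (osc_kernel L (real n + \<tau>)) * cis (c * \<tau>) + k \<tau>) (at \<tau> within {0..1})"
      using has_vector_derivative_mult[OF 2 3] unfolding h_def k_def by (simp add: algebra_simps)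
  qed simp
  moreover have ik: "k integrable_on {0..1}"
    unfolding k_def using assms by (intro integrable_continuous_real continuous_intros) auto
  ultimately have eq: "osc_piece c L n = h 1 - h 0 - integral {0..1} k"
    using integral_add[OF osc_piece_integrable[OF assms(1)] ik, of L c]
    by (simp add: osc_piece_def integral_unique)
  moreover have hb: "norm (h \<tau>) \<le> real (Suc n) / L" if "\<tau> \<in> {0..1}" for \<tau>
  proof -
    have "norm (h \<tau>) = (real n + \<tau>) / L * \<bar>cos (L / (real n + \<tau>))\<bar>"
      unfolding h_def norm_mult norm_of_real norm_cis abs_mult using that assms by simp
    also have "\<dots> \<le> real (Suc n) / L * 1"
      using that assms by (intro mult_mono divide_right_mono) auto
    finally show ?thesis by simp
  qed
  moreover have "norm (integral {0..1} k) \<le> (1 + \<bar>c\<bar>) * real (Suc n) / L * (1 - 0)"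
  proof (rule norm_integral_le)
    show "k \<in> borel_measurable borel" unfolding k_def by measurable
    fix \<tau> :: real assume t: "\<tau> \<in> {0..1}"
    have "norm (k \<tau>) \<le> \<bar>cos (L / (real n + \<tau>))\<bar> / L + norm (h \<tau>) * \<bar>c\<bar>"
      unfolding k_def h_def
      by (rule order_trans[OF norm_triangle_ineq], unfold norm_mult norm_of_real norm_cis norm_ii abs_divide)
         (use assms in simp)
    also have "\<dots> \<le> real (Suc n) / L + (real (Suc n) / L) * \<bar>c\<bar>"
      using hb[OF t] assms abs_cos_le_one[of "L / (real n + \<tau>)"]
      by (intro add_mono mult_right_mono divide_right_mono order_trans[OF abs_cos_le_one]) auto
    finally show "norm (k \<tau>) \<le> (1 + \<bar>c\<bar>) * real (Suc n) / L" by (simp add: algebra_simps add_divide_distrib)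
  qed simp
  moreover have "norm (h 0) \<le> real (Suc n) / L" "norm (h 1) \<le> real (Suc n) / L"
    by (rule hb; simp)+
  ultimately have "norm (osc_piece c L n) \<le> real (Suc n) / L + real (Suc n) / L + (1 + \<bar>c\<bar>) * real (Suc n) / L"
    using norm_triangle_ineq4[of "h 1 - h 0" "integral {0..1} k"] norm_triangle_ineq4[of "h 1" "h 0"]
    unfolding eq diff_zero mult_1_right by linarith
  also have "\<dots> = (3 + \<bar>c\<bar>) * real (Suc n) / L" by (simp add: algebra_simps add_divide_distrib)
  finally show ?thesis .
qed

lemma osc_kernel_lipschitz:
  assumes "n > 0" "L > 0" "n \<le> a" "n \<le> b"
  shows "\<bar>osc_kernel L a - osc_kernel L b\<bar> \<le> (L / n ^ 3 + 1 / n\<^sup>2) * \<bar>a - b\<bar>"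
proof -
  have "norm (osc_kernel L a - osc_kernel L b) \<le> (L / n ^ 3 + 1 / n\<^sup>2) * norm (a - b)"
  proof (rule field_differentiable_bound[of "{n..}"])
    fix y assume y: "y \<in> {n..}"
    then have y0: "y > 0" using assms by simp
    show "(osc_kernel L has_field_derivative ((cos (L / y) * (- L / y\<^sup>2)) * y - sin (L / y)) / y\<^sup>2) (at y within {n..})"
      unfolding osc_kernel_def[abs_def] using y0
      by (auto intro!: derivative_eq_intros simp: power2_eq_square)
    have "((cos (L / y) * (- L / y\<^sup>2)) * y - sin (L / y)) / y\<^sup>2 = - (L * cos (L / y) / y ^ 3) - sin (L / y) / y\<^sup>2"
      using y0 by (simp add: power2_eq_square power3_eq_cube diff_divide_distrib ac_simps)
    also have "\<bar>\<dots>\<bar> \<le> L * \<bar>cos (L / y)\<bar> / y ^ 3 + \<bar>sin (L / y)\<bar> / y\<^sup>2"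
      by (rule order_trans[OF abs_triangle_ineq4]) (use y0 assms in \<open>simp add: abs_mult abs_divide\<close>)
    also have "\<dots> \<le> L * 1 / n ^ 3 + 1 / n\<^sup>2"
      using y y0 assms by (intro add_mono frac_le mult_left_mono power_mono mult_nonneg_nonneg zero_less_power) auto
    finally show "norm (((cos (L / y) * (- L / y\<^sup>2)) * y - sin (L / y)) / y\<^sup>2) \<le> L / n ^ 3 + 1 / n\<^sup>2" by simp
  qed (use assms in auto)
  then show ?thesis by simp
qed

lemma osc_piece_diff:
  assumes "n \<ge> 1" "L > 0"
  shows "norm (osc_piece c L (Suc n) - osc_piece c L n) \<le> L / real n ^ 3 + 1 / (real n)\<^sup>2"
proof -
  have "osc_piece c L (Suc n) - osc_piece c L n = integral {0..1} (\<lambda>\<tau>. of_real (osc_kernel L (real (Suc n) + \<tau>)) * cis (c * \<tau>)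
      - of_real (osc_kernel L (real n + \<tau>)) * cis (c * \<tau>))"
    unfolding osc_piece_def
    by (rule integral_diff[symmetric, OF osc_piece_integrable osc_piece_integrable]) (use assms in auto)
  also have "norm \<dots> \<le> (L / real n ^ 3 + 1 / (real n)\<^sup>2) * (1 - 0)"
  proof (rule norm_integral_le)
    fix \<tau> :: real assume t: "\<tau> \<in> {0..1}"
    have "norm (of_real (osc_kernel L (real (Suc n) + \<tau>)) * cis (c * \<tau>) - of_real (osc_kernel L (real n + \<tau>)) * cis (c * \<tau>))
       = \<bar>osc_kernel L (real (Suc n) + \<tau>) - osc_kernel L (real n + \<tau>)\<bar>"
      by (simp flip: left_diff_distrib of_real_diff add: norm_mult)
    also have "\<dots> \<le> (L / real n ^ 3 + 1 / (real n)\<^sup>2) * \<bar>(real (Suc n) + \<tau>) - (real n + \<tau>)\<bar>"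
      by (rule osc_kernel_lipschitz) (use assms t in auto)
    finally show "norm (of_real (osc_kernel L (real (Suc n) + \<tau>)) * cis (c * \<tau>) - of_real (osc_kernel L (real n + \<tau>)) * cis (c * \<tau>))
       \<le> L / real n ^ 3 + 1 / (real n)\<^sup>2" by simp
  qed auto
  finally show ?thesis by simp
qed

lemma sum_inverse_square_tail:
  assumes "1 \<le> p" "p \<le> q"
  shows "(\<Sum>n=p..<q. 1 / (real n)\<^sup>2) \<le> 2 / real p - 2 / real q"
  using assms(2)
proof (induction q rule: dec_induct)
  case (step q)
  have q: "q \<ge> 1" using step assms by simp
  have "1 / (real q)\<^sup>2 \<le> 2 / real q - 2 / real (Suc q)"
    using q by (simp add: divide_simps power2_eq_square)
  then show ?case using step by simp
qed simp

text \<open>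
For \<open>y\<close> well above \<open>\<surd>L\<close> the pieces vary slowly, and summation by parts uses the cancellation in
\<open>\<Sum> \<omega>\<^sup>n\<close>, which is where \<open>\<omega> \<noteq> 1\<close> enters.
\<close>

lemma osc_high:
  assumes \<omega>: "norm \<omega> = 1" and "1 \<le> p" "p \<le> q" "L > 0"
  shows "norm (1 - \<omega>) * norm (\<Sum>n=p..<q. \<omega> ^ n * osc_piece c L n) \<le> 4 / real p + 2 * L / (real p)\<^sup>2"
proof -
  let ?b = "osc_piece c L"
  have "(1 - \<omega>) * (\<Sum>n=p..<q. \<omega> ^ n * ?b n) + \<omega> ^ q * ?b q - \<omega> ^ p * ?b p = (\<Sum>n=p..<q. \<omega> ^ Suc n * (?b (Suc n) - ?b n))"
    using \<open>p \<le> q\<close>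
  proof (induction q rule: dec_induct)
    case (step q)
    have "(1 - \<omega>) * (\<Sum>n=p..<Suc q. \<omega> ^ n * ?b n) + \<omega> ^ Suc q * ?b (Suc q) - \<omega> ^ p * ?b p
       = ((1 - \<omega>) * (\<Sum>n=p..<q. \<omega> ^ n * ?b n) + \<omega> ^ q * ?b q - \<omega> ^ p * ?b p) + \<omega> ^ Suc q * (?b (Suc q) - ?b q)"
      using step.hyps by (simp add: sum.atLeastLessThan_Suc algebra_simps)
    then show ?case using step by simp
  qed simp
  then have eq: "(1 - \<omega>) * (\<Sum>n=p..<q. \<omega> ^ n * ?b n) = (\<Sum>n=p..<q. \<omega> ^ Suc n * (?b (Suc n) - ?b n)) - \<omega> ^ q * ?b q + \<omega> ^ p * ?b p"
    by (simp add: algebra_simps)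
  have p0: "real p > 0" using assms by simp
  have "norm (\<Sum>n=p..<q. \<omega> ^ Suc n * (?b (Suc n) - ?b n)) \<le> (\<Sum>n=p..<q. (L / real p + 1) * (1 / (real n)\<^sup>2))"
  proof (rule sum_norm_le)
    fix n assume n: "n \<in> {p..<q}"
    have "norm (\<omega> ^ Suc n * (?b (Suc n) - ?b n)) \<le> L / real n ^ 3 + 1 / (real n)\<^sup>2"
      using osc_piece_diff[of n L c] n assms by (simp add: norm_mult norm_power \<omega>)
    also have "L / real n ^ 3 = L / real n * (1 / (real n)\<^sup>2)" by (simp add: power3_eq_cube power2_eq_square)
    also have "\<dots> \<le> L / real p * (1 / (real n)\<^sup>2)"
      using n assms p0 by (intro mult_right_mono frac_le) auto
    finally show "norm (\<omega> ^ Suc n * (?b (Suc n) - ?b n)) \<le> (L / real p + 1) * (1 / (real n)\<^sup>2)"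
      by (simp only: distrib_right mult_1)
  qed
  also have "\<dots> = (L / real p + 1) * (\<Sum>n=p..<q. 1 / (real n)\<^sup>2)" by (rule sum_distrib_left[symmetric])
  also have "\<dots> \<le> (L / real p + 1) * (2 / real p)"
    using sum_inverse_square_tail[of p q] assms p0
    by (intro mult_left_mono) (auto intro: order_trans)
  finally have 1: "norm (\<Sum>n=p..<q. \<omega> ^ Suc n * (?b (Suc n) - ?b n)) \<le> (L / real p + 1) * (2 / real p)" .
  have 2: "norm (\<omega> ^ q * ?b q) \<le> 1 / real p"
  proof -
    have "norm (?b q) \<le> 1 / real q" using osc_piece_le[of q c L] assms by simp
    also have "\<dots> \<le> 1 / real p" using assms p0 by (intro frac_le) auto
    finally show ?thesis by (simp add: norm_mult norm_power \<omega>)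
  qed
  have 3: "norm (\<omega> ^ p * ?b p) \<le> 1 / real p"
    using osc_piece_le[of p c L] assms by (simp add: norm_mult norm_power)
  have "norm ((1 - \<omega>) * (\<Sum>n=p..<q. \<omega> ^ n * ?b n)) \<le> (L / real p + 1) * (2 / real p) + 1 / real p + 1 / real p"
    unfolding eq using 1 2 3
    by (smt (verit) norm_triangle_ineq norm_triangle_ineq4)
  also have "\<dots> = 4 / real p + 2 * L / (real p)\<^sup>2"
    by (simp add: algebra_simps power2_eq_square add_divide_distrib)
  finally show ?thesis by (simp add: norm_mult)
qed

section \<open>Chirps integrated against \<open>sin (2 \<pi> M u) / u\<close>\<close>

text \<open>
The substitution \<open>y = \<surd>L w\<close> brings the resonant range to fixed size. The sine is split into two exponentials, and the
one with negative phase is the conjugate of the other for the conjugate chirp.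
\<close>

lemma osc_resonant_range:
  assumes \<omega>: "norm \<omega> = 1" and "0 < \<delta>" "\<delta> \<le> K" "0 < e"
  shows "\<exists>L0>0. \<forall>L\<ge>L0. \<forall>p q. \<delta> * sqrt L \<le> p \<longrightarrow> p \<le> q \<longrightarrow> q \<le> K * sqrt L \<longrightarrow>
    norm (integral {p..q} (\<lambda>y. of_real (osc_kernel L y) * chirp \<omega> c y)) \<le> e"
proof -
  have \<omega>': "norm (cnj \<omega>) = 1" using \<omega> by simp
  obtain \<mu>1 where \<mu>1: "\<mu>1 > 0" "\<And>\<mu> \<alpha> \<beta>. \<mu> \<ge> \<mu>1 \<Longrightarrow> \<delta> \<le> \<alpha> \<Longrightarrow> \<alpha> \<le> \<beta> \<Longrightarrow> \<beta> \<le> K \<Longrightarrow>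
    norm (integral {\<alpha>..\<beta>} (\<lambda>w. cis (\<mu> / w) * chirp \<omega> c (\<mu> * w) / of_real w)) \<le> e"
    using resonant_range[OF borel_measurable_chirp, of \<omega> c \<omega> \<delta> K e] norm_chirp[OF \<omega>] chirp_shift \<omega> assms by auto
  obtain \<mu>2 where \<mu>2: "\<mu>2 > 0" "\<And>\<mu> \<alpha> \<beta>. \<mu> \<ge> \<mu>2 \<Longrightarrow> \<delta> \<le> \<alpha> \<Longrightarrow> \<alpha> \<le> \<beta> \<Longrightarrow> \<beta> \<le> K \<Longrightarrow>
    norm (integral {\<alpha>..\<beta>} (\<lambda>w. cis (\<mu> / w) * chirp (cnj \<omega>) (-c) (\<mu> * w) / of_real w)) \<le> e"
    using resonant_range[OF borel_measurable_chirp, of "cnj \<omega>" "-c" "cnj \<omega>" \<delta> K e] norm_chirp[OF \<omega>'] chirp_shift \<omega>' assms by auto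
  show ?thesis
  proof (intro exI[of _ "(max \<mu>1 \<mu>2)\<^sup>2"] conjI allI impI)
    show "(max \<mu>1 \<mu>2)\<^sup>2 > 0" using \<mu>1 \<mu>2 by simp
    fix L p q :: real
    assume L: "(max \<mu>1 \<mu>2)\<^sup>2 \<le> L" and pq: "\<delta> * sqrt L \<le> p" "p \<le> q" "q \<le> K * sqrt L"
    define \<mu> where "\<mu> = sqrt L"
    have \<mu>: "\<mu> \<ge> \<mu>1" "\<mu> \<ge> \<mu>2" using real_le_rsqrt[OF L] by (auto simp: \<mu>_def)
    have \<mu>0: "\<mu> > 0" using \<mu> \<mu>1 by simp
    have L\<mu>: "L = \<mu> * \<mu>" using \<mu>0 by (simp add: \<mu>_def)
    have p0: "p > 0" using pq \<mu>0 \<open>0<\<delta>\<close> by (smt (verit) \<mu>_def mult_pos_pos)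
    have rng: "\<delta> \<le> p / \<mu>" "p / \<mu> \<le> q / \<mu>" "q / \<mu> \<le> K"
      using pq \<mu>0 unfolding \<mu>_def[symmetric] by (auto simp: field_simps)
    have int: "(\<lambda>y. cis (L / y) * chirp \<omega>' c' y / of_real y) integrable_on {p..q}" if "norm \<omega>' = 1" for \<omega>' c'
    proof (rule bounded_borel_integrable'[where K="1/p"])
      show "norm (cis (L / y) * chirp \<omega>' c' y / of_real y) \<le> 1 / p" if "y \<in> {p..q}" for y
        using that p0 norm_chirp[OF \<open>norm \<omega>' = 1\<close>] by (simp add: norm_mult norm_divide frac_le)
    qed measurable
    have scale: "integral {p..q} (\<lambda>y. cis (L / y) * chirp \<omega>' c' y / of_real y)
       = integral {p / \<mu>..q / \<mu>} (\<lambda>w. cis (\<mu> / w) * chirp \<omega>' c' (\<mu> * w) / of_real w)" if "norm \<omega>' = 1" for \<omega>' c'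
    proof -
      let ?f = "\<lambda>y. cis (L / y) * chirp \<omega>' c' y / of_real y"
      have "((\<lambda>w. ?f (\<mu> *\<^sub>R w + 0)) has_integral (integral {p..q} ?f /\<^sub>R \<mu> ^ DIM(real))) (cbox ((p - 0) /\<^sub>R \<mu>) ((q - 0) /\<^sub>R \<mu>))"
        using has_integral_affinity'[of ?f "integral {p..q} ?f" p q \<mu> 0] int[OF that] \<mu>0
        by (simp add: has_integral_integral)
      then have "((\<lambda>w. of_real \<mu> * ?f (\<mu> * w)) has_integral (of_real \<mu> * (integral {p..q} ?f /\<^sub>R \<mu>))) {p / \<mu>..q / \<mu>}"
        by (intro has_integral_mult_right) (simp add: divide_inverse mult.commute)
      moreover have "of_real \<mu> * (integral {p..q} ?f /\<^sub>R \<mu>) = integral {p..q} ?f"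
        using \<mu>0 by (simp add: scaleR_conv_of_real)
      moreover have "(\<lambda>w. of_real \<mu> * ?f (\<mu> * w)) = (\<lambda>w. cis (\<mu> / w) * chirp \<omega>' c' (\<mu> * w) / of_real w)"
        using \<mu>0 by (auto simp: L\<mu> field_simps)
      ultimately show ?thesis by (simp add: integral_unique)
    qed
    let ?A = "integral {p..q} (\<lambda>y. cis (L / y) * chirp \<omega> c y / of_real y)"
    let ?B = "integral {p..q} (\<lambda>y. cis (L / y) * chirp (cnj \<omega>) (-c) y / of_real y)"
    have A: "norm ?A \<le> e" unfolding scale[OF \<omega>] by (rule \<mu>1(2)) (use \<mu> rng in auto)
    have B: "norm ?B \<le> e" unfolding scale[OF \<omega>'] by (rule \<mu>2(2)) (use \<mu> rng in auto)
    have B': "((\<lambda>y. cis (- (L / y)) * chirp \<omega> c y / of_real y) has_integral cnj ?B) {p..q}"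
    proof -
      have "((cnj \<circ> (\<lambda>y. cis (L / y) * chirp (cnj \<omega>) (-c) y / of_real y)) has_integral cnj ?B) {p..q}"
        by (rule has_integral_linear[OF integrable_integral[OF int[OF \<omega>']] bounded_linear_cnj])
      then show ?thesis by (simp add: o_def cnj_chirp cis_cnj)
    qed
    have "((\<lambda>y. (cis (L / y) * chirp \<omega> c y / of_real y - cis (- (L / y)) * chirp \<omega> c y / of_real y) * (1 / (2 * \<i>)))
       has_integral (?A - cnj ?B) * (1 / (2 * \<i>))) {p..q}"
      by (intro has_integral_mult_left has_integral_diff B' integrable_integral int \<omega>)
    moreover have "(cis (L / y) * chirp \<omega> c y / of_real y - cis (- (L / y)) * chirp \<omega> c y / of_real y) * (1 / (2 * \<i>))
      = of_real (osc_kernel L y) * chirp \<omega> c y" for y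
    proof -
      have "cis (L / y) - cis (- (L / y)) = 2 * \<i> * of_real (sin (L / y))"
        by (simp add: complex_eq_iff)
      then have "(cis (L / y) * z / of_real y - cis (- (L / y)) * z / of_real y) = 2 * \<i> * of_real (sin (L / y)) * z / of_real y" for z
        by (simp only: left_diff_distrib[symmetric] diff_divide_distrib[symmetric])
      then have "(cis (L / y) * z / of_real y - cis (- (L / y)) * z / of_real y) * (1 / (2 * \<i>)) = of_real (sin (L / y)) * z / of_real y" for z
      proof -
        assume eq: "cis (L / y) * z / of_real y - cis (- (L / y)) * z / of_real y = 2 * \<i> * of_real (sin (L / y)) * z / of_real y" for z
        have "(2 * \<i>) * (of_real (sin (L / y)) * z / of_real y) / (2 * \<i>) = of_real (sin (L / y)) * z / of_real y"
          by (rule nonzero_mult_div_cancel_left) simp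
        then show ?thesis
          unfolding eq by (simp only: times_divide_eq_right mult_1_right mult.assoc)
      qed
      then show ?thesis by (simp add: osc_kernel_def)
    qed
    ultimately have "integral {p..q} (\<lambda>y. of_real (osc_kernel L y) * chirp \<omega> c y) = (?A - cnj ?B) * (1 / (2 * \<i>))"
      by (simp add: integral_unique)
    then have "norm (integral {p..q} (\<lambda>y. of_real (osc_kernel L y) * chirp \<omega> c y)) = norm (?A - cnj ?B) / 2"
      by (simp add: norm_mult norm_divide)
    also have "\<dots> \<le> (norm ?A + norm ?B) / 2"
      using norm_triangle_ineq4[of ?A "cnj ?B"] by simp
    finally show "norm (integral {p..q} (\<lambda>y. of_real (osc_kernel L y) * chirp \<omega> c y)) \<le> e"
      using A B by simp
  qed
qed

text \<open>
The ranges \<open>y \<le> \<delta> \<surd>L\<close>, \<open>\<delta> \<surd>L \<le> y \<le> K \<surd>L\<close> and \<open>y \<ge> K \<surd>L\<close> contribute \<open>O(\<delta>\<^sup>2)\<close>, \<open>o(1)\<close> for fixed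
\<open>\<delta>\<close> and \<open>K\<close>, and \<open>O(1 / K)\<close>, respectively.
\<close>

lemma osc_tail:
  assumes \<omega>: "norm \<omega> = 1" "\<omega> \<noteq> 1" and "1 \<le> p" "0 < e"
  shows "\<exists>L0>0. \<forall>L\<ge>L0. \<exists>Q\<ge>p. \<forall>q\<ge>Q. norm (integral {real p..real q} (\<lambda>y. of_real (osc_kernel L y) * chirp \<omega> c y)) \<le> e"
proof -
  define \<delta> where "\<delta> = min 1 (e / (12 * (3 + \<bar>c\<bar>)))"
  define d where "d = norm (1 - \<omega>)"
  have d: "d > 0" using \<omega> by (simp add: d_def)
  \<comment> \<open>Chosen so that the final bounds \<open>4 (3 + |c|) \<delta>\<close> and \<open>16 / (K d)\<close> are at most \<open>e / 3\<close>.\<close>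
  define K where "K = max 2 (48 / (e * d))"
  have \<delta>: "\<delta> > 0" "\<delta> \<le> 1" "(3 + \<bar>c\<bar>) * (4 * \<delta>) \<le> e / 3"
  proof -
    show "\<delta> > 0" using \<open>0<e\<close> by (auto simp: \<delta>_def intro!: divide_pos_pos add_pos_nonneg)
    show "\<delta> \<le> 1" by (simp add: \<delta>_def)
    have "\<delta> \<le> e / (12 * (3 + \<bar>c\<bar>))" by (simp add: \<delta>_def)
    then have "\<delta> * (12 * (3 + \<bar>c\<bar>)) \<le> e" by (subst (asm) pos_le_divide_eq) (auto intro: add_pos_nonneg)
    then show "(3 + \<bar>c\<bar>) * (4 * \<delta>) \<le> e / 3" by (simp add: algebra_simps)
  qed
  have K: "K \<ge> 2" "16 / K \<le> d * (e / 3)"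
  proof -
    show "K \<ge> 2" by (simp add: K_def)
    have "48 / (e * d) \<le> K" by (simp add: K_def)
    then show "16 / K \<le> d * (e / 3)" using d \<open>0<e\<close> \<open>K\<ge>2\<close> by (simp add: field_simps)
  qed
  obtain L1 where L1: "L1 > 0" "\<And>L p q. L \<ge> L1 \<Longrightarrow> \<delta> * sqrt L \<le> p \<Longrightarrow> p \<le> q \<Longrightarrow> q \<le> K * sqrt L \<Longrightarrow>
    norm (integral {p..q} (\<lambda>y. of_real (osc_kernel L y) * chirp \<omega> c y)) \<le> e / 3"
    using osc_resonant_range[OF \<omega>(1), of \<delta> K "e / 3" c] \<delta> K \<open>0<e\<close> by auto
  show ?thesis
  proof (intro exI[of _ "max L1 ((max 2 (real p / \<delta>))\<^sup>2)"] conjI allI impI)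
    show "max L1 ((max 2 (real p / \<delta>))\<^sup>2) > 0" using L1 by simp
    fix L assume L: "max L1 ((max 2 (real p / \<delta>))\<^sup>2) \<le> L"
    define \<mu> where "\<mu> = sqrt L"
    have "max 2 (real p / \<delta>) \<le> \<mu>" unfolding \<mu>_def using L by (intro real_le_rsqrt) auto
    then have \<mu>: "\<mu> \<ge> 2" "real p \<le> \<delta> * \<mu>" using \<delta> by (auto simp: field_simps)
    have L\<mu>': "L > 0" using L L1(1) by linarith
    then have L\<mu>: "L = \<mu>\<^sup>2" "L > 0" by (auto simp: \<mu>_def)
    define P where "P = nat \<lceil>\<delta> * \<mu>\<rceil>"
    define Q where "Q = nat \<lfloor>K * \<mu>\<rfloor>"
    have d1: "1 \<le> \<delta> * \<mu>" using \<mu>(2) \<open>1 \<le> p\<close> by simp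
    have P: "\<delta> * \<mu> \<le> real P" "real P \<le> 2 * (\<delta> * \<mu>)" unfolding P_def using d1 by linarith+
    have K\<mu>: "K * \<mu> \<ge> 4" using mult_mono[of 2 K 2 \<mu>] K \<mu> by simp
    have Q: "real Q \<le> K * \<mu>" "real Q \<ge> K * \<mu> - 1" unfolding Q_def using K\<mu> by linarith+
    have Q2: "real Q \<ge> K * \<mu> / 2" using Q K\<mu> by linarith
    have pP: "p \<le> P" using \<mu>(2) P by linarith
    have "\<delta> * \<mu> \<le> 1 * \<mu>" using \<delta> \<mu> by (intro mult_right_mono) auto
    moreover have "2 * \<mu> \<le> K * \<mu>" using K \<mu> by (intro mult_right_mono) auto
    ultimately have "\<lceil>\<delta> * \<mu>\<rceil> \<le> \<lfloor>K * \<mu>\<rfloor>" using \<mu> by linarith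
    then have PQ: "P \<le> Q" unfolding P_def Q_def by linarith
    show "\<exists>Q\<ge>p. \<forall>q\<ge>Q. norm (integral {real p..real q} (\<lambda>y. of_real (osc_kernel L y) * chirp \<omega> c y)) \<le> e"
    proof (intro exI[of _ Q] conjI allI impI)
      show "p \<le> Q" using pP PQ by simp
      fix q assume q: "Q \<le> q"
      let ?I = "\<lambda>a b. integral {real a..real b} (\<lambda>y. of_real (osc_kernel L y) * chirp \<omega> c y)"
      have s1: "?I p q = ?I p P + ?I P q"
        by (rule integral_split) (use pP PQ q \<open>1\<le>p\<close> osc_integrable[OF \<omega>(1)] in auto)
      have s2: "?I P q = ?I P Q + ?I Q q"
        by (rule integral_split) (use pP PQ q \<open>1\<le>p\<close> osc_integrable[OF \<omega>(1)] in auto)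
      have mid: "norm (?I P Q) \<le> e / 3"
        by (rule L1(2)) (use L P Q PQ in \<open>auto simp: \<mu>_def\<close>)
      have low: "norm (?I p P) \<le> e / 3"
      proof -
        have "norm (?I p P) \<le> (\<Sum>n=p..<P. (3 + \<bar>c\<bar>) * real P / L)"
          unfolding osc_integral_sum[OF \<omega>(1) \<open>1\<le>p\<close> pP]
        proof (rule sum_norm_le)
          fix n assume n: "n \<in> {p..<P}"
          have "norm (\<omega> ^ n * osc_piece c L n) \<le> (3 + \<bar>c\<bar>) * real (Suc n) / L"
            using osc_piece_low[of n L c] n \<open>1\<le>p\<close> L\<mu> by (simp add: norm_mult norm_power \<omega>)
          also have "\<dots> \<le> (3 + \<bar>c\<bar>) * real P / L"
            using n L\<mu> by (intro divide_right_mono mult_left_mono) auto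
          finally show "norm (\<omega> ^ n * osc_piece c L n) \<le> (3 + \<bar>c\<bar>) * real P / L" .
        qed
        also have "\<dots> = real (P - p) * ((3 + \<bar>c\<bar>) * real P / L)" by simp
        also have "\<dots> \<le> real P * ((3 + \<bar>c\<bar>) * real P / L)"
          using L\<mu> by (intro mult_right_mono divide_nonneg_pos mult_nonneg_nonneg) auto
        also have "\<dots> = (3 + \<bar>c\<bar>) * (real P)\<^sup>2 / L" by (simp add: power2_eq_square)
        also have "\<dots> \<le> (3 + \<bar>c\<bar>) * (2 * (\<delta> * \<mu>))\<^sup>2 / L"
          using P L\<mu> by (intro divide_right_mono mult_left_mono power_mono) auto
        also have "\<dots> = (3 + \<bar>c\<bar>) * (4 * (\<delta> * \<delta>))" using L\<mu> \<mu>(1) by (simp add: power2_eq_square)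
        also have "\<dots> \<le> (3 + \<bar>c\<bar>) * (4 * (\<delta> * 1))" using \<delta> by (intro mult_left_mono) auto
        also have "\<dots> \<le> e / 3" using \<delta>(3) by simp
        finally show ?thesis .
      qed
      have high: "norm (?I Q q) \<le> e / 3"
      proof -
        have Q1: "1 \<le> Q" using pP PQ \<open>1\<le>p\<close> by simp
        have Kp: "K * \<mu> / 2 > 0" using K\<mu> by simp
        have "d * norm (?I Q q) \<le> 4 / real Q + 2 * L / (real Q)\<^sup>2"
          unfolding osc_integral_sum[OF \<omega>(1) Q1 q] d_def by (rule osc_high[OF \<omega>(1) Q1 q L\<mu>(2)])
        also have "\<dots> \<le> 4 / (K * \<mu> / 2) + 2 * L / (K * \<mu> / 2)\<^sup>2"
          using Q2 Kp L\<mu> by (intro add_mono frac_le power_mono) auto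
        also have "\<dots> = 8 / (K * \<mu>) + 8 / (K * K)"
          using L\<mu> K \<mu> by (simp add: power2_eq_square field_simps)
        also have "\<dots> \<le> 8 / (K * 1) + 8 / (K * 1)"
          using K \<mu> by (intro add_mono divide_left_mono mult_left_mono mult_pos_pos) auto
        also have "\<dots> = 16 / K" by simp
        also have "\<dots> \<le> d * (e / 3)" by (rule K(2))
        finally show ?thesis using d by simp
      qed
      show "norm (?I p q) \<le> e"
        unfolding s1 s2 using low mid high norm_triangle_ineq[of "?I p P" "?I P Q + ?I Q q"] norm_triangle_ineq[of "?I P Q" "?I Q q"]
        by linarith
    qed
  qed
qed

lemma abs_sin_div_le: "u \<ge> 0 \<Longrightarrow> a \<ge> 0 \<Longrightarrow> \<bar>sin (a * u) / u\<bar> \<le> (a::real)"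
  using abs_sin_x_le_abs_x[of "a * u"] by (cases "u = 0") (auto simp: abs_mult field_simps)

lemma osc_limit_bounded:
  assumes \<omega>: "norm \<omega> = 1" "\<omega> \<noteq> 1" and "1 \<le> p" "0 < x"
  shows "(\<lambda>M. integral {0..x / real p} (\<lambda>u. of_real (sin (2 * pi * real M * u) / u) * chirp \<omega> c (x / u))) \<longlonglongrightarrow> 0"
proof (rule LIMSEQ_I)
  fix e :: real assume "e > 0"
  let ?f = "\<lambda>M u. of_real (sin (2 * pi * real M * u) / u) * chirp \<omega> c (x / u)"
  have fb: "norm (?f M u) \<le> 2 * pi * real M" if "u \<ge> 0" for M u
    using abs_sin_div_le[OF that, of "2 * pi * real M"] by (simp only: norm_mult norm_of_real norm_chirp[OF \<omega>(1)]) simp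
  have fi: "?f M integrable_on {a..b}" if "a \<ge> 0" for M a b
    by (rule bounded_borel_integrable'[where K="2 * pi * real M"]) (use fb that in auto)
  obtain L0 where L0: "L0 > 0" "\<And>L. L \<ge> L0 \<Longrightarrow> \<exists>Q\<ge>p. \<forall>q\<ge>Q. norm (integral {real p..real q} (\<lambda>y. of_real (osc_kernel L y) * chirp \<omega> c y)) \<le> e / 2"
    using osc_tail[OF \<omega> \<open>1\<le>p\<close>, of "e / 2" c] \<open>e > 0\<close> by auto
  define M0 where "M0 = nat \<lceil>L0 / (2 * pi * x)\<rceil>"
  show "\<exists>M0. \<forall>M\<ge>M0. norm (integral {0..x / real p} (?f M) - 0) < e"
  proof (intro exI[of _ M0] allI impI)
    fix M assume M: "M \<ge> M0"
    define L where "L = 2 * pi * real M * x"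
    have "L0 / (2 * pi * x) \<le> real M" using M unfolding M0_def by linarith
    then have "L \<ge> L0" unfolding L_def using \<open>0<x\<close> by (simp add: field_simps)
    from L0(2)[OF this] obtain Q where Q: "Q \<ge> p" "\<And>q. q \<ge> Q \<Longrightarrow> norm (integral {real p..real q} (\<lambda>y. of_real (osc_kernel L y) * chirp \<omega> c y)) \<le> e / 2"
      by auto
    \<comment> \<open>Below \<open>x / q\<close> the trivial bound \<open>2 \<pi> M\<close> for the integrand suffices, as \<open>M\<close> is fixed here.\<close>
    define q where "q = max Q (nat \<lceil>8 * pi * real M * x / e\<rceil>)"
    have q: "q \<ge> Q" "q \<ge> p" "q \<ge> 1" using Q \<open>1\<le>p\<close> by (auto simp: q_def)
    have "8 * pi * real M * x / e \<le> real q" unfolding q_def by linarith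
    then have small: "2 * pi * real M * (x / real q) \<le> e / 4" using \<open>e>0\<close> q \<open>0<x\<close> by (simp add: field_simps)
    have "integral {0..x / real p} (?f M) = integral {0..x / real q} (?f M) + integral {x / real q..x / real p} (?f M)"
      by (rule integral_split) (use fi q \<open>0<x\<close> \<open>1\<le>p\<close> in \<open>auto intro!: divide_left_mono\<close>)
    moreover have "norm (integral {0..x / real q} (?f M)) \<le> 2 * pi * real M * (x / real q - 0)"
      by (rule norm_integral_le) (use fb \<open>0<x\<close> in auto)
    moreover have "integral {x / real q..x / real p} (?f M) = integral {real p..real q} (\<lambda>y. of_real (osc_kernel L y) * chirp \<omega> c y)"
    proof -
      have pq: "real p > 0" using \<open>1\<le>p\<close> by simp
      have img: "(\<lambda>y. x / y) ` {real p..real q} = {x / real q..x / real p}"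
      proof safe
        fix u assume u: "u \<in> {x / real q..x / real p}"
        have "u > 0" using u q \<open>0<x\<close> by (smt (verit) atLeastAtMost_iff divide_pos_pos of_nat_0_less_iff less_le_trans zero_less_one)
        then have "x / u \<in> {real p..real q}" using u q pq \<open>0<x\<close> by (auto simp: field_simps)
        then show "u \<in> (\<lambda>y. x / y) ` {real p..real q}" using \<open>u>0\<close> \<open>0<x\<close> by (intro image_eqI[of _ _ "x / u"]) auto
      qed (use pq \<open>0<x\<close> in \<open>auto intro!: divide_left_mono\<close>)
      have inj: "inj_on (\<lambda>y. x / y) {real p..real q}"
        using pq \<open>0<x\<close> by (auto simp: inj_on_def field_simps)
      have der: "((\<lambda>y. x / y) has_field_derivative (- x / y\<^sup>2)) (at y within {real p..real q})" if "y \<in> {real p..real q}" for y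
        using that pq by (auto intro!: derivative_eq_intros simp: power2_eq_square)
      have "?f M absolutely_integrable_on {x / real q..x / real p}"
      proof (rule bounded_borel_integrable[where K="2 * pi * real M"])
        fix u assume u: "u \<in> {x / real q..x / real p}"
        have "0 \<le> x / real q" using \<open>0<x\<close> by simp
        then have "0 \<le> u" using u by simp
        then show "norm (?f M u) \<le> 2 * pi * real M" by (rule fb)
      qed measurable
      then have "integral {real p..real q} (\<lambda>y. \<bar>- x / y\<^sup>2\<bar> *\<^sub>R ?f M (x / y)) = integral {x / real q..x / real p} (?f M)"
        using has_absolute_integral_change_of_variables_real[of "{real p..real q}" "\<lambda>y. x / y" "\<lambda>y. - x / y\<^sup>2" "?f M" "integral {x / real q..x / real p} (?f M)"]
          der inj unfolding img by simp
      moreover have "integral {real p..real q} (\<lambda>y. \<bar>- x / y\<^sup>2\<bar> *\<^sub>R ?f M (x / y)) = integral {real p..real q} (\<lambda>y. of_real (osc_kernel L y) * chirp \<omega> c y)"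
      proof (rule Henstock_Kurzweil_Integration.integral_cong)
        fix y assume "y \<in> {real p..real q}"
        then have y: "y > 0" using pq by simp
        have "\<bar>- x / y\<^sup>2\<bar> * (sin (2 * pi * real M * (x / y)) / (x / y)) = osc_kernel L y"
          using y \<open>0<x\<close> by (simp add: osc_kernel_def L_def power2_eq_square)
        moreover have "x / (x / y) = y" using \<open>0<x\<close> by simp
        ultimately show "\<bar>- x / y\<^sup>2\<bar> *\<^sub>R ?f M (x / y) = of_real (osc_kernel L y) * chirp \<omega> c y"
          by (simp only: scaleR_conv_of_real mult.assoc[symmetric] of_real_mult[symmetric])
      qed
      ultimately show ?thesis by simp
    qed
    ultimately have "norm (integral {0..x / real p} (?f M)) \<le> 2 * pi * real M * (x / real q) + e / 2"
      using Q(2)[OF q(1)] norm_triangle_ineq[of "integral {0..x / real q} (?f M)" "integral {x / real q..x / real p} (?f M)"]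
      by simp
    then show "norm (integral {0..x / real p} (?f M) - 0) < e" using small \<open>e>0\<close> by simp
  qed
qed

text \<open>
Absolute estimates lose a logarithm here: the integrand has size \<open>1 / u\<close> for \<open>u > 1 / M\<close>.
\<close>

lemma osc_limit:
  assumes \<omega>: "norm \<omega> = 1" "\<omega> \<noteq> 1" and "0 < \<epsilon>" "0 < x"
  shows "(\<lambda>M. integral {0..\<epsilon>} (\<lambda>u. of_real (sin (2 * pi * real M * u) / u) * chirp \<omega> c (x / u))) \<longlonglongrightarrow> 0"
proof -
  let ?f = "\<lambda>M u. of_real (sin (2 * pi * real M * u) / u) * chirp \<omega> c (x / u)"
  define p where "p = Suc (nat \<lceil>x / \<epsilon>\<rceil>)"
  have p: "1 \<le> p" "x / \<epsilon> \<le> real p" unfolding p_def by linarith+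
  then have xp: "x / real p \<le> \<epsilon>" "0 < x / real p" using assms by (auto simp: field_simps)
  have fb: "norm (?f M u) \<le> 2 * pi * real M" if "u \<ge> 0" for M u
    using abs_sin_div_le[OF that, of "2 * pi * real M"] by (simp only: norm_mult norm_of_real norm_chirp[OF \<omega>(1)]) simp
  have fi: "?f M integrable_on {0..\<epsilon>}" for M
    by (rule bounded_borel_integrable'[where K="2 * pi * real M"]) (use fb in auto)
  have "(\<lambda>M. integral {x / real p..\<epsilon>} (\<lambda>u. (chirp \<omega> c (x / u) / of_real u) * of_real (sin (2 * pi * real M * u)))) \<longlonglongrightarrow> 0"
  proof (rule riemann_lebesgue_sin_complex[where K="1 / (x / real p)"])
    show "norm (chirp \<omega> c (x / u) / of_real u) \<le> 1 / (x / real p)" if "u \<in> {x / real p..\<epsilon>}" for u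
    proof -
      have "norm (chirp \<omega> c (x / u) / of_real u) = 1 / u"
        using that xp by (simp add: norm_divide norm_chirp \<omega>)
      also have "\<dots> \<le> 1 / (x / real p)" using that xp by (intro frac_le) auto
      finally show ?thesis .
    qed
  qed (use xp in auto)
  then have "(\<lambda>M. integral {0..x / real p} (?f M) + integral {x / real p..\<epsilon>} (?f M)) \<longlonglongrightarrow> 0 + 0"
    by (intro tendsto_add osc_limit_bounded[OF \<omega> p(1) \<open>0<x\<close>]) (simp add: mult.commute)
  then show ?thesis
    using integral_split[OF _ _ fi, of "x / real p"] xp by simp
qed

section \<open>Dirichlet kernels and half-weighted sums\<close>

text \<open>
Concavity of the sine on \<open>[0, \<pi>/2]\<close>.
\<close>

lemma sin_pi_ge_half: "0 \<le> d \<Longrightarrow> d \<le> 1 / 2 \<Longrightarrow> 2 * d \<le> sin (pi * d)"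
proof -
  assume d: "0 \<le> d" "d \<le> 1 / 2"
  have "convex_on {0..1/2} (\<lambda>d. - sin (pi * d))"
  proof (rule f''_ge0_imp_convex[where f' = "\<lambda>d. - cos (pi * d) * pi" and f'' = "\<lambda>d. sin (pi * d) * pi * pi"])
    show "sin (pi * d) * pi * pi \<ge> 0" if "d \<in> {0..1/2}" for d
      using that by (intro mult_nonneg_nonneg sin_ge_zero) (auto simp: field_simps)
  qed (auto intro!: derivative_eq_intros)
  from convex_onD[OF this, of "2 * d" 0 "1/2"] d show ?thesis by simp
qed

lemma sin_pi_ge: "0 \<le> d \<Longrightarrow> d \<le> 1 \<Longrightarrow> 2 * min d (1 - d) \<le> sin (pi * d)"
proof -
  assume d: "0 \<le> d" "d \<le> 1"
  show ?thesis
  proof (cases "d \<le> 1 / 2")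
    case True then show ?thesis using sin_pi_ge_half[of d] d by simp
  next
    case False
    have "sin (pi * (1 - d)) = sin (pi * d)" by (simp add: algebra_simps sin_diff)
    then show ?thesis using sin_pi_ge_half[of "1 - d"] d False by simp
  qed
qed

lemma abs_sin_pi_shift: "\<bar>sin (pi * u)\<bar> = \<bar>sin (pi * (u - real n))\<bar>"
proof -
  have "pi * (u - real n) = pi * u - real n * pi" by (simp add: algebra_simps)
  then show ?thesis by (simp add: sin_diff abs_mult)
qed

lemma abs_sin_pi_ge:
  assumes "\<bar>u - real n\<bar> \<le> 1 - \<eta>" "0 < \<eta>" "\<eta> \<le> 1"
  shows "2 * \<eta> * \<bar>u - real n\<bar> \<le> \<bar>sin (pi * u)\<bar>"
proof -
  define d where "d = \<bar>u - real n\<bar>"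
  have d: "0 \<le> d" "d \<le> 1 - \<eta>" using assms by (auto simp: d_def)
  have "\<bar>sin (pi * u)\<bar> = \<bar>sin (pi * d)\<bar>"
  proof -
    have "sin (pi * (real n - u)) = - sin (pi * (u - real n))"
      using sin_minus[of "pi * (u - real n)"] by (simp add: algebra_simps)
    then show ?thesis unfolding abs_sin_pi_shift[of u n] d_def by (simp add: abs_if[of "u - real n"])
  qed
  moreover have "\<eta> * d \<le> min d (1 - d)"
  proof (rule min.boundedI)
    show "\<eta> * d \<le> d" using d assms by (simp add: mult_left_le_one_le)
    have "\<eta> * d \<le> \<eta>" using d assms by (simp add: mult_left_le)
    then show "\<eta> * d \<le> 1 - d" using d by simp
  qed
  moreover have "2 * min d (1 - d) \<le> sin (pi * d)" by (rule sin_pi_ge) (use d assms in auto)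
  moreover have "2 * (\<eta> * d) \<le> 2 * min d (1 - d)" by (rule mult_left_mono) (fact, simp)
  ultimately have "2 * (\<eta> * d) \<le> \<bar>sin (pi * u)\<bar>" by (metis abs_ge_self order_trans)
  then show ?thesis unfolding d_def by simp
qed

text \<open>
The Dirichlet kernel \<open>sin (2 \<pi> N v) / sin (\<pi> v)\<close>, written as a sum so that it is continuous at the integers.
\<close>

definition dirich :: "nat \<Rightarrow> real \<Rightarrow> real" where
  "dirich N v = (\<Sum>j<N. 2 * cos (pi * real (2 * j + 1) * v))"

definition dirich_int :: "nat \<Rightarrow> real \<Rightarrow> real" where
  "dirich_int N v = (\<Sum>j<N. 2 * sin (pi * real (2 * j + 1) * v) / (pi * real (2 * j + 1)))"

lemma continuous_on_dirich [continuous_intros]: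
  fixes f :: "'a::t2_space \<Rightarrow> real"
  shows "continuous_on A f \<Longrightarrow> continuous_on A (\<lambda>u. dirich N (f u))"
  unfolding dirich_def by (intro continuous_intros)

lemma borel_measurable_dirich [measurable]: "dirich N \<in> borel_measurable borel"
  by (intro borel_measurable_continuous_onI continuous_on_dirich continuous_on_id)

lemma dirich_sin: "dirich N v * sin (pi * v) = sin (2 * pi * real N * v)"
proof (induction N)
  case 0 then show ?case by (simp add: dirich_def)
next
  case (Suc N)
  have "2 * cos (pi * real (2 * N + 1) * v) * sin (pi * v)
     = sin (pi * real (2 * N + 1) * v + pi * v) - sin (pi * real (2 * N + 1) * v - pi * v)"
    by (simp only: sin_add sin_diff)
  also have "\<dots> = sin (2 * pi * real (Suc N) * v) - sin (2 * pi * real N * v)"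
    by (simp add: algebra_simps)
  finally show ?case using Suc by (simp add: dirich_def distrib_right)
qed

lemma dirich_int_deriv: "(dirich_int N has_real_derivative dirich N v) (at v within A)"
  unfolding dirich_int_def[abs_def] dirich_def
proof (rule DERIV_sum)
  fix j
  define w where "w = pi * real (2 * j + 1)"
  have "w \<noteq> 0" by (simp add: w_def)
  then show "((\<lambda>v. 2 * sin (pi * real (2 * j + 1) * v) / (pi * real (2 * j + 1))) has_real_derivative
      2 * cos (pi * real (2 * j + 1) * v)) (at v within A)"
    unfolding w_def[symmetric] by (auto intro!: derivative_eq_intros)
qed

lemma dirich_has_integral: "a \<le> b \<Longrightarrow> (dirich N has_integral dirich_int N b - dirich_int N a) {a..b}"
  using fundamental_theorem_of_calculus[of a b "dirich_int N" "dirich N"] dirich_int_deriv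
  by (simp add: has_real_derivative_iff_has_vector_derivative)

lemma dirich_int_nat [simp]: "dirich_int N (real m) = 0"
proof -
  have "sin (pi * real (2 * j + 1) * real m) = 0" for j
  proof -
    have "pi * real (2 * j + 1) * real m = real ((2 * j + 1) * m) * pi" by (simp add: algebra_simps)
    then show ?thesis by (metis sin_npi)
  qed
  then show ?thesis unfolding dirich_int_def by simp
qed

text \<open>
At the half-integers the primitive is a partial sum of Leibniz's series for \<open>\<pi> / 4\<close>.
\<close>

lemma dirich_int_half: "(\<lambda>N. dirich_int N (real m + 1 / 2)) \<longlonglongrightarrow> (-1) ^ m / 2"
proof -
  have *: "2 * sin (pi * real (2 * j + 1) * (real m + 1 / 2)) / (pi * real (2 * j + 1)) = (-1) ^ m * (2 / pi) * ((-1) ^ j * 1 / real (j * 2 + 1))" for j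
  proof -
    have "pi * real (2 * j + 1) * (real m + 1 / 2) = real ((2 * j + 1) * m) * pi + (real j * pi + pi / 2)"
      by (simp add: algebra_simps add_divide_distrib)
    then have "sin (pi * real (2 * j + 1) * (real m + 1 / 2)) = cos (real ((2 * j + 1) * m) * pi) * sin (real j * pi + pi / 2)"
      by (simp only: sin_add[of "real ((2 * j + 1) * m) * pi"] sin_npi mult_zero_left add_0)
    also have "\<dots> = (-1) ^ ((2 * j + 1) * m) * (-1) ^ j"
      by (simp only: cos_npi) (simp add: sin_add)
    also have "(-1) ^ ((2 * j + 1) * m) = (-1::real) ^ m"
      by (simp add: power_add power_mult distrib_right)
    finally show ?thesis by (simp add: mult.commute)
  qed
  have "summable (\<lambda>k. (-1) ^ k * (1 / real (k * 2 + 1) * 1 ^ (k * 2 + 1)) :: real)"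
    by (rule summable_arctan_series) simp
  then have "(\<lambda>k. (-1) ^ k * 1 / real (k * 2 + 1)) sums (pi / 4)"
    unfolding pi_series by (simp add: summable_sums)
  then have "(\<lambda>N. (\<Sum>j<N. (-1) ^ j * 1 / real (j * 2 + 1))) \<longlonglongrightarrow> pi / 4"
    by (simp add: sums_def)
  then have "(\<lambda>N. (-1) ^ m * (2 / pi) * (\<Sum>j<N. (-1) ^ j * 1 / real (j * 2 + 1))) \<longlonglongrightarrow> (-1) ^ m * (2 / pi) * (pi / 4)"
    by (intro tendsto_intros)
  then show ?thesis unfolding dirich_int_def * sum_distrib_left by simp
qed

lemma dirich_conv_sin: "sin (pi * v) \<noteq> 0 \<Longrightarrow> dirich N v = 1 / sin (pi * v) * sin (2 * pi * real N * v)"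
  using dirich_sin[of N v] by (simp add: field_simps)

lemma dirichlet_away:
  assumes "real m < a" "a \<le> b" "b < real m + 1"
  shows "(\<lambda>N. dirich_int N b - dirich_int N a) \<longlonglongrightarrow> 0"
proof -
  define c where "c = min (2 * min (a - real m) (real m + 1 - a)) (2 * min (b - real m) (real m + 1 - b))"
  have c: "c > 0" using assms by (auto simp: c_def)
  have lb: "\<bar>sin (pi * u)\<bar> \<ge> c" if "u \<in> {a..b}" for u
  proof -
    have "2 * min (u - real m) (1 - (u - real m)) \<le> sin (pi * (u - real m))"
      by (rule sin_pi_ge) (use that assms in auto)
    moreover have "c \<le> 2 * min (u - real m) (1 - (u - real m))"
      using that unfolding c_def min_def by auto
    ultimately show ?thesis unfolding abs_sin_pi_shift[of u m] by linarith
  qed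
  have "(\<lambda>N. integral {a..b} (\<lambda>u. 1 / sin (pi * u) * sin (2 * pi * real N * u))) \<longlonglongrightarrow> 0"
  proof (rule riemann_lebesgue_sin[where K="1 / c"])
    show "\<bar>1 / sin (pi * u)\<bar> \<le> 1 / c" if "u \<in> {a..b}" for u
      using lb[OF that] c by (simp add: abs_divide frac_le)
  qed (use assms in auto)
  moreover have "integral {a..b} (\<lambda>u. 1 / sin (pi * u) * sin (2 * pi * real N * u)) = dirich_int N b - dirich_int N a" for N
  proof -
    have "integral {a..b} (\<lambda>u. 1 / sin (pi * u) * sin (2 * pi * real N * u)) = integral {a..b} (dirich N)"
    proof (rule Henstock_Kurzweil_Integration.integral_cong)
      fix u assume "u \<in> {a..b}"
      then have "sin (pi * u) \<noteq> 0" using lb[of u] c by auto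
      then show "1 / sin (pi * u) * sin (2 * pi * real N * u) = dirich N u" using dirich_conv_sin by simp
    qed
    then show ?thesis using dirich_has_integral[OF \<open>a \<le> b\<close>] by (simp add: integral_unique)
  qed
  ultimately show ?thesis by simp
qed

lemma dirich_int_limit:
  assumes "real m < b" "b < real m + 1"
  shows "(\<lambda>N. dirich_int N b) \<longlonglongrightarrow> (-1) ^ m / 2"
proof (cases "b \<le> real m + 1 / 2")
  case True
  have "(\<lambda>N. dirich_int N (real m + 1 / 2) - (dirich_int N (real m + 1 / 2) - dirich_int N b)) \<longlonglongrightarrow> (-1) ^ m / 2 - 0"
    by (intro tendsto_diff dirich_int_half dirichlet_away) (use assms True in auto)
  then show ?thesis by simp
next
  case False
  have "(\<lambda>N. dirich_int N (real m + 1 / 2) + (dirich_int N b - dirich_int N (real m + 1 / 2))) \<longlonglongrightarrow> (-1) ^ m / 2 + 0"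
    by (intro tendsto_add dirich_int_half dirichlet_away) (use assms False in auto)
  then show ?thesis by simp
qed

text \<open>
Dirichlet's localisation argument around the integer \<open>n\<close>: after subtraction of \<open>g n\<close> the quotient by
\<open>sin (\<pi> u)\<close> is bounded, so the Riemann-Lebesgue lemma applies. The limit \<open>l\<close> is left open because an interval may lie on
either side of \<open>n\<close>.
\<close>

lemma dirichlet_local:
  fixes g :: "real \<Rightarrow> real"
  assumes [measurable]: "g \<in> borel_measurable borel"
    and lip: "\<And>u. u \<in> {a..b} \<Longrightarrow> \<bar>g u - g (real n)\<bar> \<le> \<Lambda> * \<bar>u - real n\<bar>"
    and near: "\<And>u. u \<in> {a..b} \<Longrightarrow> \<bar>u - real n\<bar> \<le> 1 - \<eta>" and "0 < \<eta>" "\<eta> \<le> 1" "0 \<le> a" "a \<le> b" "0 \<le> \<Lambda>"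
    and lim: "(\<lambda>N. dirich_int N b - dirich_int N a) \<longlonglongrightarrow> l"
  shows "(\<lambda>N. integral {a..b} (\<lambda>u. g u * dirich N u)) \<longlonglongrightarrow> g (real n) * l"
proof -
  let ?h = "\<lambda>u. (g u - g (real n)) / sin (pi * u)"
  have hb: "\<bar>?h u\<bar> \<le> \<Lambda> / (2 * \<eta>)" if "u \<in> {a..b}" for u
  proof (cases "u = real n")
    case True then show ?thesis using \<open>0 \<le> \<Lambda>\<close> \<open>0<\<eta>\<close> by simp
  next
    case False
    have p: "0 < 2 * \<eta> * \<bar>u - real n\<bar>" using False \<open>0<\<eta>\<close> by simp
    have "\<bar>?h u\<bar> \<le> \<Lambda> * \<bar>u - real n\<bar> / (2 * \<eta> * \<bar>u - real n\<bar>)"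
      unfolding abs_divide
      by (rule frac_le) (use lip[OF that] abs_sin_pi_ge[OF near[OF that] \<open>0<\<eta>\<close> \<open>\<eta>\<le>1\<close>] p \<open>0\<le>\<Lambda>\<close> in auto)
    then show ?thesis using False by simp
  qed
  have h0: "?h u * sin (2 * pi * real N * u) = (g u - g (real n)) * dirich N u" if "u \<in> {a..b}" for u N
  proof (cases "u = real n")
    case True then show ?thesis by simp
  next
    case False
    have "0 < 2 * \<eta> * \<bar>u - real n\<bar>" using False \<open>0<\<eta>\<close> by simp
    then have "sin (pi * u) \<noteq> 0" using abs_sin_pi_ge[OF near[OF that] \<open>0<\<eta>\<close> \<open>\<eta>\<le>1\<close>] by auto
    then show ?thesis by (simp add: dirich_conv_sin)
  qed
  have "(\<lambda>N. integral {a..b} (\<lambda>u. ?h u * sin (2 * pi * real N * u))) \<longlonglongrightarrow> 0"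
    by (rule riemann_lebesgue_sin[OF _ hb]) (use \<open>0\<le>a\<close> in auto)
  then have "(\<lambda>N. integral {a..b} (\<lambda>u. ?h u * sin (2 * pi * real N * u)) + g (real n) * (dirich_int N b - dirich_int N a)) \<longlonglongrightarrow> 0 + g (real n) * l"
    by (intro tendsto_intros lim)
  moreover have "integral {a..b} (\<lambda>u. g u * dirich N u) = integral {a..b} (\<lambda>u. ?h u * sin (2 * pi * real N * u)) + g (real n) * (dirich_int N b - dirich_int N a)" for N
  proof -
    have i1: "(\<lambda>u. ?h u * sin (2 * pi * real N * u)) integrable_on {a..b}"
    proof (rule bounded_borel_integrable'[where K="\<Lambda> / (2 * \<eta>) * 1"])
      show "norm (?h u * sin (2 * pi * real N * u)) \<le> \<Lambda> / (2 * \<eta>) * 1" if "u \<in> {a..b}" for u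
        unfolding real_norm_def abs_mult[of "?h u"] using hb[OF that] \<open>0\<le>\<Lambda>\<close> \<open>0<\<eta>\<close> by (intro mult_mono) auto
    qed measurable
    have "integral {a..b} (\<lambda>u. g u * dirich N u) = integral {a..b} (\<lambda>u. ?h u * sin (2 * pi * real N * u) + g (real n) * dirich N u)"
      by (rule Henstock_Kurzweil_Integration.integral_cong) (use h0 in \<open>simp add: algebra_simps\<close>)
    also have "\<dots> = integral {a..b} (\<lambda>u. ?h u * sin (2 * pi * real N * u)) + g (real n) * (dirich_int N b - dirich_int N a)"
      using has_integral_add[OF integrable_integral[OF i1] has_integral_mult_right[OF dirich_has_integral[OF \<open>a\<le>b\<close>]]]
      by (simp add: integral_unique)
    finally show ?thesis .
  qed
  ultimately show ?thesis by simp
qed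

text \<open>
The factor that multiplies the Dirichlet kernel when the sines at the frequencies \<open>n + \<theta>\<close> and \<open>\<theta> - 1 - n\<close> are added
in pairs, see \<open>dsin_pair_sum\<close>. Its phase is taken relative to the midpoint \<open>\<theta> - 1/2\<close> of each pair.
\<close>

definition wave :: "nat \<Rightarrow> real \<Rightarrow> real \<Rightarrow> real" where
  "wave k \<theta> u = u ^ Suc k * dsin k (2 * pi * (\<theta> - 1 / 2) * u)"

lemma borel_measurable_wave [measurable]: "wave k \<theta> \<in> borel_measurable borel"
  unfolding wave_def[abs_def] by measurable

lemma continuous_on_wave [continuous_intros]: "continuous_on A (wave k \<theta>)"
  unfolding wave_def[abs_def] by (intro continuous_intros)

lemma wave_nat: "wave k \<theta> (real m) = (-1) ^ m * (real m ^ Suc k * dsin k (2 * pi * real m * \<theta>))"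
proof -
  have "dsin k (2 * pi * (\<theta> - 1 / 2) * real m + pi * real m) = dsin k (2 * pi * real m * \<theta>)"
    by (simp add: algebra_simps)
  then have "(-1) ^ m * dsin k (2 * pi * (\<theta> - 1 / 2) * real m) = dsin k (2 * pi * real m * \<theta>)"
    by (simp only: dsin_add_pi)
  then show ?thesis unfolding wave_def by (metis (no_types, lifting) minus_one_mult_self mult.assoc mult.left_commute mult_1)
qed

lemma wave_lipschitz: "\<exists>\<Lambda>\<ge>0. \<forall>u\<in>{0..B}. \<forall>v\<in>{0..B}. \<bar>wave k \<theta> u - wave k \<theta> v\<bar> \<le> \<Lambda> * \<bar>u - v\<bar>"
proof -
  define w' where "w' = (\<lambda>u. u ^ Suc k * (dsin (Suc k) (2 * pi * (\<theta> - 1 / 2) * u) * (2 * pi * (\<theta> - 1 / 2)))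
      + real (Suc k) * u ^ k * dsin k (2 * pi * (\<theta> - 1 / 2) * u))"
  have d: "(wave k \<theta> has_field_derivative w' u) (at u within A)" for u A
  proof -
    have 1: "((\<lambda>u. u ^ Suc k) has_real_derivative real (Suc k) * u ^ k) (at u within A)"
      using DERIV_pow[of "Suc k" u A] by simp
    have 2: "((\<lambda>u. dsin k (2 * pi * (\<theta> - 1 / 2) * u)) has_real_derivative
        dsin (Suc k) (2 * pi * (\<theta> - 1 / 2) * u) * (2 * pi * (\<theta> - 1 / 2))) (at u within A)"
      by (auto intro!: derivative_eq_intros)
    show ?thesis using DERIV_mult'[OF 1 2] unfolding wave_def[abs_def] w'_def .
  qed
  have "compact (w' ` {0..B})"
    unfolding w'_def by (intro compact_continuous_image continuous_intros) auto
  then obtain \<Lambda> where \<Lambda>: "\<Lambda> > 0" "\<And>u. u \<in> {0..B} \<Longrightarrow> norm (w' u) \<le> \<Lambda>"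
    using compact_imp_bounded[of "w' ` {0..B}"] unfolding bounded_pos by auto
  have "norm (wave k \<theta> u - wave k \<theta> v) \<le> \<Lambda> * norm (u - v)" if "u \<in> {0..B}" "v \<in> {0..B}" for u v
    by (rule field_differentiable_bound[where f' = w' and S = "{0..B}"]) (use d \<Lambda> that in auto)
  then show ?thesis using \<Lambda>(1) by (intro exI[of _ \<Lambda>]) auto
qed

lemma wave_nat_half: "wave k \<theta> (real m) * ((-1) ^ m / 2) = real m ^ Suc k * dsin k (2 * pi * real m * \<theta>) / 2"
proof -
  have "(-1) ^ m * (-1 :: real) ^ m = 1" by (simp flip: power_mult_distrib)
  then have "(-1) ^ m * a * ((-1) ^ m / 2) = a / 2" for a :: real
    by (metis (no_types, opaque_lifting) mult.commute mult.left_commute mult_1 times_divide_eq_left times_divide_eq_right)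
  then show ?thesis unfolding wave_nat .
qed

definition coef :: "nat \<Rightarrow> real \<Rightarrow> nat \<Rightarrow> real" where
  "coef k \<theta> m = real m ^ Suc k * dsin k (2 * pi * real m * \<theta>)"

definition half_sum :: "nat \<Rightarrow> real \<Rightarrow> real \<Rightarrow> real" where
  "half_sum k \<theta> X = (\<Sum>m | 1 \<le> m \<and> real m \<le> X. (if real m = X then 1 / 2 else 1) * coef k \<theta> m)"

lemma wave_integrable: "(\<lambda>u. wave k \<theta> u * dirich N u) integrable_on {a..b}"
  by (intro integrable_continuous_real continuous_intros)

lemma wave_limit_right:
  assumes "real m < b" "b < real m + 1"
  shows "(\<lambda>N. integral {real m..b} (\<lambda>u. wave k \<theta> u * dirich N u)) \<longlonglongrightarrow> coef k \<theta> m / 2"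
proof -
  obtain \<Lambda> where \<Lambda>: "\<Lambda> \<ge> 0" "\<And>u v. u \<in> {0..b} \<Longrightarrow> v \<in> {0..b} \<Longrightarrow> \<bar>wave k \<theta> u - wave k \<theta> v\<bar> \<le> \<Lambda> * \<bar>u - v\<bar>"
    using wave_lipschitz[of b k \<theta>] by blast
  have "(\<lambda>N. integral {real m..b} (\<lambda>u. wave k \<theta> u * dirich N u)) \<longlonglongrightarrow> wave k \<theta> (real m) * ((-1) ^ m / 2)"
  proof (rule dirichlet_local[where \<eta> = "1 - (b - real m)" and \<Lambda> = \<Lambda>])
    show "(\<lambda>N. dirich_int N b - dirich_int N (real m)) \<longlonglongrightarrow> (-1) ^ m / 2"
      using dirich_int_limit[OF assms] by simp
    show "\<bar>wave k \<theta> u - wave k \<theta> (real m)\<bar> \<le> \<Lambda> * \<bar>u - real m\<bar>" if "u \<in> {real m..b}" for u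
      by (rule \<Lambda>(2)) (use that assms in auto)
  qed (use assms \<Lambda>(1) in auto)
  then show ?thesis unfolding wave_nat_half coef_def .
qed

lemma wave_limit_left:
  assumes "real m < a" "a < real m + 1"
  shows "(\<lambda>N. integral {a..real (Suc m)} (\<lambda>u. wave k \<theta> u * dirich N u)) \<longlonglongrightarrow> coef k \<theta> (Suc m) / 2"
proof -
  obtain \<Lambda> where \<Lambda>: "\<Lambda> \<ge> 0" "\<And>u v. u \<in> {0..real (Suc m)} \<Longrightarrow> v \<in> {0..real (Suc m)} \<Longrightarrow> \<bar>wave k \<theta> u - wave k \<theta> v\<bar> \<le> \<Lambda> * \<bar>u - v\<bar>"
    using wave_lipschitz[of "real (Suc m)" k \<theta>] by blast
  have "(\<lambda>N. integral {a..real (Suc m)} (\<lambda>u. wave k \<theta> u * dirich N u)) \<longlonglongrightarrow> wave k \<theta> (real (Suc m)) * (0 - (-1) ^ m / 2)"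
  proof (rule dirichlet_local[where \<eta> = "a - real m" and \<Lambda> = \<Lambda>])
    show "(\<lambda>N. dirich_int N (real (Suc m)) - dirich_int N a) \<longlonglongrightarrow> 0 - (-1) ^ m / 2"
      using tendsto_diff[OF tendsto_const[of 0] dirich_int_limit[OF assms]] by (simp only: dirich_int_nat)
    show "\<bar>wave k \<theta> u - wave k \<theta> (real (Suc m))\<bar> \<le> \<Lambda> * \<bar>u - real (Suc m)\<bar>" if "u \<in> {a..real (Suc m)}" for u
      by (rule \<Lambda>(2)) (use that assms in auto)
  qed (use assms \<Lambda>(1) in auto)
  moreover have "wave k \<theta> (real (Suc m)) * (0 - (-1) ^ m / 2) = wave k \<theta> (real (Suc m)) * ((-1) ^ Suc m / 2)"
    by simp
  ultimately show ?thesis unfolding coef_def by (simp only: wave_nat_half)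
qed

lemma coef_0 [simp]: "coef k \<theta> 0 = 0"
  by (simp add: coef_def)

lemma wave_limit_nat: "(\<lambda>N. integral {0..real m} (\<lambda>u. wave k \<theta> u * dirich N u)) \<longlonglongrightarrow> (\<Sum>j<m. coef k \<theta> j) + coef k \<theta> m / 2"
proof (induction m)
  case 0 then show ?case by simp
next
  case (Suc m)
  have "integral {0..real (Suc m)} (\<lambda>u. wave k \<theta> u * dirich N u)
     = integral {0..real m} (\<lambda>u. wave k \<theta> u * dirich N u) + (integral {real m..real m + 1 / 2} (\<lambda>u. wave k \<theta> u * dirich N u)
     + integral {real m + 1 / 2..real (Suc m)} (\<lambda>u. wave k \<theta> u * dirich N u))" for N
    using integral_split[of 0 "real m" "real (Suc m)" "\<lambda>u. wave k \<theta> u * dirich N u", OF _ _ wave_integrable]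
      integral_split[of "real m" "real m + 1 / 2" "real (Suc m)" "\<lambda>u. wave k \<theta> u * dirich N u", OF _ _ wave_integrable]
    by simp
  moreover have "(\<lambda>N. integral {0..real m} (\<lambda>u. wave k \<theta> u * dirich N u) + (integral {real m..real m + 1 / 2} (\<lambda>u. wave k \<theta> u * dirich N u)
     + integral {real m + 1 / 2..real (Suc m)} (\<lambda>u. wave k \<theta> u * dirich N u))) \<longlonglongrightarrow>
      (\<Sum>j<m. coef k \<theta> j) + coef k \<theta> m / 2 + (coef k \<theta> m / 2 + coef k \<theta> (Suc m) / 2)"
    by (intro tendsto_add Suc wave_limit_right wave_limit_left) auto
  moreover have "(\<Sum>j<m. coef k \<theta> j) + coef k \<theta> m / 2 + (coef k \<theta> m / 2 + coef k \<theta> (Suc m) / 2)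
     = (\<Sum>j<Suc m. coef k \<theta> j) + coef k \<theta> (Suc m) / 2" by simp
  ultimately show ?case by (simp only:)
qed

text \<open>
Every integer collects one half of its coefficient from each side. An integer end point \<open>X\<close> is met from the left only,
which is the origin of the weight \<open>1/2\<close> in the primed sum.
\<close>

lemma wave_limit:
  assumes "X > 0"
  shows "(\<lambda>N. integral {0..X} (\<lambda>u. wave k \<theta> u * dirich N u)) \<longlonglongrightarrow> half_sum k \<theta> X"
proof -
  define m where "m = nat \<lfloor>X\<rfloor>"
  have m: "real m \<le> X" "X < real m + 1" using assms unfolding m_def by linarith+
  have fin: "finite {j. 1 \<le> j \<and> real j \<le> X}"
    by (rule finite_subset[of _ "{..m}"]) (use m in auto)
  show ?thesis
  proof (cases "X = real m")
    case True
    then have "m \<ge> 1" using assms by simp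
    have "half_sum k \<theta> X = (\<Sum>j\<in>insert m {1..<m}. (if real j = X then 1 / 2 else 1) * coef k \<theta> j)"
      unfolding half_sum_def by (rule sum.cong) (use True \<open>m\<ge>1\<close> in auto)
    also have "\<dots> = coef k \<theta> m / 2 + (\<Sum>j=1..<m. coef k \<theta> j)"
      using True by (subst sum.insert) (auto intro!: sum.cong)
    also have "(\<Sum>j=1..<m. coef k \<theta> j) = (\<Sum>j<m. coef k \<theta> j)"
      by (rule sum.mono_neutral_left) (auto simp: not_le)
    finally show ?thesis using wave_limit_nat[of m k \<theta>] True by (simp add: add.commute)
  next
    case False
    then have m': "real m < X" using m by simp
    have "half_sum k \<theta> X = (\<Sum>j=1..m. coef k \<theta> j)"
      unfolding half_sum_def by (rule sum.cong) (use m m' in auto)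
    also have "\<dots> = (\<Sum>j\<le>m. coef k \<theta> j)"
      by (rule sum.mono_neutral_left) (auto simp: not_le)
    also have "\<dots> = (\<Sum>j<m. coef k \<theta> j) + coef k \<theta> m / 2 + coef k \<theta> m / 2"
      by (simp flip: lessThan_Suc_atMost)
    finally have eq: "half_sum k \<theta> X = (\<Sum>j<m. coef k \<theta> j) + coef k \<theta> m / 2 + coef k \<theta> m / 2" .
    have "integral {0..X} (\<lambda>u. wave k \<theta> u * dirich N u) = integral {0..real m} (\<lambda>u. wave k \<theta> u * dirich N u) + integral {real m..X} (\<lambda>u. wave k \<theta> u * dirich N u)" for N
      by (rule integral_split) (use m wave_integrable in auto)
    then show ?thesis unfolding eq
      using tendsto_add[OF wave_limit_nat[of m k \<theta>] wave_limit_right[OF m' m(2), of k \<theta>]] by simp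
  qed
qed

section \<open>Bounds uniform in the length of the sum\<close>

lemma dirich_abs_le: "\<bar>dirich N v\<bar> \<le> 2 * real N"
proof -
  have "\<bar>dirich N v\<bar> \<le> (\<Sum>j<N. 2)"
    unfolding dirich_def by (rule order_trans[OF sum_abs], rule sum_mono) (simp add: abs_mult)
  then show ?thesis by simp
qed

text \<open>
The size of the Gibbs phenomenon. Up to \<open>u = 1 / N\<close> the kernel is at most \<open>2 N\<close>; beyond, one integration by parts
gains the factor \<open>1 / (N sin (\<pi> u))\<close>, which is bounded there.
\<close>

lemma dirich_int_bound_half:
  assumes "0 \<le> u" "u \<le> 1 / 2"
  shows "\<bar>dirich_int N u\<bar> \<le> 3"
proof -
  have zero: "dirich_int N 0 = 0" by (simp add: dirich_int_def)
  have near: "\<bar>dirich_int N d\<bar> \<le> 2 * real N * d" if "d \<ge> 0" for d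
  proof -
    have "norm (dirich_int N d - dirich_int N 0) \<le> 2 * real N * norm (d - 0)"
      by (rule field_differentiable_bound[of UNIV _ "dirich N"]) (use dirich_int_deriv dirich_abs_le in auto)
    then show ?thesis using that zero by simp
  qed
  show ?thesis
  proof (cases "real N * u \<le> 1")
    case True
    then show ?thesis using near[OF assms(1)] by simp
  next
    case False
    define d where "d = 1 / real N"
    have N: "N > 0" using False by (cases N) auto
    have d: "d > 0" "d < u" "real N * d = 1" using False N by (auto simp: d_def field_simps)
    define \<Phi> where "\<Phi> = (\<lambda>v. - cos (2 * pi * real N * v) / (2 * pi * real N * sin (pi * v)))"
    define q where "q = (\<lambda>v. cos (2 * pi * real N * v) * cos (pi * v) / (2 * real N * (sin (pi * v))\<^sup>2))"
    define q' where "q' = (\<lambda>v. cos (pi * v) / (2 * real N * (sin (pi * v))\<^sup>2))"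
    \<comment> \<open>\<open>\<Phi>\<close> is a primitive of the kernel up to the error \<open>q\<close>, which is dominated by the derivative \<open>q'\<close> of \<open>\<Psi>\<close>.\<close>
    define \<Psi> where "\<Psi> = (\<lambda>v. - 1 / (2 * pi * real N * sin (pi * v)))"
    have sp: "sin (pi * v) > 0" "sin (pi * v) \<ge> 2 * d" if "v \<in> {d..u}" for v
      using sin_pi_ge_half[of v] that assms d by auto
    have sn: "sin (pi * v) \<noteq> 0" if "v \<in> {d..u}" for v using sp(1)[OF that] by simp
    have I1: "((\<lambda>v. dirich N v + q v) has_integral (\<Phi> u - \<Phi> d)) {d..u}"
    proof (rule fundamental_theorem_of_calculus)
      fix v assume v: "v \<in> {d..u}"
      have "(\<Phi> has_real_derivative
         ((sin (2 * pi * real N * v) * (2 * pi * real N)) * (2 * pi * real N * sin (pi * v))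
           - (- cos (2 * pi * real N * v)) * (2 * pi * real N * (cos (pi * v) * pi))) / ((2 * pi * real N * sin (pi * v)) * (2 * pi * real N * sin (pi * v)))) (at v within {d..u})"
      proof -
        have A: "((\<lambda>v. - cos (2 * pi * real N * v)) has_real_derivative sin (2 * pi * real N * v) * (2 * pi * real N)) (at v within {d..u})"
          by (auto intro!: derivative_eq_intros)
        have B: "((\<lambda>v. 2 * pi * real N * sin (pi * v)) has_real_derivative 2 * pi * real N * (cos (pi * v) * pi)) (at v within {d..u})"
          by (auto intro!: derivative_eq_intros)
        show ?thesis unfolding \<Phi>_def by (rule DERIV_divide[OF A B]) (use sn[OF v] N in auto)
      qed
      also have "((sin (2 * pi * real N * v) * (2 * pi * real N)) * (2 * pi * real N * sin (pi * v))
           - (- cos (2 * pi * real N * v)) * (2 * pi * real N * (cos (pi * v) * pi))) / ((2 * pi * real N * sin (pi * v)) * (2 * pi * real N * sin (pi * v)))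
         = sin (2 * pi * real N * v) / sin (pi * v) + q v"
      proof -
        have "((A * (2 * pi * n)) * (2 * pi * n * S) - (- C) * (2 * pi * n * (D * pi))) / ((2 * pi * n * S) * (2 * pi * n * S))
          = A / S + C * D / (2 * n * S\<^sup>2)" if "n \<noteq> 0" "S \<noteq> 0" for A C D S n :: real
          using that by (simp add: divide_simps power2_eq_square) (simp add: algebra_simps)
        then show ?thesis unfolding q_def using sn[OF v] N by simp
      qed
      also have "sin (2 * pi * real N * v) / sin (pi * v) = dirich N v"
        using dirich_conv_sin[OF sn[OF v]] by simp
      finally show "(\<Phi> has_vector_derivative dirich N v + q v) (at v within {d..u})"
        by (simp add: has_real_derivative_iff_has_vector_derivative)
    qed (use d in simp)
    have I2: "(q' has_integral (\<Psi> u - \<Psi> d)) {d..u}"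
    proof (rule fundamental_theorem_of_calculus)
      fix v assume v: "v \<in> {d..u}"
      have "(\<Psi> has_real_derivative
         (0 * (2 * pi * real N * sin (pi * v)) - (- 1) * (2 * pi * real N * (cos (pi * v) * pi))) / ((2 * pi * real N * sin (pi * v)) * (2 * pi * real N * sin (pi * v)))) (at v within {d..u})"
        unfolding \<Psi>_def using sn[OF v] N
        by (auto intro!: derivative_eq_intros)
      also have "(0 * (2 * pi * real N * sin (pi * v)) - (- 1) * (2 * pi * real N * (cos (pi * v) * pi))) / ((2 * pi * real N * sin (pi * v)) * (2 * pi * real N * sin (pi * v))) = q' v"
        unfolding q'_def using sn[OF v] N by (simp add: divide_simps power2_eq_square)
      finally show "(\<Psi> has_vector_derivative q' v) (at v within {d..u})"
        by (simp add: has_real_derivative_iff_has_vector_derivative)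
    qed (use d in simp)
    have iq: "q integrable_on {d..u}"
      unfolding q_def using sn N by (intro integrable_continuous_real continuous_intros) auto
    have qq: "norm (q v) \<le> q' v" if "v \<in> {d..u}" for v
    proof -
      have "cos (pi * v) \<ge> 0" using that assms d by (intro cos_ge_zero) (auto simp: field_simps intro: order_trans[of _ 0])
      moreover have "\<bar>cos (2 * pi * real N * v)\<bar> * cos (pi * v) \<le> 1 * cos (pi * v)"
        using calculation by (intro mult_right_mono) auto
      ultimately show ?thesis unfolding q_def q'_def
        by (simp add: abs_divide abs_mult divide_right_mono)
    qed
    have "norm (integral {d..u} q) \<le> integral {d..u} q'"
      by (rule integral_norm_bound_integral[OF iq _ qq]) (use I2 in auto)
    also have "\<dots> = \<Psi> u - \<Psi> d" using I2 by (rule integral_unique)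
    finally have qb: "\<bar>integral {d..u} q\<bar> \<le> \<Psi> u - \<Psi> d" by simp
    have fr: "1 / (2 * pi * real N * sin (pi * v)) \<le> 1 / 12" "1 / (2 * pi * real N * sin (pi * v)) \<ge> 0" if "v \<in> {d..u}" for v
    proof -
      have "real N * sin (pi * v) \<ge> real N * (2 * d)" using sp(2)[OF that] by (intro mult_left_mono) auto
      then have "real N * sin (pi * v) \<ge> 2" using d(3) by (simp add: mult.left_commute)
      then have "2 * pi * (real N * sin (pi * v)) \<ge> 2 * 3 * 2"
        using pi_gt3 by (intro mult_mono) auto
      then show "1 / (2 * pi * real N * sin (pi * v)) \<le> 1 / 12" "1 / (2 * pi * real N * sin (pi * v)) \<ge> 0"
        by (auto simp: mult.assoc intro!: divide_left_mono)
    qed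
    have Pb: "\<bar>\<Phi> v\<bar> \<le> 1 / 12" if "v \<in> {d..u}" for v
    proof -
      have "\<bar>\<Phi> v\<bar> = \<bar>cos (2 * pi * real N * v)\<bar> * (1 / (2 * pi * real N * sin (pi * v)))"
        unfolding \<Phi>_def using sp(1)[OF that] by (simp add: abs_divide abs_mult)
      also have "\<dots> \<le> 1 * (1 / 12)" using fr[OF that] by (intro mult_mono) auto
      finally show ?thesis by simp
    qed
    have "dirich_int N u - dirich_int N d = \<Phi> u - \<Phi> d - integral {d..u} q"
      using has_integral_diff[OF I1 integrable_integral[OF iq]] dirich_has_integral[of d u N] d
      by (simp add: has_integral_unique)
    moreover have "\<bar>dirich_int N d\<bar> \<le> 2" using near[of d] d by simp
    moreover have "\<Psi> u - \<Psi> d \<le> 1 / 12" 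
  proof -
    have "\<Psi> u = - (1 / (2 * pi * real N * sin (pi * u)))" "\<Psi> d = - (1 / (2 * pi * real N * sin (pi * d)))"
      unfolding \<Psi>_def by simp_all
    moreover have "1 / (2 * pi * real N * sin (pi * u)) \<ge> 0" "1 / (2 * pi * real N * sin (pi * d)) \<le> 1 / 12"
      using fr(2)[of u] fr(1)[of d] d by (simp_all only: atLeastAtMost_iff less_imp_le order_refl simp_thms)
    ultimately show ?thesis by linarith
  qed
    moreover have "\<bar>\<Phi> u\<bar> \<le> 1 / 12" "\<bar>\<Phi> d\<bar> \<le> 1 / 12" using Pb d by auto
    ultimately show ?thesis using qb by linarith
  qed
qed

lemma dirich_int_bound:
  assumes "0 \<le> u" "u \<le> 1"
  shows "\<bar>dirich_int N u\<bar> \<le> 3"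
proof (cases "u \<le> 1 / 2")
  case True then show ?thesis using dirich_int_bound_half assms by simp
next
  case False
  have "dirich_int N u = dirich_int N (1 - u)"
    unfolding dirich_int_def
  proof (rule sum.cong)
    fix j
    have "pi * real (2 * j + 1) * (1 - u) = real (2 * j + 1) * pi - pi * real (2 * j + 1) * u"
      by (simp add: algebra_simps)
    then have "sin (pi * real (2 * j + 1) * (1 - u)) = sin (pi * real (2 * j + 1) * u)"
      by (simp only: sin_diff sin_npi cos_npi) (simp add: power_add)
    then show "2 * sin (pi * real (2 * j + 1) * u) / (pi * real (2 * j + 1)) = 2 * sin (pi * real (2 * j + 1) * (1 - u)) / (pi * real (2 * j + 1))"
      by simp
  qed simp
  then show ?thesis using dirich_int_bound_half[of "1 - u"] assms False by simp
qed

text \<open>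
The complex form of \<open>wave\<close> without its power. Over a unit step it is multiplied by \<open>cis (2 \<pi> \<theta>)\<close> (\<open>twist_shift\<close>).
\<close>

definition twist :: "real \<Rightarrow> nat \<Rightarrow> real \<Rightarrow> complex" where
  "twist \<theta> N u = cis (2 * pi * (\<theta> - 1 / 2) * u) * of_real (dirich N u)"

lemma twist_integrable: "twist \<theta> N integrable_on {a..b}"
  unfolding twist_def by (intro integrable_continuous_real continuous_intros)

lemma twist_shift: "twist \<theta> N (u + real m) = cis (2 * pi * \<theta>) ^ m * twist \<theta> N u"
proof -
  have "dirich N (u + real m) = (-1) ^ m * dirich N u"
    unfolding dirich_def sum_distrib_left
  proof (rule sum.cong)
    fix j
    have "pi * real (2 * j + 1) * (u + real m) = pi * real (2 * j + 1) * u + real ((2 * j + 1) * m) * pi"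
      by (simp add: algebra_simps)
    moreover have "(-1) ^ ((2 * j + 1) * m) = (-1::real) ^ m"
      by (simp add: power_add power_mult distrib_right)
    ultimately show "2 * cos (pi * real (2 * j + 1) * (u + real m)) = (-1) ^ m * (2 * cos (pi * real (2 * j + 1) * u))"
      by (simp only: cos_add sin_npi cos_npi) simp
  qed simp
  moreover have "cis (2 * pi * (\<theta> - 1 / 2) * (u + real m)) = cis (2 * pi * \<theta>) ^ m * (-1) ^ m * cis (2 * pi * (\<theta> - 1 / 2) * u)"
  proof -
    have "2 * pi * (\<theta> - 1 / 2) * (u + real m) = real m * (2 * pi * \<theta>) + (- (real m * pi)) + 2 * pi * (\<theta> - 1 / 2) * u"
      by (simp add: algebra_simps)
    moreover have "cis (- (real m * pi)) = (-1) ^ m"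
      by (simp add: complex_eq_iff)
    moreover have "cis (real m * (2 * pi * \<theta>)) = cis (2 * pi * \<theta>) ^ m" by (rule Complex.DeMoivre[symmetric])
    ultimately show ?thesis by (simp only: cis_mult[symmetric])
  qed
  ultimately have "twist \<theta> N (u + real m) = cis (2 * pi * \<theta>) ^ m * ((-1) ^ m * (-1) ^ m) * twist \<theta> N u"
    unfolding twist_def by simp
  moreover have "(-1) ^ m * (-1) ^ m = (1::complex)" by (simp flip: power_mult_distrib)
  ultimately show ?thesis by simp
qed

lemma twist_integral_unit:
  assumes "0 \<le> X" "X \<le> 1" "0 < \<theta>" "\<theta> < 1"
  shows "norm (integral {0..X} (twist \<theta> N)) \<le> 3 + 3 * pi"
proof -
  define a where "a = 2 * pi * (\<theta> - 1 / 2)"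
  have "\<bar>\<theta> - 1 / 2\<bar> \<le> 1 / 2" using assms by linarith
  then have "2 * pi * \<bar>\<theta> - 1 / 2\<bar> \<le> 2 * pi * (1 / 2)" by (intro mult_left_mono) auto
  then have a: "\<bar>a\<bar> \<le> pi" by (simp add: a_def abs_mult)
  let ?r = "\<lambda>u. (of_real a * \<i> * cis (a * u)) * of_real (dirich_int N u)"
  have ci: "continuous_on A (\<lambda>u. dirich_int N u)" for A
    using dirich_int_deriv by (meson DERIV_continuous continuous_on_eq_continuous_within)
  have [measurable]: "dirich_int N \<in> borel_measurable borel"
    by (rule borel_measurable_continuous_onI[OF ci])
  have "((\<lambda>u. twist \<theta> N u + ?r u) has_integral cis (a * X) * of_real (dirich_int N X) - cis (a * 0) * of_real (dirich_int N 0)) {0..X}"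
  proof (rule fundamental_theorem_of_calculus)
    fix u
    have "((\<lambda>u. of_real (dirich_int N u)) has_vector_derivative of_real (dirich N u)) (at u within {0..X})"
      by (rule has_vector_derivative_of_real[OF dirich_int_deriv])
    from has_vector_derivative_mult[OF cis_has_vector_derivative[of a] this]
    show "((\<lambda>u. cis (a * u) * of_real (dirich_int N u)) has_vector_derivative twist \<theta> N u + ?r u) (at u within {0..X})"
      by (simp add: twist_def a_def)
  qed (use assms in simp)
  moreover have ir: "?r integrable_on {0..X}"
    by (intro integrable_continuous_real continuous_intros ci)
  ultimately have "integral {0..X} (twist \<theta> N) = cis (a * X) * of_real (dirich_int N X) - integral {0..X} ?r"
    using integral_add[OF twist_integrable[of \<theta> N] ir] dirich_int_nat[of N 0] by (simp add: integral_unique)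
  moreover have "norm (integral {0..X} ?r) \<le> 3 * pi * (X - 0)"
  proof (rule norm_integral_le)
    show "norm (?r u) \<le> 3 * pi" if "u \<in> {0..X}" for u
      using mult_mono[OF a dirich_int_bound[of u N]] that assms by (simp add: norm_mult mult.commute)
  qed (use assms in auto)
  moreover from this have "norm (integral {0..X} ?r) \<le> 3 * pi"
    by (rule order_trans) (use assms in simp)
  moreover have "norm (cis (a * X) * of_real (dirich_int N X)) \<le> 3"
    using dirich_int_bound[of X N] assms by (simp add: norm_mult)
  ultimately show ?thesis
    using norm_triangle_ineq4[of "cis (a * X) * of_real (dirich_int N X)" "integral {0..X} ?r"]
    by (simp only:)
qed

lemma cis_2pi_neq_1: "0 < \<theta> \<Longrightarrow> \<theta> < 1 \<Longrightarrow> cis (2 * pi * \<theta>) \<noteq> 1"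
proof
  assume t: "0 < \<theta>" "\<theta> < 1" and "cis (2 * pi * \<theta>) = 1"
  then have "cos (2 * pi * \<theta>) = 1" by (metis cis.sel(1) one_complex.sel(1))
  then obtain n :: int where "2 * pi * \<theta> = of_int n * 2 * pi" using cos_one_2pi_int by metis
  then have "\<theta> = of_int n" by simp
  then show False using t by simp
qed

text \<open>
The integrals over consecutive unit intervals form a geometric progression with ratio \<open>cis (2 \<pi> \<theta>) \<noteq> 1\<close>. Adding
absolute values instead would give a bound that grows with \<open>X\<close>.
\<close>

lemma twist_integral_bound:
  assumes "0 < \<theta>" "\<theta> < 1"
  shows "\<exists>C\<ge>0. \<forall>N. \<forall>X\<ge>0. norm (integral {0..X} (twist \<theta> N)) \<le> C"
proof -
  define \<omega> where "\<omega> = cis (2 * pi * \<theta>)"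
  have \<omega>: "norm \<omega> = 1" "\<omega> \<noteq> 1" using cis_2pi_neq_1[OF assms] by (auto simp: \<omega>_def)
  define D where "D = 3 + 3 * pi"
  have D: "D \<ge> 0" by (simp add: D_def)
  have sh: "integral {real m..real m + Y} (twist \<theta> N) = \<omega> ^ m * integral {0..Y} (twist \<theta> N)" for m Y N
  proof -
    have "integral {real m..real m + Y} (twist \<theta> N) = integral {0..Y} (\<lambda>u. twist \<theta> N (u + real m))"
      using integral_shift_real_ivl[of "real m" "real m" "real m + Y" "twist \<theta> N"] by simp
    also have "\<dots> = \<omega> ^ m * integral {0..Y} (twist \<theta> N)" by (simp add: twist_shift \<omega>_def)
    finally show ?thesis .
  qed
  have nat: "integral {0..real m} (twist \<theta> N) = (\<Sum>j<m. \<omega> ^ j) * integral {0..1} (twist \<theta> N)" for m N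
  proof (induction m)
    case (Suc m)
    have "integral {0..real (Suc m)} (twist \<theta> N) = integral {0..real m} (twist \<theta> N) + integral {real m..real m + 1} (twist \<theta> N)"
      using integral_split[of 0 "real m" "real (Suc m)" "twist \<theta> N", OF _ _ twist_integrable] by (simp add: add.commute)
    then show ?case unfolding sh Suc by (simp add: distrib_right)
  qed simp
  have geo: "norm (\<Sum>j<m. \<omega> ^ j) \<le> 2 / norm (1 - \<omega>)" for m
  proof -
    have "(\<Sum>j<m. \<omega> ^ j) = (1 - \<omega> ^ m) / (1 - \<omega>)" by (simp add: sum_gp_strict \<omega>)
    moreover have "norm (1 - \<omega> ^ m) \<le> 2"
      by (rule order_trans[OF norm_triangle_ineq4]) (simp add: norm_power \<omega>)
    ultimately show ?thesis by (simp add: norm_divide divide_right_mono)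
  qed
  show ?thesis
  proof (intro exI[of _ "2 / norm (1 - \<omega>) * D + D"] conjI allI impI)
    show "0 \<le> 2 / norm (1 - \<omega>) * D + D" using D by simp
    fix N :: nat and X :: real assume X: "0 \<le> X"
    define m where "m = nat \<lfloor>X\<rfloor>"
    have m: "real m \<le> X" "X \<le> real m + 1" unfolding m_def using X by linarith+
    have "integral {0..X} (twist \<theta> N) = integral {0..real m} (twist \<theta> N) + integral {real m..real m + (X - real m)} (twist \<theta> N)"
      using integral_split[of 0 "real m" X "twist \<theta> N", OF _ m(1) twist_integrable] by simp
    also have "norm \<dots> \<le> norm (integral {0..real m} (twist \<theta> N)) + norm (integral {real m..real m + (X - real m)} (twist \<theta> N))"
      by (rule norm_triangle_ineq)
    also have "\<dots> \<le> 2 / norm (1 - \<omega>) * D + D"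
    proof (rule add_mono)
      show "norm (integral {0..real m} (twist \<theta> N)) \<le> 2 / norm (1 - \<omega>) * D"
        unfolding nat norm_mult
        using twist_integral_unit[of 1 \<theta> N] assms geo[of m] D unfolding D_def by (intro mult_mono) auto
      show "norm (integral {real m..real m + (X - real m)} (twist \<theta> N)) \<le> D"
        unfolding sh norm_mult norm_power \<omega> D_def using twist_integral_unit[of "X - real m" \<theta> N] assms m by simp
    qed
    finally show "norm (integral {0..X} (twist \<theta> N)) \<le> 2 / norm (1 - \<omega>) * D + D" .
  qed
qed

lemma dsin_Im: "dsin k z = Im (cis (real k * pi / 2) * cis z)"
  by (simp add: cis_mult dsin_def add.commute)

lemma Im_of_real_mult: "Im (of_real r * z) = r * Im z"
  by simp

text \<open>
Integration by parts against the bounded primitive of \<open>twist\<close>. The exponent \<open>k + 1\<close> is what the inner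
series needs: with \<open>X = x / u\<close> it is compensated by the factor \<open>u\<^sup>k\<^sup>+\<^sup>1\<close>.
\<close>

lemma wave_bound:
  assumes "0 < \<theta>" "\<theta> < 1"
  shows "\<exists>C\<ge>0. \<forall>N. \<forall>X\<ge>0. \<bar>integral {0..X} (\<lambda>u. wave k \<theta> u * dirich N u)\<bar> \<le> C * X ^ Suc k"
proof -
  obtain C where C: "C \<ge> 0" "\<And>N X. X \<ge> 0 \<Longrightarrow> norm (integral {0..X} (twist \<theta> N)) \<le> C"
    using twist_integral_bound[OF assms] by blast
  show ?thesis
  proof (intro exI[of _ "2 * C"] conjI allI impI)
    show "0 \<le> 2 * C" using C by simp
    fix N :: nat and X :: real assume X: "0 \<le> X"
    define Q where "Q = (\<lambda>u. integral {0..u} (twist \<theta> N))"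
    have cQ: "continuous_on {0..X} Q" unfolding Q_def by (rule indefinite_integral_continuous_1[OF twist_integrable])
    have ct: "continuous_on A (twist \<theta> N)" for A unfolding twist_def by (intro continuous_intros)
    let ?r = "\<lambda>u. of_real (real (Suc k) * u ^ k) * Q u"
    have "((\<lambda>u. of_real (u ^ Suc k) * twist \<theta> N u + ?r u) has_integral of_real (X ^ Suc k) * Q X - of_real (0 ^ Suc k) * Q 0) {0..X}"
    proof (rule fundamental_theorem_of_calculus[OF X])
      fix u assume u: "u \<in> {0..X}"
      have 1: "((\<lambda>u. of_real (u ^ Suc k)) has_vector_derivative (of_real (real (Suc k) * u ^ k) :: complex)) (at u within {0..X})"
        by (rule has_vector_derivative_of_real) (use DERIV_pow[of "Suc k" u "{0..X}"] in simp)
      have 2: "(Q has_vector_derivative twist \<theta> N u) (at u within {0..X})"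
        unfolding Q_def by (rule integral_has_vector_derivative[OF ct u])
      show "((\<lambda>u. of_real (u ^ Suc k) * Q u) has_vector_derivative of_real (u ^ Suc k) * twist \<theta> N u + ?r u) (at u within {0..X})"
        using has_vector_derivative_mult[OF 1 2] .
    qed
    moreover have ir: "?r integrable_on {0..X}" by (intro integrable_continuous_real continuous_intros cQ)
    moreover have it: "(\<lambda>u. of_real (u ^ Suc k) * twist \<theta> N u) integrable_on {0..X}"
      by (intro integrable_continuous_real continuous_intros ct)
    ultimately have eq: "integral {0..X} (\<lambda>u. of_real (u ^ Suc k) * twist \<theta> N u) = of_real (X ^ Suc k) * Q X - integral {0..X} ?r"
      using integral_add[OF it ir] by (simp add: integral_unique)
    have p: "((\<lambda>u. C * (real (Suc k) * u ^ k)) has_integral C * (X ^ Suc k - 0 ^ Suc k)) {0..X}"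
      by (intro has_integral_mult_right fundamental_theorem_of_calculus[OF X])
         (use DERIV_pow[of "Suc k"] in \<open>simp add: has_real_derivative_iff_has_vector_derivative[symmetric]\<close>)
    have "norm (integral {0..X} ?r) \<le> integral {0..X} (\<lambda>u. C * (real (Suc k) * u ^ k))"
    proof (rule integral_norm_bound_integral[OF ir])
      fix u assume u: "u \<in> {0..X}"
      have "norm (?r u) = (real (Suc k) * u ^ k) * norm (Q u)"
        using u unfolding norm_mult norm_of_real by simp
      also have "\<dots> \<le> (real (Suc k) * u ^ k) * C"
        using u C(2)[of u N] unfolding Q_def by (intro mult_left_mono) auto
      finally show "norm (?r u) \<le> C * (real (Suc k) * u ^ k)" by (simp only: mult.commute)
    qed (use p in auto)
    also have "\<dots> = C * X ^ Suc k" using integral_unique[OF p] by simp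
    finally have b1: "norm (integral {0..X} ?r) \<le> C * X ^ Suc k" .
    have b2: "norm (of_real (X ^ Suc k) * Q X) \<le> C * X ^ Suc k"
      unfolding norm_mult norm_of_real using C(2)[OF X, of N] X
      unfolding Q_def using mult_left_mono[OF C(2)[OF X, of N], of "X ^ Suc k"] by (simp add: mult.commute)
    have b3: "norm (integral {0..X} (\<lambda>u. of_real (u ^ Suc k) * twist \<theta> N u)) \<le> 2 * C * X ^ Suc k"
      unfolding eq using norm_triangle_ineq4[of "of_real (X ^ Suc k) * Q X" "integral {0..X} ?r"] b1 b2 by linarith
    have "((\<lambda>u. Im (cis (real k * pi / 2) * (of_real (u ^ Suc k) * twist \<theta> N u))) has_integral
        Im (cis (real k * pi / 2) * integral {0..X} (\<lambda>u. of_real (u ^ Suc k) * twist \<theta> N u))) {0..X}"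
      using has_integral_linear[OF has_integral_mult_right[OF integrable_integral[OF it], of "cis (real k * pi / 2)"] bounded_linear_Im]
      by (simp only: o_def)
    moreover have "Im (cis (real k * pi / 2) * (of_real (u ^ Suc k) * twist \<theta> N u)) = wave k \<theta> u * dirich N u" for u
    proof -
      have "cis (real k * pi / 2) * (of_real (u ^ Suc k) * twist \<theta> N u)
         = of_real (u ^ Suc k * dirich N u) * (cis (real k * pi / 2) * cis (2 * pi * (\<theta> - 1 / 2) * u))"
        unfolding twist_def of_real_mult by (simp only: ac_simps)
      then show ?thesis unfolding wave_def dsin_Im
        by (simp only: Im_of_real_mult) (simp only: ac_simps)
    qed
    ultimately have "integral {0..X} (\<lambda>u. wave k \<theta> u * dirich N u) = Im (cis (real k * pi / 2) * integral {0..X} (\<lambda>u. of_real (u ^ Suc k) * twist \<theta> N u))"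
      by (simp add: integral_unique)
    also have "\<bar>\<dots>\<bar> \<le> norm (cis (real k * pi / 2) * integral {0..X} (\<lambda>u. of_real (u ^ Suc k) * twist \<theta> N u))"
      by (rule abs_Im_le_cmod)
    also have "\<dots> \<le> 2 * C * X ^ Suc k" using b3 by (simp only: norm_mult norm_cis mult_1)
    finally show "\<bar>integral {0..X} (\<lambda>u. wave k \<theta> u * dirich N u)\<bar> \<le> 2 * C * X ^ Suc k" .
  qed
qed

section \<open>The hyperbola integral and the inner series\<close>

text \<open>
The difference of the two poles at the origin is bounded, by the quadratic Taylor estimate of the sine.
\<close>

lemma sin_pi_pole_bound:
  assumes "0 < u" "u \<le> 1 / 2"
  shows "\<bar>1 / sin (pi * u) - 1 / (pi * u)\<bar> \<le> pi / 4"
proof -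
  have s: "sin (pi * u) \<ge> 2 * u" using sin_pi_ge_half assms by simp
  then have sp: "sin (pi * u) > 0" using assms by simp
  have "\<bar>sin (pi * u) - (\<Sum>m<2. sin_coeff m * (pi * u) ^ m)\<bar> \<le> inverse (fact 2) * \<bar>pi * u\<bar> ^ 2"
    by (rule Maclaurin_sin_bound)
  then have m: "\<bar>sin (pi * u) - pi * u\<bar> \<le> (pi * u)\<^sup>2 / 2"
    by (simp add: sin_coeff_def numeral_2_eq_2)
  have "1 / sin (pi * u) - 1 / (pi * u) = (pi * u - sin (pi * u)) / (sin (pi * u) * (pi * u))"
    using sp assms by (simp add: field_simps)
  also have "\<bar>\<dots>\<bar> = \<bar>sin (pi * u) - pi * u\<bar> / (sin (pi * u) * (pi * u))"
    using sp assms by (simp add: abs_divide abs_mult abs_minus_commute)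
  also have "\<dots> \<le> ((pi * u)\<^sup>2 / 2) / (2 * u * (pi * u))"
    using m s assms by (intro frac_le mult_right_mono) auto
  also have "\<dots> = pi / 4" using assms by (simp add: power2_eq_square)
  finally show ?thesis .
qed

text \<open>
Replacing the factor of the kernel by its leading part \<open>S\<^sub>k(0) / (\<pi> u)\<close> and \<open>w\<close> by its chirp changes the factor of
\<open>sin (2 \<pi> N u)\<close> by a bounded function. What remains is the limit \<open>osc_limit\<close>. For even \<open>k\<close> the leading part is zero.
\<close>

lemma near_zero_limit:
  assumes eps: "0 < \<epsilon>" "\<epsilon> \<le> 1 / 2" and y: "0 < y" and \<omega>: "norm \<omega> = 1" "\<omega> \<noteq> 1"
    and [measurable]: "w \<in> borel_measurable borel" and K: "0 \<le> K"
    and wK: "\<And>u. 0 < u \<Longrightarrow> u \<le> \<epsilon> \<Longrightarrow> \<bar>w u\<bar> \<le> K"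
    and wv: "\<And>u. 0 < u \<Longrightarrow> u \<le> \<epsilon> \<Longrightarrow> \<bar>w u - Im (\<gamma> * chirp \<omega> c (y / u))\<bar> \<le> K * u"
  shows "(\<lambda>N. integral {0..\<epsilon>} (\<lambda>u. w u * (dsin k (2 * pi * (\<theta> - 1 / 2) * u) * dirich N u))) \<longlonglongrightarrow> 0"
proof -
  define s where "s = (\<lambda>u. dsin k (2 * pi * (\<theta> - 1 / 2) * u))"
  define v where "v = (\<lambda>u. Im (\<gamma> * chirp \<omega> c (y / u)))"
  define r where "r = (\<lambda>u. if u = 0 then 0 else w u * s u / sin (pi * u) - dsin k 0 * v u / (pi * u))"
  have [measurable]: "s \<in> borel_measurable borel" "v \<in> borel_measurable borel"
    unfolding s_def v_def by measurable
  have [measurable]: "r \<in> borel_measurable borel" unfolding r_def by measurable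
  define A where "A = K * (2 * pi * \<bar>\<theta> - 1 / 2\<bar>) / 2 + K * (pi / 4) + K / pi"
  have A: "A \<ge> 0" unfolding A_def using K by (intro add_nonneg_nonneg) auto
  have rA: "\<bar>r u\<bar> \<le> A" if u: "u \<in> {0..\<epsilon>}" for u
  proof (cases "u = 0")
    case True then show ?thesis using A by (simp add: r_def)
  next
    case False
    then have u: "0 < u" "u \<le> \<epsilon>" using u by auto
    have sp: "sin (pi * u) \<ge> 2 * u" using sin_pi_ge_half u eps by simp
    then have sp0: "sin (pi * u) > 0" using u by simp
    have "r u = w u * (s u - dsin k 0) / sin (pi * u) + dsin k 0 * w u * (1 / sin (pi * u) - 1 / (pi * u)) + dsin k 0 * (w u - v u) / (pi * u)"
      unfolding r_def using False by (simp add: algebra_simps diff_divide_distrib add_divide_distrib)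
    also have "\<bar>\<dots>\<bar> \<le> \<bar>w u * (s u - dsin k 0) / sin (pi * u)\<bar> + \<bar>dsin k 0 * w u * (1 / sin (pi * u) - 1 / (pi * u))\<bar> + \<bar>dsin k 0 * (w u - v u) / (pi * u)\<bar>"
      by (rule order_trans[OF abs_triangle_ineq add_right_mono[OF abs_triangle_ineq]])
    also have "\<dots> \<le> A" unfolding A_def
    proof (intro add_mono)
      have "\<bar>s u - dsin k 0\<bar> \<le> 2 * pi * \<bar>\<theta> - 1 / 2\<bar> * u"
        using dsin_lipschitz[of k "2 * pi * (\<theta> - 1 / 2) * u" 0] u unfolding s_def by (simp add: abs_mult)
      then have "\<bar>w u\<bar> * \<bar>s u - dsin k 0\<bar> / sin (pi * u) \<le> K * (2 * pi * \<bar>\<theta> - 1 / 2\<bar> * u) / (2 * u)"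
        using wK[OF u] sp u K by (intro frac_le mult_mono) auto
      then show "\<bar>w u * (s u - dsin k 0) / sin (pi * u)\<bar> \<le> K * (2 * pi * \<bar>\<theta> - 1 / 2\<bar>) / 2"
        using u sp0 by (simp add: abs_divide abs_mult)
      have "\<bar>dsin k 0 * w u\<bar> * \<bar>1 / sin (pi * u) - 1 / (pi * u)\<bar> \<le> (1 * K) * (pi / 4)"
        unfolding abs_mult using wK[OF u] dsin_bound[of k 0] sin_pi_pole_bound[of u] u eps K by (intro mult_mono) auto
      then show "\<bar>dsin k 0 * w u * (1 / sin (pi * u) - 1 / (pi * u))\<bar> \<le> K * (pi / 4)"
        by (simp only: abs_mult mult_1)
      have "\<bar>dsin k 0\<bar> * \<bar>w u - v u\<bar> / (pi * u) \<le> 1 * (K * u) / (pi * u)"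
        using wv[OF u] dsin_bound[of k 0] u unfolding v_def by (intro divide_right_mono mult_mono) auto
      then show "\<bar>dsin k 0 * (w u - v u) / (pi * u)\<bar> \<le> K / pi"
        using u by (simp add: abs_divide abs_mult)
    qed
    finally show ?thesis .
  qed
  have 1: "(\<lambda>N. integral {0..\<epsilon>} (\<lambda>u. r u * sin (2 * pi * real N * u))) \<longlonglongrightarrow> 0"
    by (rule riemann_lebesgue_sin[OF _ rA]) auto
  let ?f = "\<lambda>N u. of_real (sin (2 * pi * real N * u) / u) * chirp \<omega> c (y / u)"
  have 2: "(\<lambda>N. dsin k 0 / pi * Im (\<gamma> * integral {0..\<epsilon>} (?f N))) \<longlonglongrightarrow> dsin k 0 / pi * Im (\<gamma> * 0)"
    by (intro tendsto_intros osc_limit \<omega> eps y)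
  have fi: "?f N integrable_on {0..\<epsilon>}" for N
  proof (rule bounded_borel_integrable'[where K="2 * pi * real N"])
    show "norm (?f N u) \<le> 2 * pi * real N" if "u \<in> {0..\<epsilon>}" for u
      using abs_sin_div_le[of u "2 * pi * real N"] that by (simp only: norm_mult norm_of_real norm_chirp[OF \<omega>(1)]) simp
  qed measurable
  have ri: "(\<lambda>u. r u * sin (2 * pi * real N * u)) integrable_on {0..\<epsilon>}" for N
  proof (rule bounded_borel_integrable'[where K="A * 1"])
    show "norm (r u * sin (2 * pi * real N * u)) \<le> A * 1" if "u \<in> {0..\<epsilon>}" for u
      unfolding real_norm_def abs_mult using rA[OF that] A by (intro mult_mono) auto
  qed measurable
  have "integral {0..\<epsilon>} (\<lambda>u. w u * (s u * dirich N u)) = integral {0..\<epsilon>} (\<lambda>u. r u * sin (2 * pi * real N * u)) + dsin k 0 / pi * Im (\<gamma> * integral {0..\<epsilon>} (?f N))" for N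
  proof -
    have "((\<lambda>u. Im (\<gamma> * ?f N u)) has_integral Im (\<gamma> * integral {0..\<epsilon>} (?f N))) {0..\<epsilon>}"
      using has_integral_linear[OF has_integral_mult_right[OF integrable_integral[OF fi], of \<gamma>] bounded_linear_Im]
      by (simp only: o_def)
    then have "((\<lambda>u. r u * sin (2 * pi * real N * u) + dsin k 0 / pi * Im (\<gamma> * ?f N u)) has_integral
        integral {0..\<epsilon>} (\<lambda>u. r u * sin (2 * pi * real N * u)) + dsin k 0 / pi * Im (\<gamma> * integral {0..\<epsilon>} (?f N))) {0..\<epsilon>}"
      by (intro has_integral_add has_integral_mult_right integrable_integral[OF ri])
    moreover have "integral {0..\<epsilon>} (\<lambda>u. w u * (s u * dirich N u)) = integral {0..\<epsilon>} (\<lambda>u. r u * sin (2 * pi * real N * u) + dsin k 0 / pi * Im (\<gamma> * ?f N u))"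
    proof (rule integral_spike[of "{0}"])
      fix u assume "u \<in> {0..\<epsilon>} - {0}"
      then have u: "0 < u" "u \<le> \<epsilon>" by auto
      have "sin (pi * u) > 0" using sin_pi_ge_half[of u] u eps by simp
      then have D: "dirich N u = 1 / sin (pi * u) * sin (2 * pi * real N * u)" by (simp add: dirich_conv_sin)
      have "\<gamma> * ?f N u = of_real (sin (2 * pi * real N * u) / u) * (\<gamma> * chirp \<omega> c (y / u))" by (simp only: ac_simps)
      then have "Im (\<gamma> * ?f N u) = sin (2 * pi * real N * u) / u * v u" unfolding v_def by (simp only: Im_of_real_mult)
      then show "r u * sin (2 * pi * real N * u) + dsin k 0 / pi * Im (\<gamma> * ?f N u) = w u * (s u * dirich N u)"
        unfolding D r_def using u by (simp add: algebra_simps)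
    qed simp
    ultimately show ?thesis by (simp add: integral_unique)
  qed
  then show ?thesis using tendsto_add[OF 1 2] unfolding s_def by simp
qed

text \<open>
The part \<open>v \<le> V\<close> of the region \<open>u v < x\<close>, with the integration over \<open>u\<close> carried out.
\<close>

definition hyp_part :: "nat \<Rightarrow> real \<Rightarrow> real \<Rightarrow> real \<Rightarrow> real \<Rightarrow> real" where
  "hyp_part k x V s t = integral {0..V} (\<lambda>v. v ^ Suc k * dsin k (2 * pi * t * v) * cut_sine k s (x / v))"

text \<open>
The hyperbola method: the parts \<open>v \<le> V\<close> and \<open>u \<le> x / V\<close> overlap in a rectangle, whose contribution is a product.
For \<open>k = 0\<close> this is the transform of \<open>u v\<close> over the whole region. For larger \<open>k\<close> it is the value that replaces an integral
which may fail to converge absolutely.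
\<close>

definition hyp_int :: "nat \<Rightarrow> real \<Rightarrow> real \<Rightarrow> real \<Rightarrow> real \<Rightarrow> real" where
  "hyp_int k x V s t = hyp_part k x V s t + hyp_part k x (x / V) t s - cut_sine k s (x / V) * cut_sine k t V"

text \<open>
The oscillation in \<open>u\<close> saves exactly one power of \<open>x / v\<close>, which is enough for boundedness at the origin.
\<close>

lemma power_cut_sine_bound:
  assumes "s \<noteq> 0" "0 \<le> v" "0 < x"
  shows "\<bar>v ^ Suc k * cut_sine k s (x / v)\<bar> \<le> x ^ Suc k / (pi * \<bar>s\<bar>)"
proof (cases "v = 0")
  case True then show ?thesis using assms by simp
next
  case False
  have "\<bar>v ^ Suc k * cut_sine k s (x / v)\<bar> = v ^ Suc k * \<bar>cut_sine k s (x / v)\<bar>"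
    using assms by (simp add: abs_mult)
  also have "\<dots> \<le> v ^ Suc k * ((x / v) ^ Suc k / (pi * \<bar>s\<bar>))"
    using assms by (intro mult_left_mono cut_sine_bound) auto
  also have "\<dots> = x ^ Suc k / (pi * \<bar>s\<bar>)" using False by (simp add: power_divide del: power_Suc)
  finally show ?thesis .
qed

lemma hyp_part_integrand_bound:
  assumes "s \<noteq> 0" "0 \<le> v" "0 < x"
  shows "\<bar>v ^ Suc k * dsin k (2 * pi * t * v) * cut_sine k s (x / v)\<bar> \<le> x ^ Suc k / (pi * \<bar>s\<bar>)"
proof -
  have "\<bar>v ^ Suc k * dsin k (2 * pi * t * v) * cut_sine k s (x / v)\<bar> = \<bar>v ^ Suc k * cut_sine k s (x / v)\<bar> * \<bar>dsin k (2 * pi * t * v)\<bar>"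
    by (simp add: abs_mult)
  also have "\<dots> \<le> x ^ Suc k / (pi * \<bar>s\<bar>) * 1"
    by (intro mult_mono power_cut_sine_bound assms dsin_bound) (use assms in auto)
  finally show ?thesis by simp
qed

lemma hyp_part_integrable:
  assumes "s \<noteq> 0" "0 < x" "0 \<le> a"
  shows "(\<lambda>v. v ^ Suc k * dsin k (2 * pi * t * v) * cut_sine k s (x / v)) integrable_on {a..b}"
  by (rule bounded_borel_integrable'[where K="x ^ Suc k / (pi * \<bar>s\<bar>)"])
     (use hyp_part_integrand_bound[OF assms(1) _ assms(2)] assms in auto)

lemma hyp_part_minus_s: "hyp_part k x V (- s) t = (-1) ^ Suc k * hyp_part k x V s t"
proof -
  have "v ^ Suc k * dsin k (2 * pi * t * v) * cut_sine k (- s) (x / v) = (-1) ^ Suc k * (v ^ Suc k * dsin k (2 * pi * t * v) * cut_sine k s (x / v))" for v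
    unfolding cut_sine_minus by simp
  then show ?thesis unfolding hyp_part_def by (simp only: integral_mult_right)
qed

lemma hyp_part_minus_t: "hyp_part k x V s (- t) = (-1) ^ Suc k * hyp_part k x V s t"
proof -
  have "v ^ Suc k * dsin k (2 * pi * (- t) * v) * cut_sine k s (x / v) = (-1) ^ Suc k * (v ^ Suc k * dsin k (2 * pi * t * v) * cut_sine k s (x / v))" for v
    using dsin_minus[of k "2 * pi * t * v"] by simp
  then show ?thesis unfolding hyp_part_def by (simp only: integral_mult_right)
qed

lemma hyp_int_minus_s: "hyp_int k x V (- s) t = (-1) ^ Suc k * hyp_int k x V s t"
  unfolding hyp_int_def hyp_part_minus_s hyp_part_minus_t cut_sine_minus by (simp add: algebra_simps)

lemma hyp_int_minus_t: "hyp_int k x V s (- t) = (-1) ^ Suc k * hyp_int k x V s t"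
  unfolding hyp_int_def hyp_part_minus_s hyp_part_minus_t cut_sine_minus by (simp add: algebra_simps)

lemma dsin_pair_sum:
  "(\<Sum>n<N. dsin k (2 * pi * (real n + \<theta>) * v) + dsin k (2 * pi * (\<theta> - 1 - real n) * v)) = dsin k (2 * pi * (\<theta> - 1 / 2) * v) * dirich N v"
proof -
  have "dsin k (2 * pi * (real n + \<theta>) * v) + dsin k (2 * pi * (\<theta> - 1 - real n) * v) = dsin k (2 * pi * (\<theta> - 1 / 2) * v) * (2 * cos (pi * real (2 * n + 1) * v))" for n
  proof -
    have e: "(2 * pi * (real n + \<theta>) * v + 2 * pi * (\<theta> - 1 - real n) * v) / 2 = 2 * pi * (\<theta> - 1 / 2) * v"
      "(2 * pi * (real n + \<theta>) * v - 2 * pi * (\<theta> - 1 - real n) * v) / 2 = pi * real (2 * n + 1) * v"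
      by (simp_all add: algebra_simps add_divide_distrib diff_divide_distrib)
    show ?thesis unfolding dsin_sum_to_product e by (simp only: mult.left_commute mult.assoc)
  qed
  then show ?thesis unfolding dirich_def sum_distrib_left by simp
qed

lemma cut_sine_pair_sum:
  assumes "0 \<le> X"
  shows "((\<lambda>u. wave k \<theta> u * dirich N u) has_integral (\<Sum>n<N. cut_sine k (real n + \<theta>) X + cut_sine k (\<theta> - 1 - real n) X)) {0..X}"
proof -
  have "((\<lambda>u. \<Sum>n<N. u ^ Suc k * dsin k (2 * pi * (real n + \<theta>) * u) + u ^ Suc k * dsin k (2 * pi * (\<theta> - 1 - real n) * u)) has_integral (\<Sum>n<N. cut_sine k (real n + \<theta>) X + cut_sine k (\<theta> - 1 - real n) X)) {0..X}"
    by (intro has_integral_sum has_integral_add cut_sine_integral assms) auto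
  moreover have "(\<Sum>n<N. u ^ Suc k * dsin k (2 * pi * (real n + \<theta>) * u) + u ^ Suc k * dsin k (2 * pi * (\<theta> - 1 - real n) * u)) = wave k \<theta> u * dirich N u" for u
    unfolding wave_def mult.assoc[of "u ^ Suc k"] dsin_pair_sum[symmetric] sum_distrib_left by (simp add: distrib_left)
  ultimately show ?thesis by simp
qed

lemma cut_sine_pair_limit:
  "X > 0 \<Longrightarrow> (\<lambda>N. \<Sum>n<N. cut_sine k (real n + \<theta>) X + cut_sine k (\<theta> - 1 - real n) X) \<longlonglongrightarrow> half_sum k \<theta> X"
  using wave_limit[of X k \<theta>] integral_unique[OF cut_sine_pair_sum[of X k \<theta>]] by simp

lemma half_sum_small: "X < 1 \<Longrightarrow> half_sum k \<theta> X = 0"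
  unfolding half_sum_def by (rule sum.neutral) auto

lemma cis_1_neq_1: "cis 1 \<noteq> 1"
proof
  assume "cis 1 = 1"
  then have "sin 1 = (0::real)" by (metis cis.sel(2) one_complex.sel(2))
  moreover have "sin 1 > (0::real)" using sin_gt_zero[of 1] pi_gt3 by simp
  ultimately show False by simp
qed

lemma chirp_cis: "y \<ge> 0 \<Longrightarrow> chirp (cis 1) 1 y = cis y"
  unfolding chirp_def by (simp add: Complex.DeMoivre cis_mult)

text \<open>
The strip \<open>v \<le> 1/2\<close>. Near \<open>v = 0\<close> the inner transform behaves like \<open>S\<^sub>k\<^sub>+\<^sub>1 (2 \<pi> s x / v)\<close> with an error of order
\<open>v\<close>, so \<open>near_zero_limit\<close> applies with the chirp \<open>cis (2 \<pi> s x / v)\<close>.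
\<close>

lemma inner_first_part:
  assumes "s > 0" "0 < x"
  shows "(\<lambda>N. \<Sum>n<N. hyp_part k x (1 / 2) s (real n + \<theta>) + hyp_part k x (1 / 2) s (\<theta> - 1 - real n)) \<longlonglongrightarrow> 0"
proof -
  define w where "w = (\<lambda>v. v ^ Suc k * cut_sine k s (x / v))"
  have [measurable]: "w \<in> borel_measurable borel" unfolding w_def by measurable
  define K where "K = max (x ^ Suc k / (pi * \<bar>s\<bar>)) (x ^ Suc k / (2 * pi * s) * (real (Suc k) * (1 / (pi * (s * x)))))"
  have K0: "0 \<le> K" using assms by (auto simp: K_def le_max_iff_disj)
  define \<gamma> where "\<gamma> = of_real (- (x ^ Suc k / (2 * pi * s))) * cis (real (Suc k) * pi / 2)"
  have "(\<lambda>N. integral {0..1/2} (\<lambda>u. w u * (dsin k (2 * pi * (\<theta> - 1 / 2) * u) * dirich N u))) \<longlonglongrightarrow> 0"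
  proof (rule near_zero_limit[where y = "2 * pi * s * x" and \<omega> = "cis 1" and c = 1 and \<gamma> = \<gamma> and K = K])
    fix u :: real assume u: "0 < u" "u \<le> 1 / 2"
    show "\<bar>w u\<bar> \<le> K" unfolding w_def K_def
      using power_cut_sine_bound[of s u x k] assms u by (simp add: le_max_iff_disj)
    define z where "z = s * (x / u)"
    have z: "z > 0" using assms u by (simp add: z_def)
    have "w u = x ^ Suc k * ((x / u) * unit_sine (Suc k) k z)"
      using u unfolding w_def cut_sine_def z_def by (simp add: power_divide)
    also have "(x / u) * unit_sine (Suc k) k z = (real (Suc k) * unit_sine k (Suc k) z - dsin (Suc k) (2 * pi * z)) / (2 * pi * s)"
      using unit_sine_parts[of z k k] z assms u by (simp add: z_def field_simps)
    also have "x ^ Suc k * \<dots> = x ^ Suc k / (2 * pi * s) * (real (Suc k) * unit_sine k (Suc k) z) - x ^ Suc k / (2 * pi * s) * dsin (Suc k) (2 * pi * z)"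
      by (simp add: diff_divide_distrib right_diff_distrib)
    finally have w: "w u = \<dots>" .
    have "Im (\<gamma> * chirp (cis 1) 1 (2 * pi * s * x / u)) = - (x ^ Suc k / (2 * pi * s)) * dsin (Suc k) (2 * pi * z)"
      using assms u chirp_cis[of "2 * pi * s * x / u"] unfolding \<gamma>_def dsin_Im z_def
      by (simp only: mult.assoc Im_of_real_mult) simp
    then have "w u - Im (\<gamma> * chirp (cis 1) 1 (2 * pi * s * x / u)) = x ^ Suc k / (2 * pi * s) * (real (Suc k) * unit_sine k (Suc k) z)"
      unfolding w by linarith
    also have "\<bar>\<dots>\<bar> = x ^ Suc k / (2 * pi * s) * (real (Suc k) * \<bar>unit_sine k (Suc k) z\<bar>)"
      using assms by (simp add: abs_mult)
    also have "\<dots> \<le> x ^ Suc k / (2 * pi * s) * (real (Suc k) * (1 / (pi * \<bar>z\<bar>)))"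
      using unit_sine_decay[of z k "Suc k"] z assms by (intro mult_left_mono) auto
    also have "\<dots> = x ^ Suc k / (2 * pi * s) * (real (Suc k) * (1 / (pi * (s * x)))) * u"
      using z assms u by (simp add: z_def)
    also have "\<dots> \<le> K * u" using u by (intro mult_right_mono) (auto simp: K_def)
    finally show "\<bar>w u - Im (\<gamma> * chirp (cis 1) 1 (2 * pi * s * x / u))\<bar> \<le> K * u" .
  qed (use assms K0 cis_1_neq_1 in auto)
  moreover have "(\<Sum>n<N. hyp_part k x (1 / 2) s (real n + \<theta>) + hyp_part k x (1 / 2) s (\<theta> - 1 - real n)) = integral {0..1/2} (\<lambda>u. w u * (dsin k (2 * pi * (\<theta> - 1 / 2) * u) * dirich N u))" for N
  proof -
    have "((\<lambda>u. \<Sum>n<N. u ^ Suc k * dsin k (2 * pi * (real n + \<theta>) * u) * cut_sine k s (x / u) + u ^ Suc k * dsin k (2 * pi * (\<theta> - 1 - real n) * u) * cut_sine k s (x / u))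
      has_integral (\<Sum>n<N. hyp_part k x (1 / 2) s (real n + \<theta>) + hyp_part k x (1 / 2) s (\<theta> - 1 - real n))) {0..1/2}"
      unfolding hyp_part_def by (intro has_integral_sum has_integral_add integrable_integral hyp_part_integrable) (use assms in auto)
    moreover have "(\<Sum>n<N. u ^ Suc k * dsin k (2 * pi * (real n + \<theta>) * u) * cut_sine k s (x / u) + u ^ Suc k * dsin k (2 * pi * (\<theta> - 1 - real n) * u) * cut_sine k s (x / u)) = w u * (dsin k (2 * pi * (\<theta> - 1 / 2) * u) * dirich N u)" for u
      unfolding w_def dsin_pair_sum[symmetric] sum_distrib_left by (simp add: algebra_simps)
    ultimately show ?thesis by (simp add: integral_unique)
  qed
  ultimately show ?thesis by simp
qed

definition inner_value :: "nat \<Rightarrow> real \<Rightarrow> real \<Rightarrow> real \<Rightarrow> real" where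
  "inner_value k x \<theta> s = integral {0..2 * x} (\<lambda>u. u ^ Suc k * dsin k (2 * pi * s * u) * half_sum k \<theta> (x / u))"

text \<open>
Dominated convergence. The bound \<open>wave_bound\<close> at \<open>X = x / u\<close> cancels against \<open>u\<^sup>k\<^sup>+\<^sup>1\<close> and leaves a constant.
\<close>

lemma inner_second_part:
  assumes "0 < x" "0 < \<theta>" "\<theta> < 1"
  shows "(\<lambda>u. u ^ Suc k * dsin k (2 * pi * s * u) * half_sum k \<theta> (x / u)) integrable_on {0..2 * x}"
    and "(\<lambda>N. \<Sum>n<N. hyp_part k x (2 * x) (real n + \<theta>) s + hyp_part k x (2 * x) (\<theta> - 1 - real n) s) \<longlonglongrightarrow> inner_value k x \<theta> s"
proof -
  obtain C where C: "C \<ge> 0" "\<And>N X. X \<ge> 0 \<Longrightarrow> \<bar>integral {0..X} (\<lambda>u. wave k \<theta> u * dirich N u)\<bar> \<le> C * X ^ Suc k"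
    using wave_bound[OF assms(2,3)] by blast
  let ?P = "\<lambda>N X. \<Sum>n<N. cut_sine k (real n + \<theta>) X + cut_sine k (\<theta> - 1 - real n) X"
  let ?f = "\<lambda>N u. u ^ Suc k * dsin k (2 * pi * s * u) * ?P N (x / u)"
  have int: "(?f N has_integral (\<Sum>n<N. hyp_part k x (2 * x) (real n + \<theta>) s + hyp_part k x (2 * x) (\<theta> - 1 - real n) s)) {0..2 * x}" for N
  proof -
    have "((\<lambda>u. \<Sum>n<N. u ^ Suc k * dsin k (2 * pi * s * u) * cut_sine k (real n + \<theta>) (x / u) + u ^ Suc k * dsin k (2 * pi * s * u) * cut_sine k (\<theta> - 1 - real n) (x / u))
      has_integral (\<Sum>n<N. hyp_part k x (2 * x) (real n + \<theta>) s + hyp_part k x (2 * x) (\<theta> - 1 - real n) s)) {0..2 * x}"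
      unfolding hyp_part_def by (intro has_integral_sum has_integral_add integrable_integral hyp_part_integrable) (use assms in auto)
    then show ?thesis by (simp only: sum_distrib_left distrib_left)
  qed
  have bd: "norm (?f N u) \<le> C * x ^ Suc k" if "u \<in> {0..2 * x}" for N u
  proof (cases "u = 0")
    case True then show ?thesis using C assms by simp
  next
    case False
    then have u: "u > 0" using that by simp
    have "norm (?f N u) = u ^ Suc k * \<bar>dsin k (2 * pi * s * u)\<bar> * \<bar>?P N (x / u)\<bar>"
      unfolding real_norm_def abs_mult using u by simp
    also have "\<dots> \<le> u ^ Suc k * 1 * (C * (x / u) ^ Suc k)"
      using integral_unique[OF cut_sine_pair_sum[of "x / u" k \<theta> N]] C(2)[of "x / u" N] u assms dsin_bound
      by (intro mult_mono) auto
    also have "\<dots> = C * x ^ Suc k" using u by (simp add: power_divide del: power_Suc)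
    finally show ?thesis .
  qed
  have lim: "(\<lambda>N. ?f N u) \<longlonglongrightarrow> u ^ Suc k * dsin k (2 * pi * s * u) * half_sum k \<theta> (x / u)" if "u \<in> {0..2 * x}" for u
  proof (cases "u = 0")
    case True then show ?thesis by simp
  next
    case False
    then show ?thesis using that assms by (intro tendsto_intros cut_sine_pair_limit) auto
  qed
  have fi: "?f N integrable_on {0..2 * x}" for N using int by blast
  show "(\<lambda>u. u ^ Suc k * dsin k (2 * pi * s * u) * half_sum k \<theta> (x / u)) integrable_on {0..2 * x}"
    by (rule dominated_convergence(1)[OF fi _ bd lim]) auto
  have "(\<lambda>N. integral {0..2 * x} (?f N)) \<longlonglongrightarrow> inner_value k x \<theta> s"
    unfolding inner_value_def by (rule dominated_convergence(2)[OF fi _ bd lim]) auto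
  then show "(\<lambda>N. \<Sum>n<N. hyp_part k x (2 * x) (real n + \<theta>) s + hyp_part k x (2 * x) (\<theta> - 1 - real n) s) \<longlonglongrightarrow> inner_value k x \<theta> s"
    unfolding integral_unique[OF int] .
qed

lemma inner_value_minus: "inner_value k x \<theta> (- s) = (-1) ^ Suc k * inner_value k x \<theta> s"
proof -
  have "u ^ Suc k * dsin k (2 * pi * (- s) * u) * half_sum k \<theta> (x / u) = (-1) ^ Suc k * (u ^ Suc k * dsin k (2 * pi * s * u) * half_sum k \<theta> (x / u))" for u
    using dsin_minus[of k "2 * pi * s * u"] by simp
  then show ?thesis unfolding inner_value_def by (simp only: integral_mult_right)
qed

text \<open>
With \<open>V = 1/2\<close> neither the strip \<open>v \<le> 1/2\<close> nor the overlap contains a positive integer \<open>v\<close>, so that only the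
second part survives.
\<close>

lemma inner_limit_pos:
  assumes "s > 0" "0 < x" "0 < \<theta>" "\<theta> < 1"
  shows "(\<lambda>N. \<Sum>n<N. hyp_int k x (1 / 2) s (real n + \<theta>) + hyp_int k x (1 / 2) s (\<theta> - 1 - real n)) \<longlonglongrightarrow> inner_value k x \<theta> s"
proof -
  let ?P = "\<lambda>N X. \<Sum>n<N. cut_sine k (real n + \<theta>) X + cut_sine k (\<theta> - 1 - real n) X"
  have "(\<lambda>N. (\<Sum>n<N. hyp_part k x (1 / 2) s (real n + \<theta>) + hyp_part k x (1 / 2) s (\<theta> - 1 - real n))
     + (\<Sum>n<N. hyp_part k x (2 * x) (real n + \<theta>) s + hyp_part k x (2 * x) (\<theta> - 1 - real n) s) - cut_sine k s (2 * x) * ?P N (1 / 2))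
     \<longlonglongrightarrow> 0 + inner_value k x \<theta> s - cut_sine k s (2 * x) * half_sum k \<theta> (1 / 2)"
    by (intro tendsto_intros inner_first_part inner_second_part cut_sine_pair_limit assms) auto
  then show ?thesis
    by (simp add: half_sum_small hyp_int_def sum.distrib sum_subtractf sum_distrib_left mult.commute algebra_simps)
qed

lemma inner_limit:
  assumes "s \<noteq> 0" "0 < x" "0 < \<theta>" "\<theta> < 1"
  shows "(\<lambda>N. \<Sum>n<N. hyp_int k x (1 / 2) s (real n + \<theta>) + hyp_int k x (1 / 2) s (\<theta> - 1 - real n)) \<longlonglongrightarrow> inner_value k x \<theta> s"
proof (cases "s > 0")
  case True then show ?thesis using inner_limit_pos assms by blast
next
  case False
  have "(\<lambda>N. (-1) ^ Suc k * (\<Sum>n<N. hyp_int k x (1 / 2) (- s) (real n + \<theta>) + hyp_int k x (1 / 2) (- s) (\<theta> - 1 - real n))) \<longlonglongrightarrow> (-1) ^ Suc k * inner_value k x \<theta> (- s)"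
    by (intro tendsto_intros inner_limit_pos) (use False assms in auto)
  moreover have "(-1) ^ Suc k * inner_value k x \<theta> (- s) = inner_value k x \<theta> s"
    using inner_value_minus[of k x \<theta> "- s"] by simp
  moreover have "(-1) ^ Suc k * (\<Sum>n<N. hyp_int k x (1 / 2) (- s) (real n + \<theta>) + hyp_int k x (1 / 2) (- s) (\<theta> - 1 - real n)) = (\<Sum>n<N. hyp_int k x (1 / 2) s (real n + \<theta>) + hyp_int k x (1 / 2) s (\<theta> - 1 - real n))" for N
    using hyp_int_minus_s[of k x "1 / 2" "- s"] by (simp only: sum_distrib_left distrib_left minus_minus)
  ultimately show ?thesis by simp
qed

section \<open>The outer series\<close>

lemma power_Suc_diff_le:
  assumes "0 \<le> b" "b \<le> (a::real)"
  shows "a ^ Suc k - b ^ Suc k \<le> (a - b) * (real (Suc k) * a ^ k)"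
proof -
  have "a ^ Suc k - b ^ Suc k = (a - b) * (\<Sum>i<Suc k. b ^ (Suc k - Suc i) * a ^ i)"
    by (rule power_diff_sumr2)
  also have "\<dots> \<le> (a - b) * (\<Sum>i<Suc k. a ^ (Suc k - Suc i) * a ^ i)"
    using assms by (intro mult_left_mono sum_mono mult_right_mono power_mono) auto
  also have "(\<Sum>i<Suc k. a ^ (Suc k - Suc i) * a ^ i) = (\<Sum>i<Suc k. a ^ k)"
    by (rule sum.cong) (auto simp flip: power_add)
  finally show ?thesis by simp
qed

text \<open>
The increments of \<open>n\<^sup>k\<^sup>+\<^sup>1\<close> are sums of monomials in \<open>n\<close> and \<open>n + 1\<close> with nonnegative exponents.
\<close>

lemma power_increment_mono: "m \<le> n \<Longrightarrow> real (Suc m) ^ Suc k - real m ^ Suc k \<le> real (Suc n) ^ Suc k - real n ^ Suc k"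
proof -
  assume "m \<le> n"
  have "real (Suc j) ^ Suc k - real j ^ Suc k = (\<Sum>i<Suc k. real j ^ (Suc k - Suc i) * real (Suc j) ^ i)" for j
    using power_diff_sumr2[of "real (Suc j)" "Suc k" "real j"] by simp
  then show ?thesis using \<open>m \<le> n\<close> by (simp only:) (intro sum_mono mult_mono power_mono; simp)
qed

lemma abel_identity:
  fixes \<omega> :: complex and b :: "nat \<Rightarrow> complex"
  shows "(\<omega> - 1) * (\<Sum>n<N. b n * \<omega> ^ n) = b N * \<omega> ^ N - b 0 - (\<Sum>n<N. (b (Suc n) - b n) * \<omega> ^ Suc n)"
proof (induction N)
  case (Suc N)
  have "(\<omega> - 1) * (\<Sum>n<Suc N. b n * \<omega> ^ n) = (\<omega> - 1) * (\<Sum>n<N. b n * \<omega> ^ n) + (\<omega> - 1) * (b N * \<omega> ^ N)"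
    by (simp add: distrib_left)
  also have "\<dots> = b (Suc N) * \<omega> ^ Suc N - b 0 - (\<Sum>n<Suc N. (b (Suc n) - b n) * \<omega> ^ Suc n)"
    unfolding Suc by (simp add: algebra_simps)
  finally show ?case .
qed simp

lemma monotone_geometric_bound:
  fixes \<omega> :: complex and b :: "nat \<Rightarrow> real"
  assumes "norm \<omega> = 1" "mono b" "0 \<le> b 0"
  shows "norm ((\<omega> - 1) * (\<Sum>n<N. of_real (b n) * \<omega> ^ n)) \<le> 2 * b N"
proof -
  have "norm (\<Sum>n<N. (of_real (b (Suc n)) - of_real (b n)) * \<omega> ^ Suc n) \<le> (\<Sum>n<N. b (Suc n) - b n)"
  proof (rule sum_norm_le)
    fix n
    have "b n \<le> b (Suc n)" using assms(2) by (simp add: monoD)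
    then show "norm ((of_real (b (Suc n)) - of_real (b n)) * \<omega> ^ Suc n) \<le> b (Suc n) - b n"
      unfolding of_real_diff[symmetric] norm_mult norm_of_real norm_power assms(1) by simp
  qed
  also have "\<dots> = b N - b 0" by (rule sum_lessThan_telescope)
  finally have 1: "norm (\<Sum>n<N. (of_real (b (Suc n)) - of_real (b n)) * \<omega> ^ Suc n) \<le> b N - b 0" .
  have bN: "b 0 \<le> b N" using assms(2) by (simp add: monoD)
  have 2: "norm (of_real (b N) * \<omega> ^ N) = b N" "norm (of_real (b 0) :: complex) = b 0"
    using assms bN by (auto simp: norm_mult norm_power)
  show ?thesis unfolding abel_identity
    using norm_triangle_ineq4[of "of_real (b N) * \<omega> ^ N - of_real (b 0)" "\<Sum>n<N. (of_real (b (Suc n)) - of_real (b n)) * \<omega> ^ Suc n"]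
      norm_triangle_ineq4[of "of_real (b N) * \<omega> ^ N" "of_real (b 0) :: complex"] 1 2 by linarith
qed

text \<open>
Two summations by parts: the first extracts the boundary term of order \<open>N\<^sup>k\<^sup>+\<^sup>1\<close>, the second shows that the remaining sum, whose
weights are the increments of the power, is only of order \<open>N\<^sup>k\<close>.
\<close>

lemma power_geometric_asymp:
  fixes \<omega> :: complex
  assumes "norm \<omega> = 1" "\<omega> \<noteq> 1"
  shows "norm ((\<Sum>n\<le>N. of_real (real n ^ Suc k) * \<omega> ^ n) - of_real (real N ^ Suc k) * \<omega> ^ N * (\<omega> / (\<omega> - 1)))
    \<le> 2 / (norm (\<omega> - 1))\<^sup>2 * (real (Suc k) * real (Suc N) ^ k)"
proof -
  define d where "d = norm (\<omega> - 1)"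
  have d: "d > 0" using assms by (simp add: d_def)
  define b where "b = (\<lambda>n. real (Suc n) ^ Suc k - real n ^ Suc k)"
  define a where "a = (\<lambda>n. complex_of_real (real n ^ Suc k))"
  have "mono b" unfolding b_def by (intro monoI power_increment_mono)
  moreover have "0 \<le> b 0" by (simp add: b_def)
  ultimately have B: "norm ((\<omega> - 1) * (\<Sum>n<N. of_real (b n) * \<omega> ^ n)) \<le> 2 * b N"
    by (rule monotone_geometric_bound[OF assms(1)])
  have bN: "b N \<le> real (Suc k) * real (Suc N) ^ k"
    unfolding b_def using power_Suc_diff_le[of "real N" "real (Suc N)" k] by simp
  have "(\<omega> - 1) * (\<Sum>n<N. a n * \<omega> ^ n) = a N * \<omega> ^ N - \<omega> * (\<Sum>n<N. of_real (b n) * \<omega> ^ n)"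
  proof -
    have "(\<Sum>n<N. (a (Suc n) - a n) * \<omega> ^ Suc n) = \<omega> * (\<Sum>n<N. of_real (b n) * \<omega> ^ n)"
      unfolding sum_distrib_left a_def b_def of_real_diff by (simp only: power_Suc[of \<omega>] mult.left_commute)
    moreover have "a 0 = 0" by (simp add: a_def)
    ultimately show ?thesis by (simp only: abel_identity diff_zero)
  qed
  then have "(\<omega> - 1) * (\<Sum>n\<le>N. a n * \<omega> ^ n) = a N * \<omega> ^ N * \<omega> - \<omega> * (\<Sum>n<N. of_real (b n) * \<omega> ^ n)"
    by (simp add: lessThan_Suc_atMost[symmetric] algebra_simps)
  then have "(\<omega> - 1) * ((\<Sum>n\<le>N. a n * \<omega> ^ n) - a N * \<omega> ^ N * (\<omega> / (\<omega> - 1))) = - (\<omega> * (\<Sum>n<N. of_real (b n) * \<omega> ^ n))"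
    using assms by (simp add: right_diff_distrib)
  then have "d * norm ((\<Sum>n\<le>N. a n * \<omega> ^ n) - a N * \<omega> ^ N * (\<omega> / (\<omega> - 1))) = norm (\<Sum>n<N. of_real (b n) * \<omega> ^ n)"
    unfolding d_def norm_mult[symmetric] by (simp add: norm_mult assms)
  moreover have "d * norm (\<Sum>n<N. of_real (b n) * \<omega> ^ n) \<le> 2 * (real (Suc k) * real (Suc N) ^ k)"
    using B bN unfolding norm_mult d_def by linarith
  ultimately have "d * (d * norm ((\<Sum>n\<le>N. a n * \<omega> ^ n) - a N * \<omega> ^ N * (\<omega> / (\<omega> - 1)))) \<le> 2 * (real (Suc k) * real (Suc N) ^ k)"
    by simp
  then have "norm ((\<Sum>n\<le>N. a n * \<omega> ^ n) - a N * \<omega> ^ N * (\<omega> / (\<omega> - 1))) \<le> 2 * (real (Suc k) * real (Suc N) ^ k) / d\<^sup>2"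
    using d by (simp add: pos_le_divide_eq power2_eq_square mult.commute mult.left_commute)
  then show ?thesis unfolding a_def d_def by simp
qed

definition step_sum :: "nat \<Rightarrow> real \<Rightarrow> real \<Rightarrow> real" where
  "step_sum k \<theta> y = (\<Sum>n\<le>nat \<lfloor>y\<rfloor>. coef k \<theta> n)"

lemma borel_measurable_step_sum [measurable]: "step_sum k \<theta> \<in> borel_measurable borel"
proof -
  have "(\<lambda>y::real. nat \<lfloor>y\<rfloor>) \<in> measurable borel (count_space UNIV)" by measurable
  from measurable_compose[OF this, of "\<lambda>N. \<Sum>n\<le>N. coef k \<theta> n" borel]
  show ?thesis unfolding step_sum_def[abs_def] by simp
qed

lemma coef_Im: "coef k \<theta> n = Im (cis (real k * pi / 2) * (of_real (real n ^ Suc k) * cis (2 * pi * \<theta>) ^ n))"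
proof -
  have "cis (2 * pi * \<theta>) ^ n = cis (2 * pi * real n * \<theta>)"
    by (simp add: Complex.DeMoivre mult.commute mult.left_commute)
  then have "cis (real k * pi / 2) * (of_real (real n ^ Suc k) * cis (2 * pi * \<theta>) ^ n) = of_real (real n ^ Suc k) * (cis (real k * pi / 2) * cis (2 * pi * real n * \<theta>))"
    by (simp only: ac_simps)
  then show ?thesis unfolding coef_def dsin_Im by (simp only: Im_of_real_mult)
qed

text \<open>
The leading term is a chirp times \<open>y\<^sup>k\<^sup>+\<^sup>1\<close>, as \<open>near_zero_limit\<close> requires. Replacing the integer part of \<open>y\<close> by
\<open>y\<close> in the power costs only \<open>O(y\<^sup>k)\<close>.
\<close>

lemma step_sum_asymp:
  fixes k :: nat
  assumes "0 < \<theta>" "\<theta> < 1"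
  defines "\<omega> \<equiv> cis (2 * pi * \<theta>)"
  defines "\<gamma> \<equiv> cis (real k * pi / 2) * (\<omega> / (\<omega> - 1))"
  shows "\<exists>C\<ge>0. \<forall>y\<ge>1. \<bar>step_sum k \<theta> y - y ^ Suc k * Im (\<gamma> * chirp \<omega> 0 y)\<bar> \<le> C * y ^ k"
proof -
  have \<omega>: "norm \<omega> = 1" "\<omega> \<noteq> 1" using cis_2pi_neq_1[OF assms(1,2)] by (auto simp: \<omega>_def)
  define d where "d = norm (\<omega> - 1)"
  have d: "d > 0" using \<omega> by (simp add: d_def)
  define C where "C = 2 / d\<^sup>2 * (real (Suc k) * 2 ^ k) + real (Suc k) / d"
  have "C \<ge> 0" using d by (simp add: C_def)
  moreover have "\<bar>step_sum k \<theta> y - y ^ Suc k * Im (\<gamma> * chirp \<omega> 0 y)\<bar> \<le> C * y ^ k" if y: "y \<ge> 1" for y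
  proof -
    define N where "N = nat \<lfloor>y\<rfloor>"
    have N: "real N \<le> y" "y \<le> real N + 1" "N \<ge> 1" unfolding N_def using y by linarith+
    let ?S = "\<Sum>n\<le>N. of_real (real n ^ Suc k) * \<omega> ^ n"
    let ?L = "\<lambda>a. of_real (a ^ Suc k) * \<omega> ^ N * (\<omega> / (\<omega> - 1))"
    have S: "step_sum k \<theta> y = Im (cis (real k * pi / 2) * ?S)"
      unfolding step_sum_def coef_Im \<omega>_def[symmetric] N_def[symmetric] sum_distrib_left by (simp only: Im_sum)
    have ch: "chirp \<omega> 0 y = \<omega> ^ N" by (simp add: chirp_def N_def)
    have "cis (real k * pi / 2) * ?L y = of_real (y ^ Suc k) * (\<gamma> * chirp \<omega> 0 y)"
      unfolding \<gamma>_def ch by (simp only: ac_simps)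
    then have "y ^ Suc k * Im (\<gamma> * chirp \<omega> 0 y) = Im (cis (real k * pi / 2) * ?L y)"
      by (simp only: Im_of_real_mult)
    then have "step_sum k \<theta> y - y ^ Suc k * Im (\<gamma> * chirp \<omega> 0 y) = Im (cis (real k * pi / 2) * (?S - ?L y))"
      unfolding S right_diff_distrib minus_complex.sel by simp
    also have "\<bar>\<dots>\<bar> \<le> norm (?S - ?L y)"
      by (rule order_trans[OF abs_Im_le_cmod]) (simp only: norm_mult norm_cis mult_1 order_refl)
    also have "\<dots> \<le> norm (?S - ?L (real N)) + norm (?L (real N) - ?L y)"
      by (rule order_trans[OF _ norm_triangle_ineq]) simp
    also have "\<dots> \<le> 2 / d\<^sup>2 * (real (Suc k) * real (Suc N) ^ k) + (real (Suc k) * y ^ k) / d"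
    proof (rule add_mono)
      show "norm (?S - ?L (real N)) \<le> 2 / d\<^sup>2 * (real (Suc k) * real (Suc N) ^ k)"
        unfolding d_def by (rule power_geometric_asymp[OF \<omega>])
      have "?L (real N) - ?L y = of_real (real N ^ Suc k - y ^ Suc k) * \<omega> ^ N * (\<omega> / (\<omega> - 1))"
        by (simp only: of_real_diff left_diff_distrib)
      then have "norm (?L (real N) - ?L y) = \<bar>real N ^ Suc k - y ^ Suc k\<bar> / d"
        unfolding d_def by (simp only: norm_mult norm_divide norm_of_real norm_power \<omega> power_one) simp
      also have "\<bar>real N ^ Suc k - y ^ Suc k\<bar> = y ^ Suc k - real N ^ Suc k"
        using power_mono[OF N(1), of "Suc k"] by linarith
      also have "\<dots> \<le> (y - real N) * (real (Suc k) * y ^ k)"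
        by (rule power_Suc_diff_le) (use N in auto)
      also have "\<dots> \<le> 1 * (real (Suc k) * y ^ k)"
        using N y by (intro mult_right_mono) auto
      finally show "norm (?L (real N) - ?L y) \<le> (real (Suc k) * y ^ k) / d"
        using d by (simp add: divide_right_mono)
    qed
    also have "\<dots> \<le> 2 / d\<^sup>2 * (real (Suc k) * (2 * y) ^ k) + (real (Suc k) * y ^ k) / d"
      using N y d by (intro add_right_mono mult_left_mono power_mono) auto
    also have "\<dots> = C * y ^ k" by (simp add: C_def power_mult_distrib algebra_simps)
    finally show ?thesis .
  qed
  ultimately show ?thesis by blast
qed

lemma half_sum_eq_step_sum:
  assumes "\<And>n. X \<noteq> real n"
  shows "half_sum k \<theta> X = step_sum k \<theta> X"
proof (cases "X \<ge> 0")
  case True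
  have "half_sum k \<theta> X = (\<Sum>n=1..nat \<lfloor>X\<rfloor>. coef k \<theta> n)"
    unfolding half_sum_def
    by (rule sum.cong) (use assms True in \<open>auto simp: le_nat_floor le_nat_iff le_floor_iff\<close>)
  also have "\<dots> = step_sum k \<theta> X" unfolding step_sum_def
    by (rule sum.mono_neutral_left) (auto simp: not_le)
  finally show ?thesis .
next
  case False
  then have "nat \<lfloor>X\<rfloor> = 0" by linarith
  then show ?thesis using False by (simp add: half_sum_small step_sum_def)
qed

text \<open>
The interval is cut at \<open>\<epsilon> = x / N0 \<le> 1/2\<close>. To the right of \<open>\<epsilon>\<close> the sum over \<open>n \<le> x / u\<close> has at most \<open>N0\<close> terms and can be
interchanged with the integral, each term giving a limit of the form \<open>wave_limit\<close>. The interval \<open>[0, \<epsilon>]\<close> contributes nothing by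
\<open>near_zero_limit\<close>.
\<close>

lemma outer_limit:
  assumes "0 < x" "0 < \<theta>" "\<theta> < 1"
  shows "(\<lambda>M. \<Sum>m<M. inner_value k x \<theta> (real m + \<sigma>) + inner_value k x \<theta> (\<sigma> - 1 - real m))
    \<longlonglongrightarrow> (\<Sum>n | 1 \<le> n \<and> real n \<le> x. coef k \<theta> n * half_sum k \<sigma> (x / real n))"
proof -
  \<comment> \<open>Large enough that \<open>x / N0 \<le> 1/2\<close> and that all \<open>n \<le> x\<close> are included.\<close>
  define N0 where "N0 = Suc (nat \<lceil>2 * x\<rceil>)"
  have N0: "N0 \<ge> 1" "2 * x \<le> real N0" unfolding N0_def by linarith+
  define \<epsilon> where "\<epsilon> = x / real N0"
  have "real N0 \<ge> 1" using N0 by simp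
  then have N2: "1 \<le> real N0 * 2" by linarith
  then have eps: "\<epsilon> > 0" "\<epsilon> \<le> 1 / 2" "\<epsilon> \<le> 2 * x" using N0 assms N2 by (auto simp: \<epsilon>_def field_simps)
  define \<omega> where "\<omega> = cis (2 * pi * \<theta>)"
  have \<omega>: "norm \<omega> = 1" "\<omega> \<noteq> 1" using cis_2pi_neq_1[OF assms(2,3)] by (auto simp: \<omega>_def)
  define \<gamma> where "\<gamma> = cis (real k * pi / 2) * (\<omega> / (\<omega> - 1))"
  obtain C where C: "C \<ge> 0" "\<And>y. y \<ge> 1 \<Longrightarrow> \<bar>step_sum k \<theta> y - y ^ Suc k * Im (\<gamma> * chirp \<omega> 0 y)\<bar> \<le> C * y ^ k"
    using step_sum_asymp[OF assms(2,3), of k] unfolding \<gamma>_def \<omega>_def by blast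
  let ?g = "\<lambda>M u. wave k \<sigma> u * dirich M u"
  let ?P = "\<lambda>M X. integral {0..X} (?g M)"
  define w where "w = (\<lambda>u. u ^ Suc k * step_sum k \<theta> (x / u))"
  have [measurable]: "w \<in> borel_measurable borel" unfolding w_def by measurable
  let ?F = "\<lambda>M u. ?g M u * step_sum k \<theta> (x / u)"

  have near: "(\<lambda>M. integral {0..\<epsilon>} (\<lambda>u. w u * (dsin k (2 * pi * (\<sigma> - 1 / 2) * u) * dirich M u))) \<longlonglongrightarrow> 0"
  proof (rule near_zero_limit[where y = x and \<omega> = \<omega> and c = 0 and \<gamma> = "of_real (x ^ Suc k) * \<gamma>" and K = "max (x ^ Suc k * norm \<gamma> + C * x ^ k * \<epsilon>) (C * x ^ k)"])
    show "0 \<le> max (x ^ Suc k * norm \<gamma> + C * x ^ k * \<epsilon>) (C * x ^ k)"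
      using C assms by (simp add: le_max_iff_disj)
    fix u assume u: "0 < u" "u \<le> \<epsilon>"
    have y1: "x / u \<ge> 1"
    proof -
      have "x / \<epsilon> \<le> x / u" using u eps assms by (intro divide_left_mono) auto
      moreover have "x / \<epsilon> = real N0" using N0 assms by (simp add: \<epsilon>_def)
      ultimately show ?thesis using N0 by linarith
    qed
    have I: "Im (of_real (x ^ Suc k) * \<gamma> * chirp \<omega> 0 (x / u)) = u ^ Suc k * ((x / u) ^ Suc k * Im (\<gamma> * chirp \<omega> 0 (x / u)))"
    proof -
      have "u ^ Suc k * (x / u) ^ Suc k = x ^ Suc k" using u by (simp only: power_mult_distrib[symmetric]) simp
      then show ?thesis by (simp only: mult.assoc Im_of_real_mult) (simp only: mult.assoc[symmetric])
    qed
    have "\<bar>w u - Im (of_real (x ^ Suc k) * \<gamma> * chirp \<omega> 0 (x / u))\<bar>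
       = u ^ Suc k * \<bar>step_sum k \<theta> (x / u) - (x / u) ^ Suc k * Im (\<gamma> * chirp \<omega> 0 (x / u))\<bar>"
      unfolding I w_def right_diff_distrib[symmetric] abs_mult using u by simp
    also have "\<dots> \<le> u ^ Suc k * (C * (x / u) ^ k)"
      using u C(2)[OF y1] by (intro mult_left_mono) auto
    also have "\<dots> = C * x ^ k * u" using u by (simp add: power_divide)
    finally have diff: "\<bar>w u - Im (of_real (x ^ Suc k) * \<gamma> * chirp \<omega> 0 (x / u))\<bar> \<le> C * x ^ k * u" .
    also have "\<dots> \<le> max (x ^ Suc k * norm \<gamma> + C * x ^ k * \<epsilon>) (C * x ^ k) * u"
      using u by (intro mult_right_mono) auto
    finally show "\<bar>w u - Im (of_real (x ^ Suc k) * \<gamma> * chirp \<omega> 0 (x / u))\<bar> \<le> max (x ^ Suc k * norm \<gamma> + C * x ^ k * \<epsilon>) (C * x ^ k) * u" .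
    have "\<bar>Im (of_real (x ^ Suc k) * \<gamma> * chirp \<omega> 0 (x / u))\<bar> \<le> norm (of_real (x ^ Suc k) * \<gamma> * chirp \<omega> 0 (x / u))"
      by (rule abs_Im_le_cmod)
    also have "\<dots> = x ^ Suc k * norm \<gamma>" using assms by (simp only: norm_mult norm_of_real norm_chirp[OF \<omega>(1)]) simp
    finally have "\<bar>w u\<bar> \<le> x ^ Suc k * norm \<gamma> + C * x ^ k * u" using diff by linarith
    also have "\<dots> \<le> x ^ Suc k * norm \<gamma> + C * x ^ k * \<epsilon>"
      using u C assms by (intro add_left_mono mult_left_mono) auto
    finally show "\<bar>w u\<bar> \<le> max (x ^ Suc k * norm \<gamma> + C * x ^ k * \<epsilon>) (C * x ^ k)" by simp
  qed (use eps assms \<omega> in auto)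

  have wg: "w u * (dsin k (2 * pi * (\<sigma> - 1 / 2) * u) * dirich M u) = ?F M u" for M u
    unfolding w_def wave_def by simp

  have ind: "step_sum k \<theta> (x / u) = (\<Sum>n=1..N0. coef k \<theta> n * (if u \<in> {\<epsilon>..x / real n} then 1 else 0))" if u: "u \<in> {\<epsilon>..2 * x}" for u
  proof -
    have u0: "u > 0" using u eps by simp
    have "x / u \<le> real N0" using u u0 eps N0 assms by (simp add: \<epsilon>_def field_simps)
    then have le: "nat \<lfloor>x / u\<rfloor> \<le> N0" by linarith
    have "step_sum k \<theta> (x / u) = (\<Sum>n=1..nat \<lfloor>x / u\<rfloor>. coef k \<theta> n)"
      unfolding step_sum_def by (rule sum.mono_neutral_right) (auto simp: not_le)
    also have "\<dots> = (\<Sum>n=1..N0. if n \<le> nat \<lfloor>x / u\<rfloor> then coef k \<theta> n else 0)"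
      by (rule sum.mono_neutral_cong_left) (use le in auto)
    also have "\<dots> = (\<Sum>n=1..N0. coef k \<theta> n * (if u \<in> {\<epsilon>..x / real n} then 1 else 0))"
    proof (rule sum.cong)
      fix n assume "n \<in> {1..N0}"
      then have n: "real n > 0" by simp
      have "n \<le> nat \<lfloor>x / u\<rfloor> \<longleftrightarrow> real n \<le> x / u"
        using u0 assms by (simp add: le_nat_iff le_floor_iff)
      also have "\<dots> \<longleftrightarrow> u \<le> x / real n" using u0 n by (simp add: field_simps)
      finally show "(if n \<le> nat \<lfloor>x / u\<rfloor> then coef k \<theta> n else 0) = coef k \<theta> n * (if u \<in> {\<epsilon>..x / real n} then 1 else 0)"
        using u by simp
    qed simp
    finally show ?thesis .
  qed
  have far: "(?F M has_integral (\<Sum>n=1..N0. coef k \<theta> n * (?P M (x / real n) - ?P M \<epsilon>))) {\<epsilon>..2 * x}" for M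
  proof -
    have "((\<lambda>u. \<Sum>n=1..N0. coef k \<theta> n * (if u \<in> {\<epsilon>..x / real n} then ?g M u else 0)) has_integral (\<Sum>n=1..N0. coef k \<theta> n * (?P M (x / real n) - ?P M \<epsilon>))) {\<epsilon>..2 * x}"
    proof (intro has_integral_sum has_integral_mult_right)
      fix n assume "n \<in> {1..N0}"
      then have n: "1 \<le> n" "n \<le> N0" by auto
      have r: "\<epsilon> \<le> x / real n" "x / real n \<le> 2 * x"
        using n N0 assms by (auto simp: \<epsilon>_def field_simps)
      have "integral {\<epsilon>..x / real n} (?g M) = ?P M (x / real n) - ?P M \<epsilon>"
        using integral_split[of 0 \<epsilon> "x / real n" "?g M", OF _ r(1) wave_integrable] eps by simp
      then have "(?g M has_integral (?P M (x / real n) - ?P M \<epsilon>)) {\<epsilon>..x / real n}"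
        using integrable_integral[OF wave_integrable[of k \<sigma> M \<epsilon> "x / real n"]] by simp
      then show "((\<lambda>u. if u \<in> {\<epsilon>..x / real n} then ?g M u else 0) has_integral (?P M (x / real n) - ?P M \<epsilon>)) {\<epsilon>..2 * x}"
        by (subst has_integral_restrict) (use r in auto)
    qed simp
    then show ?thesis
    proof (rule has_integral_eq[rotated])
      fix u assume u: "u \<in> {\<epsilon>..2 * x}"
      show "(\<Sum>n=1..N0. coef k \<theta> n * (if u \<in> {\<epsilon>..x / real n} then ?g M u else 0)) = ?F M u"
        unfolding ind[OF u] sum_distrib_left by (rule sum.cong) auto
    qed
  qed
  have Fi: "?F M integrable_on {0..2 * x}" and Fint: "((\<Sum>m<M. inner_value k x \<theta> (real m + \<sigma>) + inner_value k x \<theta> (\<sigma> - 1 - real m))) = integral {0..2 * x} (?F M)" for M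
  proof -
    \<comment> \<open>The half weights differ from the plain step function only where \<open>x / u\<close> is an integer.\<close>
    have neg: "negligible (insert 0 (range (\<lambda>n::nat. x / real n)))"
      unfolding negligible_iff_null_sets by (intro null_sets_completionI countable_imp_null_set_lborel) auto
    have "((\<lambda>u. \<Sum>m<M. u ^ Suc k * dsin k (2 * pi * (real m + \<sigma>) * u) * half_sum k \<theta> (x / u) + u ^ Suc k * dsin k (2 * pi * (\<sigma> - 1 - real m) * u) * half_sum k \<theta> (x / u))
      has_integral (\<Sum>m<M. inner_value k x \<theta> (real m + \<sigma>) + inner_value k x \<theta> (\<sigma> - 1 - real m))) {0..2 * x}"
      unfolding inner_value_def by (intro has_integral_sum has_integral_add integrable_integral inner_second_part(1) assms) auto
    moreover have "(\<Sum>m<M. u ^ Suc k * dsin k (2 * pi * (real m + \<sigma>) * u) * half_sum k \<theta> (x / u) + u ^ Suc k * dsin k (2 * pi * (\<sigma> - 1 - real m) * u) * half_sum k \<theta> (x / u)) = ?g M u * half_sum k \<theta> (x / u)" for u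
      unfolding wave_def mult.assoc[of "u ^ Suc k"] dsin_pair_sum[symmetric] sum_distrib_left sum_distrib_right
      by (simp add: distrib_left distrib_right mult.assoc)
    ultimately have "((\<lambda>u. ?g M u * half_sum k \<theta> (x / u)) has_integral (\<Sum>m<M. inner_value k x \<theta> (real m + \<sigma>) + inner_value k x \<theta> (\<sigma> - 1 - real m))) {0..2 * x}"
      by simp
    then have "(?F M has_integral (\<Sum>m<M. inner_value k x \<theta> (real m + \<sigma>) + inner_value k x \<theta> (\<sigma> - 1 - real m))) {0..2 * x}"
    proof (rule has_integral_spike[OF neg, rotated])
      fix u assume u: "u \<in> {0..2 * x} - insert 0 (range (\<lambda>n::nat. x / real n))"
      have "x / u \<noteq> real n" for n
      proof
        assume "x / u = real n"
        then have "u = x / real n" using u assms by (auto simp: field_simps)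
        then show False using u by auto
      qed
      then have "half_sum k \<theta> (x / u) = step_sum k \<theta> (x / u)" by (rule half_sum_eq_step_sum)
      then show "?F M u = ?g M u * half_sum k \<theta> (x / u)" by (simp only:)
    qed
    then show "?F M integrable_on {0..2 * x}" "((\<Sum>m<M. inner_value k x \<theta> (real m + \<sigma>) + inner_value k x \<theta> (\<sigma> - 1 - real m))) = integral {0..2 * x} (?F M)"
      by (auto simp: integral_unique)
  qed
  have "(\<lambda>M. integral {0..\<epsilon>} (?F M) + (\<Sum>n=1..N0. coef k \<theta> n * (?P M (x / real n) - ?P M \<epsilon>))) \<longlonglongrightarrow> 0 + (\<Sum>n=1..N0. coef k \<theta> n * (half_sum k \<sigma> (x / real n) - half_sum k \<sigma> \<epsilon>))"
    by (intro tendsto_intros wave_limit near[unfolded wg]) (use assms eps in auto)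
  moreover have "integral {0..2 * x} (?F M) = integral {0..\<epsilon>} (?F M) + (\<Sum>n=1..N0. coef k \<theta> n * (?P M (x / real n) - ?P M \<epsilon>))" for M
    using integral_split[of 0 \<epsilon> "2 * x" "?F M", OF _ _ Fi] eps integral_unique[OF far] by simp
  moreover have "(\<Sum>n=1..N0. coef k \<theta> n * (half_sum k \<sigma> (x / real n) - half_sum k \<sigma> \<epsilon>)) = (\<Sum>n | 1 \<le> n \<and> real n \<le> x. coef k \<theta> n * half_sum k \<sigma> (x / real n))"
  proof (rule sum.mono_neutral_cong_right)
    show "{n. 1 \<le> n \<and> real n \<le> x} \<subseteq> {1..N0}" using N0 assms by auto
    show "\<forall>n\<in>{1..N0} - {n. 1 \<le> n \<and> real n \<le> x}. coef k \<theta> n * (half_sum k \<sigma> (x / real n) - half_sum k \<sigma> \<epsilon>) = 0"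
    proof
      fix n assume n: "n \<in> {1..N0} - {n. 1 \<le> n \<and> real n \<le> x}"
      then have "x / real n < 1" by (auto simp: field_simps)
      then show "coef k \<theta> n * (half_sum k \<sigma> (x / real n) - half_sum k \<sigma> \<epsilon>) = 0"
        using eps by (simp add: half_sum_small)
    qed
    show "coef k \<theta> n * (half_sum k \<sigma> (x / real n) - half_sum k \<sigma> \<epsilon>) = coef k \<theta> n * half_sum k \<sigma> (x / real n)" for n
      using eps by (simp add: half_sum_small)
  qed simp
  ultimately show ?thesis unfolding Fint by simp
qed

section \<open>The hyperbola integral as a function of \<open>s t\<close>\<close>

lemma hyp_part_deriv_V:
  assumes "0 < V" "0 < x" "s \<noteq> 0"
  shows "((\<lambda>V. hyp_part k x V s t) has_real_derivative V ^ Suc k * dsin k (2 * pi * t * V) * cut_sine k s (x / V)) (at V)"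
proof -
  let ?f = "\<lambda>v. v ^ Suc k * dsin k (2 * pi * t * v) * cut_sine k s (x / v)"
  have "continuous_on {0<..} ?f" by (intro continuous_intros) auto
  then have "continuous (at V within {0..V + 1}) ?f"
    using assms by (simp add: continuous_on_eq_continuous_at continuous_at_imp_continuous_at_within)
  then have "((\<lambda>u. integral {0..u} ?f) has_vector_derivative ?f V) (at V within {0..V + 1})"
    using integral_has_vector_derivative_continuous_at[of ?f 0 "V + 1" V "{}"] hyp_part_integrable[of s x 0 k t "V + 1"] assms by simp
  moreover have "at V within {0..V + 1} = at V" by (rule at_within_Icc_at) (use assms in auto)
  ultimately show ?thesis
    unfolding hyp_part_def has_real_derivative_iff_has_vector_derivative by simp
qed

text \<open>
The derivative with respect to \<open>V\<close> vanishes: moving the cut transfers a slice of the region from one part to the other, and the overlap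
term accounts for the end points.
\<close>

lemma hyp_int_indep:
  assumes "0 < V" "0 < V'" "0 < x" "s \<noteq> 0" "t \<noteq> 0"
  shows "hyp_int k x V s t = hyp_int k x V' s t"
proof -
  have "\<exists>c. \<forall>V\<in>{0<..}. hyp_int k x V s t = c"
  proof (rule has_field_derivative_zero_constant)
    fix V :: real assume "V \<in> {0<..}"
    then have V: "V > 0" by simp
    have xV: "((\<lambda>V. x / V) has_real_derivative - x / V\<^sup>2) (at V within {0<..})"
      using V by (auto intro!: derivative_eq_intros simp: power2_eq_square)
    have 1: "((\<lambda>V. hyp_part k x V s t) has_real_derivative V ^ Suc k * dsin k (2 * pi * t * V) * cut_sine k s (x / V)) (at V within {0<..})"
      by (rule DERIV_subset[OF hyp_part_deriv_V]) (use V assms in auto)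
    have "((\<lambda>W. hyp_part k x W t s) has_real_derivative (x / V) ^ Suc k * dsin k (2 * pi * s * (x / V)) * cut_sine k t (x / (x / V))) (at (x / V))"
      by (rule hyp_part_deriv_V) (use V assms in auto)
    moreover have "x / (x / V) = V" using assms by simp
    ultimately have "((\<lambda>W. hyp_part k x W t s) has_real_derivative (x / V) ^ Suc k * dsin k (2 * pi * s * (x / V)) * cut_sine k t V) (at (x / V))"
      by (simp only:)
    from DERIV_chain2[OF this xV]
    have 2: "((\<lambda>V. hyp_part k x (x / V) t s) has_real_derivative (x / V) ^ Suc k * dsin k (2 * pi * s * (x / V)) * cut_sine k t V * (- x / V\<^sup>2)) (at V within {0<..})" .
    have 3: "((\<lambda>V. cut_sine k s (x / V) * cut_sine k t V) has_real_derivative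
        cut_sine k s (x / V) * (V ^ Suc k * dsin k (2 * pi * t * V)) + ((x / V) ^ Suc k * dsin k (2 * pi * s * (x / V)) * (- x / V\<^sup>2)) * cut_sine k t V) (at V within {0<..})"
      by (rule DERIV_mult'[OF DERIV_chain2[OF cut_sine_deriv_X xV] cut_sine_deriv_X])
    show "((\<lambda>V. hyp_int k x V s t) has_real_derivative 0) (at V within {0<..})"
      using DERIV_diff[OF DERIV_add[OF 1 2] 3] unfolding hyp_int_def by (simp add: algebra_simps)
  qed auto
  then show ?thesis using assms by auto
qed

lemma integral_dilate:
  fixes f :: "real \<Rightarrow> real"
  assumes "0 < a" "f integrable_on {0..V}"
  shows "integral {0..V} f = integral {0..V / a} (\<lambda>v. a * f (a * v))"
proof -
  have "((\<lambda>v. f (a *\<^sub>R v + 0)) has_integral (integral {0..V} f /\<^sub>R a ^ DIM(real))) (cbox ((0 - 0) /\<^sub>R a) ((V - 0) /\<^sub>R a))"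
    using has_integral_affinity'[of f "integral {0..V} f" 0 V a 0] assms by (simp add: has_integral_integral)
  then have "((\<lambda>v. a * f (a * v)) has_integral a * (integral {0..V} f / a)) {0..V / a}"
    by (intro has_integral_mult_right) (simp add: divide_inverse mult.commute)
  moreover have "a * (integral {0..V} f / a) = integral {0..V} f" using assms by simp
  ultimately show ?thesis by (simp only: integral_unique)
qed

lemma hyp_part_scale:
  assumes "0 < a" "s \<noteq> 0" "0 < x"
  shows "hyp_part k x V (a * s) (t / a) = hyp_part k x (V / a) s t"
proof -
  let ?f = "\<lambda>v. v ^ Suc k * dsin k (2 * pi * (t / a) * v) * cut_sine k (a * s) (x / v)"
  have "hyp_part k x V (a * s) (t / a) = integral {0..V / a} (\<lambda>v. a * ?f (a * v))"
    unfolding hyp_part_def by (rule integral_dilate[OF assms(1) hyp_part_integrable]) (use assms in auto)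
  also have "(\<lambda>v. a * ?f (a * v)) = (\<lambda>v. v ^ Suc k * dsin k (2 * pi * t * v) * cut_sine k s (x / v))"
  proof
    fix v
    have "a * (x / (a * v)) = x / v" using assms by simp
    then have "cut_sine k (a * s) (x / (a * v)) = cut_sine k s (x / v) / a ^ (k + 2)"
      using cut_sine_scale[of a k s "x / (a * v)"] assms by simp
    moreover have "2 * pi * (t / a) * (a * v) = 2 * pi * t * v" using assms by simp
    moreover have "a * ((a * v) ^ Suc k * S * (c / a ^ (k + 2))) = v ^ Suc k * S * c" for S c
      using assms by (simp add: power_mult_distrib)
    ultimately show "a * ?f (a * v) = v ^ Suc k * dsin k (2 * pi * t * v) * cut_sine k s (x / v)"
      by (simp only:)
  qed
  finally show ?thesis unfolding hyp_part_def .
qed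

lemma hyp_int_scale:
  assumes "0 < a" "s \<noteq> 0" "t \<noteq> 0" "0 < x"
  shows "hyp_int k x V (a * s) (t / a) = hyp_int k x (V / a) s t"
proof -
  have 1: "hyp_part k x (x / V) (t / a) (a * s) = hyp_part k x (x / (V / a)) t s"
    using hyp_part_scale[of "1 / a" t x k "x / V" s] assms by (simp add: mult.commute)
  have 2: "cut_sine k (a * s) (x / V) = cut_sine k s (x / (V / a)) / a ^ (k + 2)"
    using cut_sine_scale[of a k s "x / V"] assms by (simp add: mult.commute)
  have 3: "cut_sine k (t / a) V = cut_sine k t (V / a) * a ^ (k + 2)"
    using cut_sine_scale[of "1 / a" k t V] assms by (simp add: power_divide)
  have 4: "a ^ (k + 2) \<noteq> 0" using assms by simp
  have 5: "cut_sine k (a * s) (x / V) * cut_sine k (t / a) V = cut_sine k s (x / (V / a)) * cut_sine k t (V / a)"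
  proof -
    have "p / c * (q * c) = p * q" if "c \<noteq> 0" for p q c :: real using that by simp
    from this[OF 4] show ?thesis unfolding 2 3 .
  qed
  show ?thesis
    unfolding hyp_int_def 1 5 using hyp_part_scale[of a s x k V t] assms by simp
qed

definition hyp_kernel :: "nat \<Rightarrow> real \<Rightarrow> real \<Rightarrow> real" where
  "hyp_kernel k x p = hyp_int k x 1 1 p"

text \<open>
Scaling \<open>s\<close> up and \<open>t\<close> down by the same factor only moves the cut \<open>V\<close>.
\<close>

lemma hyp_int_prod:
  assumes "0 < V" "0 < s" "0 < t" "0 < x"
  shows "hyp_int k x V s t = hyp_kernel k x (s * t)"
proof -
  have "hyp_int k x V (s * 1) (s * t / s) = hyp_int k x (V / s) 1 (s * t)"
    by (rule hyp_int_scale) (use assms in auto)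
  also have "\<dots> = hyp_int k x 1 1 (s * t)"
    by (rule hyp_int_indep) (use assms in auto)
  finally show ?thesis using assms by (simp add: hyp_kernel_def)
qed

lemma continuous_on_hyp_part_s:
  assumes "0 < c" "0 < x"
  shows "continuous_on {c..} (\<lambda>s. hyp_part k x V s t)"
  unfolding continuous_on_sequentially o_def
proof (intro allI ballI impI, elim conjE)
  fix S s assume s: "s \<in> {c..}" and S: "\<forall>n. S n \<in> {c..}" "S \<longlonglongrightarrow> s"
  show "(\<lambda>n. hyp_part k x V (S n) t) \<longlonglongrightarrow> hyp_part k x V s t"
    unfolding hyp_part_def
  proof (rule dominated_convergence(2)[where h = "\<lambda>_. x ^ Suc k / (pi * c)"])
    have Sc: "S n \<ge> c" for n using S(1) by simp
    show "(\<lambda>v. v ^ Suc k * dsin k (2 * pi * t * v) * cut_sine k (S n) (x / v)) integrable_on {0..V}" for n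
      by (rule hyp_part_integrable) (use Sc[of n] assms in auto)
    show "norm (v ^ Suc k * dsin k (2 * pi * t * v) * cut_sine k (S n) (x / v)) \<le> x ^ Suc k / (pi * c)" if "v \<in> {0..V}" for n v
    proof -
      have "norm (v ^ Suc k * dsin k (2 * pi * t * v) * cut_sine k (S n) (x / v)) \<le> x ^ Suc k / (pi * \<bar>S n\<bar>)"
        using hyp_part_integrand_bound[of "S n" v x k t] Sc[of n] that assms by simp
      also have "\<dots> \<le> x ^ Suc k / (pi * c)"
        using Sc[of n] assms by (intro divide_left_mono mult_left_mono) auto
      finally show ?thesis .
    qed
    show "(\<lambda>n. v ^ Suc k * dsin k (2 * pi * t * v) * cut_sine k (S n) (x / v)) \<longlonglongrightarrow> v ^ Suc k * dsin k (2 * pi * t * v) * cut_sine k s (x / v)" for v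
    proof (intro tendsto_intros)
      have "isCont (\<lambda>s. cut_sine k s (x / v)) s" using cut_sine_deriv_s by (rule DERIV_isCont)
      then show "(\<lambda>n. cut_sine k (S n) (x / v)) \<longlonglongrightarrow> cut_sine k s (x / v)" using S(2) by (rule isCont_tendsto_compose)
    qed
  qed auto
qed

lemma continuous_on_hyp_part_t:
  assumes "s \<noteq> 0" "0 < x"
  shows "continuous_on (A :: real set) (\<lambda>t. hyp_part k x V s t)"
  unfolding continuous_on_sequentially o_def
proof (intro allI ballI impI, elim conjE)
  fix T :: "nat \<Rightarrow> real" and t assume T: "T \<longlonglongrightarrow> t"
  show "(\<lambda>n. hyp_part k x V s (T n)) \<longlonglongrightarrow> hyp_part k x V s t"
    unfolding hyp_part_def
  proof (rule dominated_convergence(2)[where h = "\<lambda>_. x ^ Suc k / (pi * \<bar>s\<bar>)"])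
    show "(\<lambda>v. v ^ Suc k * dsin k (2 * pi * T n * v) * cut_sine k s (x / v)) integrable_on {0..V}" for n
      by (rule hyp_part_integrable) (use assms in auto)
    show "norm (v ^ Suc k * dsin k (2 * pi * T n * v) * cut_sine k s (x / v)) \<le> x ^ Suc k / (pi * \<bar>s\<bar>)" if "v \<in> {0..V}" for n v
      using hyp_part_integrand_bound[of s v x k "T n"] that assms by simp
    show "(\<lambda>n. v ^ Suc k * dsin k (2 * pi * T n * v) * cut_sine k s (x / v)) \<longlonglongrightarrow> v ^ Suc k * dsin k (2 * pi * t * v) * cut_sine k s (x / v)" for v
    proof (intro tendsto_intros)
      have "isCont (\<lambda>t. dsin k (2 * pi * t * v)) t" by (intro DERIV_isCont[of _ "dsin (Suc k) (2 * pi * t * v) * (2 * pi * v)"]) (auto intro!: derivative_eq_intros)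
      then show "(\<lambda>n. dsin k (2 * pi * T n * v)) \<longlonglongrightarrow> dsin k (2 * pi * t * v)" using T by (rule isCont_tendsto_compose)
    qed
  qed auto
qed

lemma continuous_on_positive_reals:
  fixes f :: "real \<Rightarrow> real"
  assumes "\<And>c. c > 0 \<Longrightarrow> continuous_on {c..} f"
  shows "continuous_on {0<..} f"
proof (rule continuous_at_imp_continuous_on, rule ballI)
  fix p :: real assume "p \<in> {0<..}"
  then have p: "p > 0" by simp
  have "continuous_on {p / 2<..} f"
    by (rule continuous_on_subset[OF assms[of "p / 2"]]) (use p in auto)
  then show "isCont f p" using p by (simp add: continuous_on_eq_continuous_at)
qed

text \<open>
Both parts are continuous by dominated convergence. As a function of \<open>p\<close> the second part has an integrand of size \<open>1 / p\<close>, so its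
continuity is first shown on half-lines bounded away from \<open>0\<close>.
\<close>

lemma continuous_on_hyp_kernel:
  assumes "0 < x"
  shows "continuous_on {0<..} (hyp_kernel k x)"
  unfolding hyp_kernel_def[abs_def] hyp_int_def
  by (intro continuous_intros continuous_on_hyp_part_t continuous_on_positive_reals[of "\<lambda>p. hyp_part k x (x / 1) p 1"] continuous_on_hyp_part_s)
     (use assms in auto)

lemma fubini_box:
  fixes f :: "real \<Rightarrow> real \<Rightarrow> real"
  assumes [measurable]: "case_prod f \<in> borel_measurable (borel \<Otimes>\<^sub>M borel)"
    and bd: "\<And>a b. a \<in> {a1..a2} \<Longrightarrow> b \<in> {b1..b2} \<Longrightarrow> \<bar>f a b\<bar> \<le> K"
  shows "((\<lambda>a. integral {b1..b2} (f a)) has_integral integral {b1..b2} (\<lambda>b. integral {a1..a2} (\<lambda>a. f a b))) {a1..a2}"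
proof -
  define g where "g = (\<lambda>a b. indicator {a1..a2} a * (indicator {b1..b2} b * f a b))"
  have gm: "case_prod g \<in> borel_measurable (lborel \<Otimes>\<^sub>M lborel)" unfolding g_def by measurable
  have "emeasure (lborel \<Otimes>\<^sub>M lborel) ({a1..a2} \<times> {b1..b2}) = emeasure lborel {a1..a2} * emeasure lborel {b1..b2}"
    by (rule lborel.emeasure_pair_measure_Times) auto
  also have "\<dots> < \<infinity>" by (simp add: ennreal_mult_less_top emeasure_lborel_Icc_eq)
  finally have fin: "emeasure (lborel \<Otimes>\<^sub>M lborel) ({a1..a2} \<times> {b1..b2}) < \<infinity>" .
  have "integrable (lborel \<Otimes>\<^sub>M lborel) (\<lambda>z. indicator ({a1..a2} \<times> {b1..b2}) z *\<^sub>R case_prod f z)"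
    by (rule integrableI_bounded_set_indicator[where B = K])
       (use bd fin in \<open>auto intro!: AE_I2\<close>)
  moreover have "(\<lambda>z. indicator ({a1..a2} \<times> {b1..b2}) z *\<^sub>R case_prod f z) = case_prod g"
    by (auto simp: g_def indicator_def)
  ultimately have gi: "integrable (lborel \<Otimes>\<^sub>M lborel) (case_prod g)" by simp
  have fm1 [measurable]: "f a \<in> borel_measurable borel" for a
    using measurable_compose[OF measurable_Pair1'[of a borel borel] assms(1)] by simp
  have fm2 [measurable]: "(\<lambda>a. f a b) \<in> borel_measurable borel" for b
    using measurable_compose[OF measurable_Pair2'[of b borel borel] assms(1)] by simp
  have in1: "(LBINT b. g a b) = indicator {a1..a2} a * integral {b1..b2} (f a)" for a
  proof (cases "a \<in> {a1..a2}")
    case True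
    have "set_integrable lborel {b1..b2} (f a)"
      unfolding set_integrable_def
      by (rule integrableI_bounded_set_indicator[where B = K])
         (use bd[OF True] in \<open>auto simp: emeasure_lborel_Icc_eq intro!: AE_I2\<close>)
    from set_borel_integral_eq_integral(2)[OF this] show ?thesis
      using True by (simp add: g_def set_lebesgue_integral_def)
  qed (simp add: g_def)
  have in2: "(LBINT a. g a b) = indicator {b1..b2} b * integral {a1..a2} (\<lambda>a. f a b)" for b
  proof (cases "b \<in> {b1..b2}")
    case True
    have "set_integrable lborel {a1..a2} (\<lambda>a. f a b)"
      unfolding set_integrable_def
      by (rule integrableI_bounded_set_indicator[where B = K])
         (use bd[OF _ True] in \<open>auto simp: emeasure_lborel_Icc_eq intro!: AE_I2\<close>)
    from set_borel_integral_eq_integral(2)[OF this] show ?thesis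
      using True by (simp add: g_def set_lebesgue_integral_def mult.left_commute)
  qed (simp add: g_def)
  have s1: "set_integrable lborel {a1..a2} (\<lambda>a. integral {b1..b2} (f a))"
    using lborel_pair.integrable_fst[OF gi] unfolding set_integrable_def in1 by simp
  have s2: "set_integrable lborel {b1..b2} (\<lambda>b. integral {a1..a2} (\<lambda>a. f a b))"
    using lborel_pair.integrable_snd[OF gi] unfolding set_integrable_def in2 by simp
  have "(LBINT b. LBINT a. g a b) = (LBINT a. LBINT b. g a b)"
    by (rule lborel_pair.Fubini_integral[OF gi])
  then have "integral {a1..a2} (\<lambda>a. integral {b1..b2} (f a)) = integral {b1..b2} (\<lambda>b. integral {a1..a2} (\<lambda>a. f a b))"
    unfolding in1 in2 using set_borel_integral_eq_integral(2)[OF s1] set_borel_integral_eq_integral(2)[OF s2]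
    by (simp add: set_lebesgue_integral_def)
  moreover have "(\<lambda>a. integral {b1..b2} (f a)) integrable_on {a1..a2}"
    by (rule set_borel_integral_eq_integral(1)[OF s1])
  ultimately show ?thesis by (simp add: has_integral_iff)
qed

section \<open>Second differences of the hyperbola integral\<close>

text \<open>
The form of Fubini's theorem for a separated integrand, where the integrations over \<open>p\<close> and \<open>q\<close> act on different factors. It
includes the integrability of the iterated integral in the outer variable.
\<close>

lemma integral_product_swap:
  fixes a b :: "real \<Rightarrow> real \<Rightarrow> real" and A B :: "real \<Rightarrow> real"
  assumes [measurable]: "case_prod a \<in> borel_measurable (borel \<Otimes>\<^sub>M borel)" "case_prod b \<in> borel_measurable (borel \<Otimes>\<^sub>M borel)"
      "B \<in> borel_measurable borel"
    and Ka: "\<And>p v. p \<in> {p1..p2} \<Longrightarrow> v \<in> {0..V} \<Longrightarrow> \<bar>a p v\<bar> \<le> Ka"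
    and Kb: "\<And>q v. q \<in> {q1..q2} \<Longrightarrow> v \<in> {0..V} \<Longrightarrow> \<bar>b q v\<bar> \<le> Kb"
    and KB: "\<And>v. v \<in> {0..V} \<Longrightarrow> \<bar>B v\<bar> \<le> KB" and K0: "0 \<le> Ka" "0 \<le> Kb" "0 \<le> KB"
    and A: "\<And>v. v \<in> {0..V} \<Longrightarrow> ((\<lambda>p. a p v) has_integral A v) {p1..p2}"
    and B: "\<And>v. v \<in> {0..V} \<Longrightarrow> ((\<lambda>q. b q v) has_integral B v) {q1..q2}"
  shows "((\<lambda>p. integral {q1..q2} (\<lambda>q. integral {0..V} (\<lambda>v. a p v * b q v))) has_integral
     integral {0..V} (\<lambda>v. A v * B v)) {p1..p2}"
proof -
  have am [measurable]: "a p \<in> borel_measurable borel" for p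
    using measurable_compose[OF measurable_Pair1'[of p borel borel] assms(1)] by simp
  have inner: "integral {q1..q2} (\<lambda>q. integral {0..V} (\<lambda>v. a p v * b q v)) = integral {0..V} (\<lambda>v. a p v * B v)" if p: "p \<in> {p1..p2}" for p
  proof -
    have "((\<lambda>q. integral {0..V} (\<lambda>v. a p v * b q v)) has_integral integral {0..V} (\<lambda>v. integral {q1..q2} (\<lambda>q. a p v * b q v))) {q1..q2}"
    proof (rule fubini_box[where K = "Ka * Kb"])
      show "(\<lambda>(q, v). a p v * b q v) \<in> borel_measurable (borel \<Otimes>\<^sub>M borel)" by measurable
      show "\<bar>a p v * b q v\<bar> \<le> Ka * Kb" if "q \<in> {q1..q2}" "v \<in> {0..V}" for q v
        unfolding abs_mult using Ka[OF p that(2)] Kb[OF that] K0 by (intro mult_mono) auto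
    qed
    moreover have "integral {0..V} (\<lambda>v. integral {q1..q2} (\<lambda>q. a p v * b q v)) = integral {0..V} (\<lambda>v. a p v * B v)"
      by (rule Henstock_Kurzweil_Integration.integral_cong) (use B in \<open>simp add: integral_unique\<close>)
    ultimately show ?thesis by (simp add: integral_unique)
  qed
  have "((\<lambda>p. integral {0..V} (\<lambda>v. a p v * B v)) has_integral integral {0..V} (\<lambda>v. integral {p1..p2} (\<lambda>p. a p v * B v))) {p1..p2}"
  proof (rule fubini_box[where K = "Ka * KB"])
    show "(\<lambda>(p, v). a p v * B v) \<in> borel_measurable (borel \<Otimes>\<^sub>M borel)" by measurable
    show "\<bar>a p v * B v\<bar> \<le> Ka * KB" if "p \<in> {p1..p2}" "v \<in> {0..V}" for p v
      unfolding abs_mult using Ka[OF that] KB[OF that(2)] K0 by (intro mult_mono) auto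
  qed
  moreover have "integral {0..V} (\<lambda>v. integral {p1..p2} (\<lambda>p. a p v * B v)) = integral {0..V} (\<lambda>v. A v * B v)"
    by (rule Henstock_Kurzweil_Integration.integral_cong) (use A in \<open>simp add: integral_unique\<close>)
  ultimately show ?thesis
    by (subst has_integral_cong[OF inner]) simp_all
qed

text \<open>
The integral over \<open>s\<close> of the factor \<open>v\<^sup>k\<^sup>+\<^sup>2 * cut_sine (k + 1) s (x / v)\<close>, see \<open>wedge_A_integral\<close>. The factor \<open>v\<close> gained by
differentiating \<open>S\<^sub>k (2 \<pi> t v)\<close> is placed here, since it is needed to keep this factor bounded at \<open>v = 0\<close>.
\<close>

definition wedge_A :: "nat \<Rightarrow> real \<Rightarrow> real \<Rightarrow> real \<Rightarrow> real \<Rightarrow> real" where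
  "wedge_A k x s1 s2 v = v ^ Suc (Suc k) * (cut_sine k s2 (x / v) - cut_sine k s1 (x / v)) / (2 * pi)"

definition wedge_B :: "nat \<Rightarrow> real \<Rightarrow> real \<Rightarrow> real \<Rightarrow> real" where
  "wedge_B k t1 t2 v = (if v = 0 then (t2 - t1) * dsin (Suc k) 0
     else (dsin k (2 * pi * t2 * v) - dsin k (2 * pi * t1 * v)) / (2 * pi * v))"

lemma wedge_A_integral:
  assumes "s1 \<le> s2"
  shows "((\<lambda>s. v ^ Suc (Suc k) * cut_sine (Suc k) s (x / v)) has_integral wedge_A k x s1 s2 v) {s1..s2}"
proof -
  have "((\<lambda>s. v ^ Suc (Suc k) * cut_sine (Suc k) s (x / v)) has_integral
     v ^ Suc (Suc k) * cut_sine k s2 (x / v) / (2 * pi) - v ^ Suc (Suc k) * cut_sine k s1 (x / v) / (2 * pi)) {s1..s2}"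
  proof (rule fundamental_theorem_of_calculus[OF assms])
    fix s
    have "((\<lambda>s. v ^ Suc (Suc k) * cut_sine k s (x / v) / (2 * pi)) has_real_derivative v ^ Suc (Suc k) * (2 * pi * cut_sine (Suc k) s (x / v)) / (2 * pi)) (at s within {s1..s2})"
      by (intro DERIV_cdivide DERIV_cmult cut_sine_deriv_s)
    moreover have "w * (2 * pi * c) / (2 * pi) = w * c" for w c :: real by simp
    ultimately show "((\<lambda>s. v ^ Suc (Suc k) * cut_sine k s (x / v) / (2 * pi)) has_vector_derivative v ^ Suc (Suc k) * cut_sine (Suc k) s (x / v)) (at s within {s1..s2})"
      by (simp only: has_real_derivative_iff_has_vector_derivative)
  qed
  then show ?thesis by (simp only: wedge_A_def right_diff_distrib diff_divide_distrib)
qed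

lemma wedge_B_integral:
  assumes "t1 \<le> t2"
  shows "((\<lambda>t. dsin (Suc k) (2 * pi * t * v)) has_integral wedge_B k t1 t2 v) {t1..t2}"
proof (cases "v = 0")
  case True
  then show ?thesis using has_integral_const_real[of "dsin (Suc k) 0" t1 t2] assms by (simp add: wedge_B_def)
next
  case False
  have "((\<lambda>t. dsin (Suc k) (2 * pi * t * v)) has_integral
     dsin k (2 * pi * t2 * v) / (2 * pi * v) - dsin k (2 * pi * t1 * v) / (2 * pi * v)) {t1..t2}"
  proof (rule fundamental_theorem_of_calculus[OF assms])
    fix t
    have "((\<lambda>t. dsin k (2 * pi * t * v)) has_real_derivative dsin (Suc k) (2 * pi * t * v) * (2 * pi * v)) (at t within {t1..t2})"
      by (auto intro!: derivative_eq_intros)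
    from DERIV_cdivide[OF this, of "2 * pi * v"]
    show "((\<lambda>t. dsin k (2 * pi * t * v) / (2 * pi * v)) has_vector_derivative dsin (Suc k) (2 * pi * t * v)) (at t within {t1..t2})"
      using False by (simp add: has_real_derivative_iff_has_vector_derivative)
  qed
  then show ?thesis using False by (simp add: wedge_B_def diff_divide_distrib)
qed

lemma borel_measurable_wedge [measurable]:
  "wedge_A k x s1 s2 \<in> borel_measurable borel" "wedge_B k t1 t2 \<in> borel_measurable borel"
  unfolding wedge_A_def[abs_def] wedge_B_def[abs_def] by measurable

lemma power_cut_sine_bound_from:
  assumes "0 < s1" "s \<in> {s1..s2}" "0 < x" "0 \<le> v"
  shows "\<bar>v ^ Suc (Suc k) * cut_sine (Suc k) s (x / v)\<bar> \<le> x ^ Suc (Suc k) / (pi * s1)"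
proof -
  have "\<bar>v ^ Suc (Suc k) * cut_sine (Suc k) s (x / v)\<bar> \<le> x ^ Suc (Suc k) / (pi * \<bar>s\<bar>)"
    using power_cut_sine_bound[of s v x "Suc k"] assms by simp
  also have "\<dots> \<le> x ^ Suc (Suc k) / (pi * s1)"
    using assms by (intro divide_left_mono mult_left_mono) auto
  finally show ?thesis .
qed

lemma wedge_A_bound:
  assumes "0 < s1" "s1 \<le> s2" "0 < x" "0 \<le> v"
  shows "\<bar>wedge_A k x s1 s2 v\<bar> \<le> x ^ Suc (Suc k) / (pi * s1) * (s2 - s1)"
proof -
  have "norm (integral {s1..s2} (\<lambda>s. v ^ Suc (Suc k) * cut_sine (Suc k) s (x / v))) \<le> x ^ Suc (Suc k) / (pi * s1) * (s2 - s1)"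
    by (rule norm_integral_le) (use power_cut_sine_bound_from[of s1 _ s2 x v k] assms in auto)
  then show ?thesis using integral_unique[OF wedge_A_integral[OF assms(2)]] by simp
qed

lemma wedge_B_bound:
  assumes "t1 \<le> t2"
  shows "\<bar>wedge_B k t1 t2 v\<bar> \<le> t2 - t1"
proof -
  have "norm (integral {t1..t2} (\<lambda>t. dsin (Suc k) (2 * pi * t * v))) \<le> 1 * (t2 - t1)"
    by (rule norm_integral_le) (use assms dsin_bound in auto)
  then show ?thesis using integral_unique[OF wedge_B_integral[OF assms]] by simp
qed

lemma hyp_part_second_difference:
  assumes "0 < s1" "s1 \<le> s2" "0 < x"
  shows "hyp_part k x V s2 t2 - hyp_part k x V s1 t2 - hyp_part k x V s2 t1 + hyp_part k x V s1 t1
     = 4 * pi\<^sup>2 * integral {0..V} (\<lambda>v. wedge_A k x s1 s2 v * wedge_B k t1 t2 v)"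
proof -
  let ?f = "\<lambda>s t v. v ^ Suc k * dsin k (2 * pi * t * v) * cut_sine k s (x / v)"
  have I: "(?f s t has_integral hyp_part k x V s t) {0..V}" if "s \<in> {s1, s2}" for s t
    unfolding hyp_part_def by (intro integrable_integral hyp_part_integrable) (use that assms in auto)
  have "((\<lambda>v. ?f s2 t2 v - ?f s1 t2 v - ?f s2 t1 v + ?f s1 t1 v) has_integral
     (hyp_part k x V s2 t2 - hyp_part k x V s1 t2 - hyp_part k x V s2 t1 + hyp_part k x V s1 t1)) {0..V}"
    by (intro has_integral_add has_integral_diff I) auto
  moreover have "?f s2 t2 v - ?f s1 t2 v - ?f s2 t1 v + ?f s1 t1 v = 4 * pi\<^sup>2 * (wedge_A k x s1 s2 v * wedge_B k t1 t2 v)" for v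
  proof (cases "v = 0")
    case True then show ?thesis by (simp add: wedge_A_def)
  next
    case False
    have "4 * pi\<^sup>2 * ((v ^ Suc (Suc k) * c / (2 * pi)) * (d / (2 * pi * v))) = v ^ Suc k * c * d" for c d
      using False by (simp add: power2_eq_square)
    then show ?thesis using False by (simp only: wedge_A_def wedge_B_def if_False) (simp add: algebra_simps)
  qed
  ultimately have "((\<lambda>v. 4 * pi\<^sup>2 * (wedge_A k x s1 s2 v * wedge_B k t1 t2 v)) has_integral
     (hyp_part k x V s2 t2 - hyp_part k x V s1 t2 - hyp_part k x V s2 t1 + hyp_part k x V s1 t1)) {0..V}" by simp
  then show ?thesis by (metis integral_mult_right integral_unique)
qed

lemma hyp_part_mixed_1:
  assumes "0 < s1" "s1 \<le> s2" "t1 \<le> t2" "0 < x"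
  shows "((\<lambda>t. integral {s1..s2} (\<lambda>s. hyp_part (Suc k) x V s t)) has_integral
    integral {0..V} (\<lambda>v. wedge_A k x s1 s2 v * wedge_B k t1 t2 v)) {t1..t2}"
proof -
  have "((\<lambda>t. integral {s1..s2} (\<lambda>s. integral {0..V} (\<lambda>v. dsin (Suc k) (2 * pi * t * v) * (v ^ Suc (Suc k) * cut_sine (Suc k) s (x / v))))) has_integral
    integral {0..V} (\<lambda>v. wedge_B k t1 t2 v * wedge_A k x s1 s2 v)) {t1..t2}"
  proof (rule integral_product_swap)
    show "\<bar>dsin (Suc k) (2 * pi * p * v)\<bar> \<le> 1" for p v by (rule dsin_bound)
    show "\<bar>v ^ Suc (Suc k) * cut_sine (Suc k) q (x / v)\<bar> \<le> x ^ Suc (Suc k) / (pi * s1)" if "q \<in> {s1..s2}" "v \<in> {0..V}" for q v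
      by (rule power_cut_sine_bound_from) (use that assms in auto)
    show "\<bar>wedge_A k x s1 s2 v\<bar> \<le> x ^ Suc (Suc k) / (pi * s1) * (s2 - s1)" if "v \<in> {0..V}" for v
      by (rule wedge_A_bound) (use that assms in auto)
  qed (use assms wedge_A_integral wedge_B_integral in auto)
  moreover have "dsin (Suc k) (2 * pi * t * v) * (v ^ Suc (Suc k) * cut_sine (Suc k) s (x / v)) = v ^ Suc (Suc k) * dsin (Suc k) (2 * pi * t * v) * cut_sine (Suc k) s (x / v)" for s t v
    by (simp only: ac_simps)
  ultimately show ?thesis unfolding hyp_part_def by (simp only: mult.commute[of "wedge_B _ _ _ _"])
qed

lemma hyp_part_mixed_2:
  assumes "0 < t1" "s1 \<le> s2" "t1 \<le> t2" "0 < x"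
  shows "((\<lambda>t. integral {s1..s2} (\<lambda>s. hyp_part (Suc k) x V t s)) has_integral
    integral {0..V} (\<lambda>v. wedge_A k x t1 t2 v * wedge_B k s1 s2 v)) {t1..t2}"
proof -
  have "((\<lambda>t. integral {s1..s2} (\<lambda>s. integral {0..V} (\<lambda>v. (v ^ Suc (Suc k) * cut_sine (Suc k) t (x / v)) * dsin (Suc k) (2 * pi * s * v)))) has_integral
    integral {0..V} (\<lambda>v. wedge_A k x t1 t2 v * wedge_B k s1 s2 v)) {t1..t2}"
  proof (rule integral_product_swap)
    show "\<bar>dsin (Suc k) (2 * pi * p * v)\<bar> \<le> 1" for p v by (rule dsin_bound)
    show "\<bar>v ^ Suc (Suc k) * cut_sine (Suc k) q (x / v)\<bar> \<le> x ^ Suc (Suc k) / (pi * t1)" if "q \<in> {t1..t2}" "v \<in> {0..V}" for q v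
      by (rule power_cut_sine_bound_from) (use that assms in auto)
    show "\<bar>wedge_B k s1 s2 v\<bar> \<le> s2 - s1" if "v \<in> {0..V}" for v
      by (rule wedge_B_bound) (use that assms in auto)
  qed (use assms wedge_A_integral wedge_B_integral in auto)
  moreover have "(v ^ Suc (Suc k) * cut_sine (Suc k) t (x / v)) * dsin (Suc k) (2 * pi * s * v) = v ^ Suc (Suc k) * dsin (Suc k) (2 * pi * s * v) * cut_sine (Suc k) t (x / v)" for s t v
    by (simp only: ac_simps)
  ultimately show ?thesis unfolding hyp_part_def by (simp only:)
qed

lemma cut_sine_integral_s:
  assumes "s1 \<le> s2"
  shows "((\<lambda>s. cut_sine (Suc k) s X) has_integral (cut_sine k s2 X - cut_sine k s1 X) / (2 * pi)) {s1..s2}"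
proof -
  have "((\<lambda>s. 2 * pi * cut_sine (Suc k) s X) has_integral cut_sine k s2 X - cut_sine k s1 X) {s1..s2}"
    by (rule fundamental_theorem_of_calculus[OF assms])
       (use cut_sine_deriv_s in \<open>simp add: has_real_derivative_iff_has_vector_derivative\<close>)
  from has_integral_divide[OF this, of "2 * pi"] show ?thesis by simp
qed

text \<open>
A weak form of \<open>\<partial>\<^sup>2/\<partial>s \<partial>t f\<^sub>k (s t) = 4 \<pi>\<^sup>2 f\<^sub>k\<^sub>+\<^sub>1 (s t)\<close>. In each of the two parts only one
order of differentiation could be carried out under the integral sign, and the orders differ; the integrated form treats both alike.
\<close>

lemma hyp_kernel_second_difference:
  assumes "0 < s1" "s1 \<le> s2" "0 < t1" "t1 \<le> t2" "0 < x"
  shows "((\<lambda>t. integral {s1..s2} (\<lambda>s. 4 * pi\<^sup>2 * hyp_kernel (Suc k) x (s * t))) has_integral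
    hyp_kernel k x (s2 * t2) - hyp_kernel k x (s1 * t2) - hyp_kernel k x (s2 * t1) + hyp_kernel k x (s1 * t1)) {t1..t2}"
proof -
  let ?H = "\<lambda>k s t. hyp_int k x 1 s t"
  let ?W1 = "integral {0..1} (\<lambda>v. wedge_A k x s1 s2 v * wedge_B k t1 t2 v)"
  let ?W2 = "integral {0..x} (\<lambda>v. wedge_A k x t1 t2 v * wedge_B k s1 s2 v)"
  let ?cs = "(cut_sine k s2 x - cut_sine k s1 x) / (2 * pi)" and ?ct = "(cut_sine k t2 1 - cut_sine k t1 1) / (2 * pi)"
  have H: "hyp_int k x 1 s t = hyp_part k x 1 s t + hyp_part k x x t s - cut_sine k s x * cut_sine k t 1" for k s t
    by (simp add: hyp_int_def)
  have inner: "integral {s1..s2} (\<lambda>s. ?H (Suc k) s t) = integral {s1..s2} (\<lambda>s. hyp_part (Suc k) x 1 s t) + integral {s1..s2} (\<lambda>s. hyp_part (Suc k) x x t s) - ?cs * cut_sine (Suc k) t 1" if "t \<in> {t1..t2}" for t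
  proof -
    have i1: "(\<lambda>s. hyp_part (Suc k) x 1 s t) integrable_on {s1..s2}"
      by (rule integrable_continuous_real, rule continuous_on_subset[OF continuous_on_hyp_part_s[of s1]]) (use assms in auto)
    have i2: "(\<lambda>s. hyp_part (Suc k) x x t s) integrable_on {s1..s2}"
      by (rule integrable_continuous_real, rule continuous_on_hyp_part_t) (use assms that in auto)
    have i3: "((\<lambda>s. cut_sine (Suc k) s x * cut_sine (Suc k) t 1) has_integral ?cs * cut_sine (Suc k) t 1) {s1..s2}"
      by (intro has_integral_mult_left cut_sine_integral_s assms)
    show ?thesis unfolding H
      by (rule integral_unique) (intro has_integral_diff has_integral_add integrable_integral i1 i2 i3)
  qed
  have "((\<lambda>t. integral {s1..s2} (\<lambda>s. hyp_part (Suc k) x 1 s t) + integral {s1..s2} (\<lambda>s. hyp_part (Suc k) x x t s) - ?cs * cut_sine (Suc k) t 1)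
    has_integral ?W1 + ?W2 - ?cs * ?ct) {t1..t2}"
    by (intro has_integral_diff has_integral_add has_integral_mult_right hyp_part_mixed_1 hyp_part_mixed_2 cut_sine_integral_s assms)
  then have "((\<lambda>t. integral {s1..s2} (\<lambda>s. ?H (Suc k) s t)) has_integral ?W1 + ?W2 - ?cs * ?ct) {t1..t2}"
    by (subst has_integral_cong[OF inner]) auto
  then have I: "((\<lambda>t. 4 * pi\<^sup>2 * integral {s1..s2} (\<lambda>s. ?H (Suc k) s t)) has_integral 4 * pi\<^sup>2 * (?W1 + ?W2 - ?cs * ?ct)) {t1..t2}"
    by (rule has_integral_mult_right)
  have "4 * pi\<^sup>2 * (?W1 + ?W2 - ?cs * ?ct) = 4 * pi\<^sup>2 * ?W1 + 4 * pi\<^sup>2 * ?W2 - (cut_sine k s2 x - cut_sine k s1 x) * (cut_sine k t2 1 - cut_sine k t1 1)"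
  proof -
    have "4 * pi\<^sup>2 * (c / (2 * pi) * (d / (2 * pi))) = c * d" for c d :: real by (simp add: power2_eq_square)
    then show ?thesis by (simp only: distrib_left right_diff_distrib)
  qed
  also have "4 * pi\<^sup>2 * ?W1 = hyp_part k x 1 s2 t2 - hyp_part k x 1 s1 t2 - hyp_part k x 1 s2 t1 + hyp_part k x 1 s1 t1"
    by (rule hyp_part_second_difference[symmetric]) (use assms in auto)
  also have "4 * pi\<^sup>2 * ?W2 = hyp_part k x x t2 s2 - hyp_part k x x t1 s2 - hyp_part k x x t2 s1 + hyp_part k x x t1 s1"
    by (rule hyp_part_second_difference[symmetric]) (use assms in auto)
  finally have "4 * pi\<^sup>2 * (?W1 + ?W2 - ?cs * ?ct) = ?H k s2 t2 - ?H k s1 t2 - ?H k s2 t1 + ?H k s1 t1"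
    unfolding H by (simp add: algebra_simps)
  moreover have "?H k s t = hyp_kernel k x (s * t)" if "s > 0" "t > 0" for k s t
    by (rule hyp_int_prod) (use that assms in auto)
  ultimately have J: "((\<lambda>t. 4 * pi\<^sup>2 * integral {s1..s2} (\<lambda>s. ?H (Suc k) s t)) has_integral
     hyp_kernel k x (s2 * t2) - hyp_kernel k x (s1 * t2) - hyp_kernel k x (s2 * t1) + hyp_kernel k x (s1 * t1)) {t1..t2}"
    using I assms by simp
  show ?thesis
  proof (rule has_integral_eq[OF _ J])
    fix t assume t: "t \<in> {t1..t2}"
    have "integral {s1..s2} (\<lambda>s. ?H (Suc k) s t) = integral {s1..s2} (\<lambda>s. hyp_kernel (Suc k) x (s * t))"
      by (rule Henstock_Kurzweil_Integration.integral_cong) (use t assms in \<open>auto intro!: hyp_int_prod\<close>)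
    then show "4 * pi\<^sup>2 * integral {s1..s2} (\<lambda>s. ?H (Suc k) s t) = integral {s1..s2} (\<lambda>s. 4 * pi\<^sup>2 * hyp_kernel (Suc k) x (s * t))"
      by simp
  qed
qed

lemma antiderivative_positive_reals:
  fixes f :: "real \<Rightarrow> real"
  assumes "continuous_on {0<..} f"
  shows "\<exists>G. \<forall>p>0. (G has_real_derivative f p) (at p)"
proof -
  define G where "G = (\<lambda>p. if p \<ge> 1 then integral {1..p} f else - integral {p..1} f)"
  have "(G has_real_derivative f p) (at p)" if p: "p > 0" for p
  proof -
    define a where "a = min p 1 / 2"
    define b where "b = max p 1 + 1"
    have ab: "0 < a" "a < p" "p < b" "a < 1" "1 < b" using p by (auto simp: a_def b_def min_def max_def)
    have c: "continuous_on {a..b} f" by (rule continuous_on_subset[OF assms]) (use ab in auto)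
    have fi: "f integrable_on {u..v}" if "a \<le> u" "v \<le> b" for u v
      by (rule integrable_continuous_real, rule continuous_on_subset[OF c]) (use that in auto)
    have "((\<lambda>u. integral {a..u} f) has_vector_derivative f p) (at p within {a..b})"
      by (rule integral_has_vector_derivative[OF c]) (use ab in auto)
    then have "((\<lambda>u. integral {a..u} f) has_real_derivative f p) (at p)"
      using ab by (simp add: at_within_Icc_at has_real_derivative_iff_has_vector_derivative)
    then have "((\<lambda>u. integral {a..u} f - integral {a..1} f) has_real_derivative f p - 0) (at p)"
      by (intro DERIV_diff DERIV_const)
    moreover have Geq: "G u = integral {a..u} f - integral {a..1} f" if "u \<in> {a<..<b}" for u
      using integral_split[of a 1 u f] integral_split[of a u 1 f] fi[of a u] fi[of a 1] that ab by (auto simp: G_def)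
    have "eventually (\<lambda>u. u \<in> {a<..<b}) (nhds p)"
      by (rule eventually_nhds_in_open) (use ab in auto)
    then have "eventually (\<lambda>u. G u = integral {a..u} f - integral {a..1} f) (nhds p)"
      by (rule eventually_mono) (rule Geq)
    from DERIV_cong_ev[OF refl this refl] show ?thesis using calculation by simp
  qed
  then show ?thesis by blast
qed

section \<open>Smoothness of the hyperbola kernel\<close>

text \<open>
The solutions are the multiples of the logarithm. Averaging the functional equation over \<open>1 \<le> s \<le> 2\<close> expresses \<open>\<phi>\<close> through a
primitive of itself and so makes it differentiable; differentiating the equation then gives \<open>\<phi>' (p) = \<phi>' (1) / p\<close>.
\<close>

lemma continuous_log_additive:
  fixes \<phi> :: "real \<Rightarrow> real"
  assumes cont: "continuous_on {0<..} \<phi>" and add: "\<And>s t. s > 0 \<Longrightarrow> t > 0 \<Longrightarrow> \<phi> (s * t) = \<phi> s + \<phi> t"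
  shows "\<exists>\<alpha>. \<forall>p>0. (\<phi> has_real_derivative \<alpha> / p) (at p)"
proof -
  obtain \<Phi> where \<Phi>: "\<And>p. p > 0 \<Longrightarrow> (\<Phi> has_real_derivative \<phi> p) (at p)"
    using antiderivative_positive_reals[OF cont] by blast
  define I where "I = integral {1..2} \<phi>"
  have eq: "\<phi> t = (\<Phi> (2 * t) - \<Phi> (1 * t)) / t - I" if t: "t > 0" for t
  proof -
    have "((\<lambda>s. \<phi> (s * t)) has_integral \<Phi> (2 * t) / t - \<Phi> (1 * t) / t) {1..2}"
    proof (rule fundamental_theorem_of_calculus)
      fix s :: real assume s: "s \<in> {1..2}"
      have "((\<lambda>s. \<Phi> (s * t)) has_real_derivative \<phi> (s * t) * (1 * t)) (at s within {1..2})"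
        by (rule DERIV_chain2[OF \<Phi>]) (use s t in \<open>auto intro!: derivative_eq_intros\<close>)
      from DERIV_cdivide[OF this, of t]
      show "((\<lambda>s. \<Phi> (s * t) / t) has_vector_derivative \<phi> (s * t)) (at s within {1..2})"
        using t by (simp add: has_real_derivative_iff_has_vector_derivative)
    qed simp
    moreover have "((\<lambda>s. \<phi> s + \<phi> t) has_integral I + \<phi> t) {1..2}"
    proof -
      have "\<phi> integrable_on {1..2}"
        by (rule integrable_continuous_real, rule continuous_on_subset[OF cont]) auto
      then show ?thesis using has_integral_add[OF integrable_integral has_integral_const_real[of "\<phi> t" 1 2]] by (simp add: I_def)
    qed
    then have "((\<lambda>s. \<phi> (s * t)) has_integral I + \<phi> t) {1..2}"
      by (rule has_integral_eq[rotated]) (use add t in auto)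
    ultimately have "\<Phi> (2 * t) / t - \<Phi> (1 * t) / t = I + \<phi> t" by (rule has_integral_unique)
    then show ?thesis by (simp add: diff_divide_distrib)
  qed
  have "\<exists>D. (\<phi> has_real_derivative D) (at 1)"
  proof -
    have "((\<lambda>t. (\<Phi> (2 * t) - \<Phi> (1 * t)) / t - I) has_real_derivative
       ((\<phi> (2 * 1) * (2 * 1) - \<phi> (1 * 1) * (1 * 1)) * 1 - (\<Phi> (2 * 1) - \<Phi> (1 * 1)) * 1) / (1 * 1) - 0) (at 1)"
      by (intro DERIV_diff DERIV_divide DERIV_const DERIV_ident DERIV_chain2[OF \<Phi>] DERIV_cmult) auto
    moreover have ev: "eventually (\<lambda>t. \<phi> t = (\<Phi> (2 * t) - \<Phi> (1 * t)) / t - I) (nhds 1)"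
      by (rule eventually_mono[OF eventually_nhds_in_open[of "{0<..}" "1::real"]]) (use eq in \<open>auto simp del: mult_1_left\<close>)
    ultimately show ?thesis using DERIV_cong_ev[OF refl ev refl] by blast
  qed
  then obtain \<alpha> where \<alpha>: "(\<phi> has_real_derivative \<alpha>) (at 1)" by blast
  have "(\<phi> has_real_derivative \<alpha> / p) (at p)" if p: "p > 0" for p
  proof -
    have "((\<lambda>t. t / p) has_real_derivative 1 / p) (at p)" using p by (auto intro!: derivative_eq_intros)
    moreover have "(\<phi> has_real_derivative \<alpha>) (at (p / p))" using \<alpha> p by simp
    ultimately have "((\<lambda>t. \<phi> (t / p)) has_real_derivative \<alpha> * (1 / p)) (at p)" by (intro DERIV_chain2)
    then have der: "((\<lambda>t. \<phi> p + \<phi> (t / p)) has_real_derivative 0 + \<alpha> * (1 / p)) (at p)"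
      by (intro DERIV_add DERIV_const)
    have "eventually (\<lambda>t. \<phi> t = \<phi> p + \<phi> (t / p)) (nhds p)"
    proof -
      have "eventually (\<lambda>t::real. t \<in> {0<..}) (nhds p)"
        by (rule eventually_nhds_in_open) (use p in auto)
      then show ?thesis
      proof (rule eventually_mono)
        fix t :: real assume "t \<in> {0<..}"
        then show "\<phi> t = \<phi> p + \<phi> (t / p)" using add[of p "t / p"] p by simp
      qed
    qed
    from DERIV_cong_ev[OF refl this refl] der show ?thesis by (simp only: add_0 times_divide_eq_right mult_1_right)
  qed
  then show ?thesis by blast
qed

text \<open>
Let \<open>G\<close> be a primitive of \<open>f1\<close> and \<open>F\<close> a primitive of \<open>G p / p\<close>. Then \<open>F (s t)\<close> has the same second differences as
\<open>f0 (s t)\<close>, so \<open>f0 - F\<close> satisfies the functional equation of the logarithm up to a constant. Continuity of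
\<open>f0\<close> and \<open>f1\<close> is all that is assumed, and differentiability is a conclusion.
\<close>

lemma product_kernel_ode:
  fixes f0 f1 :: "real \<Rightarrow> real"
  assumes c0: "continuous_on {0<..} f0" and c1: "continuous_on {0<..} f1"
    and dd: "\<And>s1 s2 t1 t2. 0 < s1 \<Longrightarrow> s1 \<le> s2 \<Longrightarrow> 0 < t1 \<Longrightarrow> t1 \<le> t2 \<Longrightarrow>
      ((\<lambda>t. integral {s1..s2} (\<lambda>s. f1 (s * t))) has_integral f0 (s2 * t2) - f0 (s1 * t2) - f0 (s2 * t1) + f0 (s1 * t1)) {t1..t2}"
  shows "\<exists>g. \<forall>p>0. (f0 has_real_derivative g p / p) (at p) \<and> (g has_real_derivative f1 p) (at p)"
proof -
  obtain G where G: "\<And>p. p > 0 \<Longrightarrow> (G has_real_derivative f1 p) (at p)"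
    using antiderivative_positive_reals[OF c1] by blast
  have "continuous_on {0<..} (\<lambda>p. G p / p)"
    using G by (intro continuous_intros continuous_at_imp_continuous_on) (auto intro: DERIV_isCont)
  then obtain F where F: "\<And>p. p > 0 \<Longrightarrow> (F has_real_derivative G p / p) (at p)"
    using antiderivative_positive_reals by blast
  have inner: "integral {s1..s2} (\<lambda>s. f1 (s * t)) = G (s2 * t) / t - G (s1 * t) / t" if "0 < s1" "s1 \<le> s2" "0 < t" for s1 s2 t
  proof (rule integral_unique, rule fundamental_theorem_of_calculus)
    fix s assume s: "s \<in> {s1..s2}"
    have "((\<lambda>s. G (s * t)) has_real_derivative f1 (s * t) * (1 * t)) (at s within {s1..s2})"
      by (rule DERIV_chain2[OF G]) (use s that in \<open>auto intro!: derivative_eq_intros\<close>)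
    from DERIV_cdivide[OF this, of t]
    show "((\<lambda>s. G (s * t) / t) has_vector_derivative f1 (s * t)) (at s within {s1..s2})"
      using that by (simp add: has_real_derivative_iff_has_vector_derivative)
  qed (use that in auto)
  have ddF: "((\<lambda>t. integral {s1..s2} (\<lambda>s. f1 (s * t))) has_integral (F (s2 * t2) - F (s1 * t2)) - (F (s2 * t1) - F (s1 * t1))) {t1..t2}"
    if st: "0 < s1" "s1 \<le> s2" "0 < t1" "t1 \<le> t2" for s1 s2 t1 t2
  proof (rule fundamental_theorem_of_calculus)
    fix t assume t: "t \<in> {t1..t2}"
    have d: "((\<lambda>t. F (s * t)) has_real_derivative G (s * t) / t) (at t within {t1..t2})" if "s > 0" for s
    proof -
      have "((\<lambda>t. F (s * t)) has_real_derivative G (s * t) / (s * t) * (s * 1)) (at t within {t1..t2})"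
        by (rule DERIV_chain2[OF F]) (use that t st in \<open>auto intro!: derivative_eq_intros\<close>)
      then show ?thesis using that by simp
    qed
    have "((\<lambda>t. F (s2 * t) - F (s1 * t)) has_real_derivative G (s2 * t) / t - G (s1 * t) / t) (at t within {t1..t2})"
      by (intro DERIV_diff d) (use st in auto)
    then show "((\<lambda>t. F (s2 * t) - F (s1 * t)) has_vector_derivative integral {s1..s2} (\<lambda>s. f1 (s * t))) (at t within {t1..t2})"
      using inner[of s1 s2 t] t st by (simp add: has_real_derivative_iff_has_vector_derivative)
  qed (use st in auto)
  define q where "q = (\<lambda>p. f0 p - F p)"
  have q0: "q (s2 * t2) - q (s1 * t2) - q (s2 * t1) + q (s1 * t1) = 0" if "0 < s1" "s1 \<le> s2" "0 < t1" "t1 \<le> t2" for s1 s2 t1 t2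
    using has_integral_unique[OF dd[OF that] ddF[OF that]] by (simp add: q_def)
  define \<phi> where "\<phi> = (\<lambda>p. q p - q 1)"
  have add: "\<phi> (s * t) = \<phi> s + \<phi> t" if "s > 0" "t > 0" for s t
  proof -
    have "q (s * t) - q t - q s + q 1 = 0"
    proof (cases "s \<ge> 1"; cases "t \<ge> 1")
      assume "s \<ge> 1" "t \<ge> 1" then show ?thesis using q0[of 1 s 1 t] by simp
    next
      assume "s \<ge> 1" "\<not> t \<ge> 1" then show ?thesis using q0[of 1 s t 1] that by simp
    next
      assume "\<not> s \<ge> 1" "t \<ge> 1" then show ?thesis using q0[of s 1 1 t] that by simp
    next
      assume "\<not> s \<ge> 1" "\<not> t \<ge> 1" then show ?thesis using q0[of s 1 t 1] that by simp
    qed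
    then show ?thesis by (simp add: \<phi>_def)
  qed
  have "continuous_on {0<..} F" using F by (intro continuous_at_imp_continuous_on) (auto intro: DERIV_isCont)
  then have "continuous_on {0<..} \<phi>" unfolding \<phi>_def q_def by (intro continuous_intros c0)
  from continuous_log_additive[OF this add] obtain \<alpha> where \<alpha>: "\<And>p. p > 0 \<Longrightarrow> (\<phi> has_real_derivative \<alpha> / p) (at p)"
    by blast
  have "(f0 has_real_derivative (G p + \<alpha>) / p) (at p) \<and> ((\<lambda>p. G p + \<alpha>) has_real_derivative f1 p) (at p)" if "p > 0" for p
  proof
    have "((\<lambda>p. F p + \<phi> p + q 1) has_real_derivative G p / p + \<alpha> / p + 0) (at p)"
      by (intro DERIV_add DERIV_const F \<alpha> that)
    moreover have "(\<lambda>p. F p + \<phi> p + q 1) = f0" by (auto simp: \<phi>_def q_def)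
    ultimately show "(f0 has_real_derivative (G p + \<alpha>) / p) (at p)" by (simp add: add_divide_distrib)
    show "((\<lambda>p. G p + \<alpha>) has_real_derivative f1 p) (at p)"
      using DERIV_add[OF G[OF that] DERIV_const[of \<alpha>]] by simp
  qed
  then show ?thesis by (intro exI[of _ "\<lambda>p. G p + \<alpha>"]) blast
qed

text \<open>
All derivatives of a family of functions \<open>H k\<close> with \<open>H k' = g k / p\<close> and \<open>g k' = 4 \<pi>\<^sup>2 H (k + 1)\<close>: the \<open>j\<close>-th derivative of
\<open>p H'' + H' = 4 \<pi>\<^sup>2 H (k + 1)\<close> expresses the derivative of order \<open>j + 2\<close> by lower ones.
\<close>

fun tower :: "(nat \<Rightarrow> real \<Rightarrow> real) \<Rightarrow> (nat \<Rightarrow> real \<Rightarrow> real) \<Rightarrow> nat \<Rightarrow> nat \<Rightarrow> real \<Rightarrow> real" where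
  "tower H g k 0 p = H k p"
| "tower H g k (Suc 0) p = g k p / p"
| "tower H g k (Suc (Suc j)) p = (4 * pi\<^sup>2 * tower H g (Suc k) j p - real (Suc j) * tower H g k (Suc j) p) / p"

lemma tower_deriv:
  assumes H: "\<And>k p. p > 0 \<Longrightarrow> (H k has_real_derivative g k p / p) (at p)"
    and g: "\<And>k p. p > 0 \<Longrightarrow> (g k has_real_derivative 4 * pi\<^sup>2 * H (Suc k) p) (at p)" and "p > 0"
  shows "(tower H g k j has_real_derivative tower H g k (Suc j) p) (at p)"
proof (induction j arbitrary: k rule: induct_nat_012)
  case 0
  have "tower H g k 0 = H k" by auto
  then show ?case using H[OF \<open>p > 0\<close>] by simp
next
  case 1
  have "tower H g k (Suc 0) = (\<lambda>p. g k p / p)" by auto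
  moreover have "((\<lambda>p. g k p / p) has_real_derivative (4 * pi\<^sup>2 * H (Suc k) p * p - g k p * 1) / (p * p)) (at p)"
    by (rule DERIV_divide[OF g DERIV_ident]) (use \<open>p > 0\<close> in auto)
  ultimately show ?case using \<open>p > 0\<close> by (simp add: divide_simps)
next
  case (ge2 j)
  define A where "A = tower H g (Suc k) (Suc j) p"
  define T where "T = tower H g k (Suc (Suc j)) p"
  define N where "N = 4 * pi\<^sup>2 * tower H g (Suc k) j p - real (Suc j) * tower H g k (Suc j) p"
  have N: "N = T * p" using \<open>p > 0\<close> by (simp add: N_def T_def)
  have nxt: "tower H g k (Suc (Suc (Suc j))) p = (4 * pi\<^sup>2 * A - real (Suc (Suc j)) * T) / p"
    by (simp only: tower.simps(3)[of H g k "Suc j" p] A_def T_def)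
  have fn: "tower H g k (Suc (Suc j)) = (\<lambda>p. (4 * pi\<^sup>2 * tower H g (Suc k) j p - real (Suc j) * tower H g k (Suc j) p) / p)"
    by (rule ext) (rule tower.simps(3))
  have "((\<lambda>p. (4 * pi\<^sup>2 * tower H g (Suc k) j p - real (Suc j) * tower H g k (Suc j) p) / p) has_real_derivative
     ((4 * pi\<^sup>2 * A - real (Suc j) * T) * p - N * 1) / (p * p)) (at p)"
    unfolding A_def T_def N_def
    by (intro DERIV_divide DERIV_diff DERIV_cmult DERIV_ident ge2) (use \<open>p > 0\<close> in auto)
  moreover have "((4 * pi\<^sup>2 * A - real (Suc j) * T) * p - N * 1) / (p * p) = (4 * pi\<^sup>2 * A - real (Suc (Suc j)) * T) / p"
  proof -
    have "(4 * pi\<^sup>2 * A - real (Suc j) * T) * p - N * 1 = (4 * pi\<^sup>2 * A - real (Suc (Suc j)) * T) * p"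
      unfolding N by (simp add: algebra_simps)
    then show ?thesis using \<open>p > 0\<close> by simp
  qed
  ultimately show ?case unfolding nxt by (subst fn) (simp only:)
qed

lemma hyp_kernel_smooth:
  assumes "0 < x"
  shows "\<exists>fd :: nat \<Rightarrow> nat \<Rightarrow> real \<Rightarrow> real. (\<forall>k p. fd k 0 p = hyp_kernel k x p)
    \<and> (\<forall>k j. \<forall>p>0. (fd k j has_real_derivative fd k (Suc j) p) (at p))
    \<and> (\<forall>k j. \<forall>p>0. real (Suc j) * fd k (Suc j) p + p * fd k (Suc (Suc j)) p = 4 * pi\<^sup>2 * fd (Suc k) j p)"
proof -
  have "\<exists>g. \<forall>p>0. (hyp_kernel k x has_real_derivative g p / p) (at p) \<and> (g has_real_derivative 4 * pi\<^sup>2 * hyp_kernel (Suc k) x p) (at p)" for k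
  proof (rule product_kernel_ode)
    show "continuous_on {0<..} (hyp_kernel k x)" by (rule continuous_on_hyp_kernel[OF assms])
    show "continuous_on {0<..} (\<lambda>p. 4 * pi\<^sup>2 * hyp_kernel (Suc k) x p)"
      by (intro continuous_on_mult continuous_on_const continuous_on_hyp_kernel[OF assms])
  qed (rule hyp_kernel_second_difference, assumption+, rule assms)
  then obtain g where g: "\<And>k p. p > 0 \<Longrightarrow> (hyp_kernel k x has_real_derivative g k p / p) (at p)"
    "\<And>k p. p > 0 \<Longrightarrow> (g k has_real_derivative 4 * pi\<^sup>2 * hyp_kernel (Suc k) x p) (at p)"
    by metis
  show ?thesis
  proof (intro exI[of _ "tower (\<lambda>k. hyp_kernel k x) g"] conjI allI impI)
    show "(tower (\<lambda>k. hyp_kernel k x) g k j has_real_derivative tower (\<lambda>k. hyp_kernel k x) g k (Suc j) p) (at p)" if "p > 0" for k j p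
      by (rule tower_deriv[where H = "\<lambda>k. hyp_kernel k x"]) (use that in \<open>auto intro: g\<close>)
    show "real (Suc j) * tower (\<lambda>k. hyp_kernel k x) g k (Suc j) p + p * tower (\<lambda>k. hyp_kernel k x) g k (Suc (Suc j)) p = 4 * pi\<^sup>2 * tower (\<lambda>k. hyp_kernel k x) g (Suc k) j p"
      if "p > 0" for k j p
      using that by simp
  qed simp
qed

section \<open>Bessel functions of order 1/2 and 3/2\<close>

text \<open>
Legendre's duplication formula at the half-integers, by induction from \<open>\<Gamma> (1/2) = \<surd>\<pi>\<close>.
\<close>

lemma rGamma_half_integer:
  "rGamma (real j + 3 / 2) / fact j = 2 ^ (2 * j + 1) / (fact (2 * j + 1) * sqrt pi)"
proof (induction j)
  case 0
  have "1 / 2 * rGamma (1 / 2 + 1) = rGamma (1 / 2 :: real)" by (rule rGamma_plus1)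
  moreover have "rGamma (1 / 2 :: real) = 1 / sqrt pi"
    by (simp add: rGamma_inverse_Gamma Gamma_one_half_real inverse_eq_divide)
  ultimately show ?case by simp
next
  case (Suc j)
  have "(real j + 3 / 2) * rGamma (real j + 3 / 2 + 1) = rGamma (real j + 3 / 2)" by (rule rGamma_plus1)
  moreover have "real j + 3 / 2 + 1 = real (Suc j) + 3 / 2" by simp
  ultimately have "(real j + 3 / 2) * rGamma (real (Suc j) + 3 / 2) = rGamma (real j + 3 / 2)" by (simp only:)
  then have r: "rGamma (real (Suc j) + 3 / 2) = rGamma (real j + 3 / 2) / (real j + 3 / 2)"
    by (simp only: nonzero_eq_divide_eq) (simp add: mult.commute nonzero_eq_divide_eq)
  then have "rGamma (real (Suc j) + 3 / 2) / fact (Suc j) = (rGamma (real j + 3 / 2) / fact j) / ((real j + 3 / 2) * real (Suc j))"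
    unfolding r fact_Suc of_nat_mult by (simp only: divide_divide_eq_left ac_simps)
  also have "\<dots> = 2 ^ (2 * j + 1) / (fact (2 * j + 1) * sqrt pi) / ((real j + 3 / 2) * real (Suc j))"
    by (simp only: Suc)
  also have "(real j + 3 / 2) * real (Suc j) = real (2 * j + 3) * real (2 * j + 2) / 4"
    by (simp add: algebra_simps)
  also have "2 ^ (2 * j + 1) / (fact (2 * j + 1) * sqrt pi) / (real (2 * j + 3) * real (2 * j + 2) / 4) = 2 ^ (2 * Suc j + 1) / (fact (2 * Suc j + 1) * sqrt pi)"
  proof -
    have "fact (2 * Suc j + 1) = real (2 * j + 3) * (real (2 * j + 2) * fact (2 * j + 1))"
      using fact_Suc[of "2 * j + 2"] fact_Suc[of "2 * j + 1"] by (simp add: numeral_3_eq_3)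
    moreover have "2 ^ (2 * Suc j + 1) = 4 * (2 :: real) ^ (2 * j + 1)" by simp
    ultimately show ?thesis by (simp only:) (simp add: divide_simps)
  qed
  finally show ?case .
qed

lemma powr_even_plus:
  assumes "z > 0"
  shows "z powr (2 * real j + a) = z ^ (2 * j) * z powr a"
  using assms powr_realpow[of z "2 * j"] by (simp add: powr_add)

lemma sqrt_two_over:
  assumes "z > 0"
  shows "2 / (sqrt pi * z) * sqrt (z / 2) = sqrt (2 / (pi * z))"
proof (rule real_sqrt_unique[symmetric])
  show "(2 / (sqrt pi * z) * sqrt (z / 2))\<^sup>2 = 2 / (pi * z)"
    using assms by (simp add: power_mult_distrib power_divide) (simp add: power2_eq_square)
  show "0 \<le> 2 / (sqrt pi * z) * sqrt (z / 2)" using assms by simp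
qed

lemma bessel_J_half:
  assumes "z > 0"
  shows "bessel_J (1 / 2) z = sqrt (2 / (pi * z)) * sin z"
proof -
  have "(-1) ^ j * rGamma (1 / 2 + real j + 1) / fact j * (z / 2) powr (2 * real j + 1 / 2)
     = (2 / (sqrt pi * z) * sqrt (z / 2)) * ((- 1) ^ j / fact (2 * j + 1) * z ^ (2 * j + 1))" for j
  proof -
    have "(-1) ^ j * rGamma (1 / 2 + real j + 1) / fact j = (-1) ^ j * (rGamma (real j + 3 / 2) / fact j)"
      by (simp add: add.commute)
    also have "\<dots> = (-1) ^ j * (2 ^ (2 * j + 1) / (fact (2 * j + 1) * sqrt pi))" by (simp only: rGamma_half_integer)
    finally have 1: "(-1) ^ j * rGamma (1 / 2 + real j + 1) / fact j = (-1) ^ j * (2 ^ (2 * j + 1) / (fact (2 * j + 1) * sqrt pi))" .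
    have 2: "(z / 2) powr (2 * real j + 1 / 2) = z ^ (2 * j) / 2 ^ (2 * j) * sqrt (z / 2)"
      using powr_even_plus[of "z / 2" j "1 / 2"] assms by (simp add: powr_half_sqrt power_divide)
    show ?thesis unfolding 1 2 using assms by (simp add: field_simps)
  qed
  moreover have "(\<lambda>j. (2 / (sqrt pi * z) * sqrt (z / 2)) * ((- 1) ^ j / fact (2 * j + 1) * z ^ (2 * j + 1))) sums ((2 / (sqrt pi * z) * sqrt (z / 2)) * sin z)"
    by (intro sums_mult sin_paired)
  ultimately have "bessel_J (1 / 2) z = (2 / (sqrt pi * z) * sqrt (z / 2)) * sin z"
    unfolding bessel_J_def by (simp only: sums_iff)
  then show ?thesis by (simp only: sqrt_two_over[OF assms])
qed

text \<open>
The two elementary series are subtracted termwise. Their constant terms cancel, which accounts for the index shift.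
\<close>

lemma bessel_J_three_halves_sin_cos:
  assumes "z > 0"
  shows "bessel_J (3 / 2) z = sqrt (2 / (pi * z)) * (sin z / z - cos z)"
proof -
  have "(\<lambda>j. (- 1) ^ j / fact (2 * j + 1) * z ^ (2 * j + 1) / z - (- 1) ^ j / fact (2 * j) * z ^ (2 * j)) sums (sin z / z - cos z)"
    by (intro sums_diff sums_divide sin_paired cos_paired)
  moreover have "(- 1) ^ 0 / fact (2 * 0 + 1) * z ^ (2 * 0 + 1) / z - (- 1) ^ 0 / fact (2 * 0) * z ^ (2 * 0) = 0" using assms by simp
  ultimately have "(\<lambda>j. (- 1) ^ Suc j / fact (2 * Suc j + 1) * z ^ (2 * Suc j + 1) / z - (- 1) ^ Suc j / fact (2 * Suc j) * z ^ (2 * Suc j)) sums (sin z / z - cos z)"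
    by (subst sums_Suc_iff) simp
  then have S: "(\<lambda>j. (2 / (sqrt pi * z) * sqrt (z / 2)) * ((- 1) ^ Suc j / fact (2 * Suc j + 1) * z ^ (2 * Suc j + 1) / z - (- 1) ^ Suc j / fact (2 * Suc j) * z ^ (2 * Suc j)))
     sums ((2 / (sqrt pi * z) * sqrt (z / 2)) * (sin z / z - cos z))"
    by (rule sums_mult)
  have "(-1) ^ j * rGamma (3 / 2 + real j + 1) / fact j * (z / 2) powr (2 * real j + 3 / 2)
     = (2 / (sqrt pi * z) * sqrt (z / 2)) * ((- 1) ^ Suc j / fact (2 * Suc j + 1) * z ^ (2 * Suc j + 1) / z - (- 1) ^ Suc j / fact (2 * Suc j) * z ^ (2 * Suc j))" for j
  proof -
    have "(-1) ^ j * rGamma (3 / 2 + real j + 1) / fact j = (-1) ^ j * (real (Suc j) * (rGamma (real (Suc j) + 3 / 2) / fact (Suc j)))"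
      by (simp add: add.commute add.left_commute)
    also have "\<dots> = (-1) ^ j * (real (Suc j) * (2 ^ (2 * Suc j + 1) / (fact (2 * Suc j + 1) * sqrt pi)))" by (simp only: rGamma_half_integer)
    finally have 1: "(-1) ^ j * rGamma (3 / 2 + real j + 1) / fact j = (-1) ^ j * (real (Suc j) * (2 ^ (2 * Suc j + 1) / (fact (2 * Suc j + 1) * sqrt pi)))" .
    have "(z / 2) powr (3 / 2) = (z / 2) * sqrt (z / 2)"
      using powr_add[of "z / 2" 1 "1 / 2"] assms by (simp add: powr_half_sqrt)
    then have 2: "(z / 2) powr (2 * real j + 3 / 2) = z ^ (2 * j) / 2 ^ (2 * j) * ((z / 2) * sqrt (z / 2))"
      using powr_even_plus[of "z / 2" j "3 / 2"] assms by (simp only: power_divide)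
    have f: "fact (2 * Suc j + 1) = real (2 * j + 3) * fact (2 * Suc j)"
      using fact_Suc[of "2 * Suc j"] by (simp add: numeral_3_eq_3)
    have 3: "(- 1) ^ Suc j / fact (2 * Suc j + 1) * z ^ (2 * Suc j + 1) / z - (- 1) ^ Suc j / fact (2 * Suc j) * z ^ (2 * Suc j)
        = (-1) ^ j * (2 * real (Suc j)) / fact (2 * Suc j + 1) * z ^ (2 * Suc j)"
    proof -
      have "(- 1) ^ Suc j / (c * F) * (Z * z) / z - (- 1) ^ Suc j / F * Z = (-1) ^ j * (c - 1) / (c * F) * Z" if "c > 0" "F > 0" for c F Z :: real
        using assms that by (simp add: field_simps)
      from this[of "real (2 * j + 3)" "fact (2 * Suc j)" "z ^ (2 * Suc j)"] show ?thesis
        unfolding f power_add[of z "2 * Suc j" 1] by simp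
    qed
    have 4: "(-1) ^ j * (r * (2 ^ (2 * Suc j + 1) / (F * sqrt pi))) * (z ^ (2 * j) / 2 ^ (2 * j) * ((z / 2) * q))
       = (2 / (sqrt pi * z) * q) * ((-1) ^ j * (2 * r) / F * z ^ (2 * Suc j))" if "F > 0" for r F q :: real
      using assms that by (simp add: field_simps)
    show ?thesis unfolding 1 2 3 by (rule 4) simp
  qed
  then have "bessel_J (3 / 2) z = (2 / (sqrt pi * z) * sqrt (z / 2)) * (sin z / z - cos z)"
    unfolding bessel_J_def using S by (simp only: sums_iff)
  then show ?thesis by (simp only: sqrt_two_over[OF assms])
qed

text \<open>
Written as a moment, the function \<open>sin z / z - cos z\<close> can be compared directly with \<open>cut_sine\<close>, and its decay as \<open>z \<rightarrow> 0\<close> is visible.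
\<close>

lemma bessel_J_three_halves:
  assumes "z > 0"
  shows "bessel_J (3 / 2) z = sqrt (2 / (pi * z)) * (z * unit_sine 1 0 (z / (2 * pi)))"
proof -
  define w where "w = z / (2 * pi)"
  have w: "w \<noteq> 0" "2 * pi * w = z" using assms by (auto simp: w_def)
  have m1: "unit_sine 1 0 w = (unit_sine 0 1 w - dsin 1 z) / z"
    using unit_sine_parts[of w 0 0] w by simp
  have m0: "unit_sine 0 1 w = sin z / z"
  proof -
    have "((\<lambda>r. cos (z * r)) has_integral sin (z * 1) / z - sin (z * 0) / z) {0..1}"
      by (rule fundamental_theorem_of_calculus)
         (use assms in \<open>auto intro!: derivative_eq_intros simp: has_real_derivative_iff_has_vector_derivative[symmetric]\<close>)
    moreover have "dsin 1 (z * r) = cos (z * r)" for r using dsin_Suc[of 0] by simp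
    ultimately show ?thesis unfolding unit_sine_def w(2) by (simp add: integral_unique)
  qed
  have "z * unit_sine 1 0 w = sin z / z - cos z"
    using assms dsin_Suc[of 0 z] unfolding m1 m0 by simp
  then show ?thesis using bessel_J_three_halves_sin_cos[OF assms] by (simp add: w_def)
qed

lemma unit_sine_small: "\<bar>unit_sine j 0 z\<bar> \<le> 2 * pi * \<bar>z\<bar>"
proof -
  have "norm (unit_sine j 0 z) \<le> 2 * pi * \<bar>z\<bar> * (1 - 0)"
    unfolding unit_sine_def
  proof (rule norm_integral_le)
    fix r :: real assume r: "r \<in> {0..1}"
    have "norm (r ^ j * dsin 0 (2 * pi * z * r)) \<le> 1 * \<bar>2 * pi * z * r\<bar>"
      unfolding real_norm_def dsin_0 abs_mult[of "r ^ j"] using r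
      by (intro mult_mono abs_sin_x_le_abs_x) (auto simp: power_le_one)
    also have "\<dots> \<le> 2 * pi * \<bar>z\<bar>" using r by (simp add: abs_mult mult_left_le)
    finally show "norm (r ^ j * dsin 0 (2 * pi * z * r)) \<le> 2 * pi * \<bar>z\<bar>" .
  qed auto
  then show ?thesis by simp
qed

definition t_integrand :: "real \<Rightarrow> real \<Rightarrow> real" where
  "t_integrand y u = sin u * (y / u * unit_sine 1 0 (y / u / (2 * pi)))"

lemma borel_measurable_t_integrand [measurable]: "t_integrand y \<in> borel_measurable borel"
  unfolding t_integrand_def[abs_def] by measurable

lemma t_integrand_bound:
  assumes "y > 0" "u \<ge> 0"
  shows "\<bar>t_integrand y u\<bar> \<le> 2" "\<bar>t_integrand y u\<bar> \<le> y\<^sup>2 * (1 / u ^ 2)"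
proof -
  have *: "\<bar>t_integrand y u\<bar> \<le> \<bar>y / u * unit_sine 1 0 (y / u / (2 * pi))\<bar>"
    unfolding t_integrand_def abs_mult[of "sin u"] by (rule mult_left_le_one_le) auto
  show "\<bar>t_integrand y u\<bar> \<le> 2"
  proof (cases "u = 0")
    case False
    have z: "y / u > 0" using False assms by simp
    have "\<bar>y / u * unit_sine 1 0 (y / u / (2 * pi))\<bar> = y / u * \<bar>unit_sine 1 0 (y / u / (2 * pi))\<bar>"
      unfolding abs_mult[of "y / u"] using z by (simp only: abs_of_pos)
    also have "\<dots> \<le> y / u * (1 / (pi * \<bar>y / u / (2 * pi)\<bar>))"
      using z by (intro mult_left_mono unit_sine_decay) auto
    also have "\<dots> = 2" using False assms by (simp add: abs_mult)
    finally show ?thesis using * by simp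
  qed (simp add: t_integrand_def)
  show "\<bar>t_integrand y u\<bar> \<le> y\<^sup>2 * (1 / u ^ 2)"
  proof (cases "u = 0")
    case False
    have z: "y / u > 0" using False assms by simp
    have "\<bar>y / u * unit_sine 1 0 (y / u / (2 * pi))\<bar> = y / u * \<bar>unit_sine 1 0 (y / u / (2 * pi))\<bar>"
      unfolding abs_mult[of "y / u"] using z by (simp only: abs_of_pos)
    also have "\<dots> \<le> y / u * (2 * pi * \<bar>y / u / (2 * pi)\<bar>)"
      using z by (intro mult_left_mono unit_sine_small) auto
    also have "\<dots> = (y / u) * (y / u)" using False assms by (simp add: abs_mult)
    also have "\<dots> = y\<^sup>2 * (1 / u ^ 2)" by (simp add: power2_eq_square)
    finally show ?thesis using * by simp
  qed (simp add: t_integrand_def)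
qed

lemma T32_eq:
  assumes "y > 0"
  shows "T32 y = 2 / (pi * sqrt y) * (LBINT u:{0..}. t_integrand y u)"
proof -
  have "indicat_real {0<..} u *\<^sub>R (bessel_J (1 / 2) u * bessel_J (3 / 2) (y / u)) = 2 / (pi * sqrt y) * (indicat_real {0..} u *\<^sub>R t_integrand y u)" for u
  proof (cases "u > 0")
    case True
    have "sqrt (2 / (pi * u)) * sqrt (2 / (pi * (y / u))) = 2 / (pi * sqrt y)"
    proof -
      have "sqrt (2 / (pi * u)) * sqrt (2 / (pi * (y / u))) = sqrt (4 / (pi\<^sup>2 * y))"
        unfolding real_sqrt_mult[symmetric] using True assms by (simp add: power2_eq_square)
      also have "\<dots> = 2 / (pi * sqrt y)" by (simp add: real_sqrt_divide real_sqrt_mult)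
      finally show ?thesis .
    qed
    moreover have "bessel_J (1 / 2) u * bessel_J (3 / 2) (y / u) = (sqrt (2 / (pi * u)) * sqrt (2 / (pi * (y / u)))) * t_integrand y u"
      using True assms bessel_J_half[of u] bessel_J_three_halves[of "y / u"] unfolding t_integrand_def
      by (simp only: zero_less_divide_iff) (simp only: simp_thms ac_simps)
    ultimately show ?thesis using True by simp
  next
    case False
    then show ?thesis by (cases "u = 0") (auto simp: t_integrand_def)
  qed
  then show ?thesis unfolding T32_def set_lebesgue_integral_def by simp
qed

text \<open>
The bounds \<open>2\<close> and \<open>y\<^sup>2 / u\<^sup>2\<close> give absolute integrability on \<open>[0, 1]\<close> and \<open>[1, \<infinity>)\<close>. Initial segments are needed
since the hyperbola integral is built on bounded intervals.
\<close>

lemma t_integrand_limit: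
  assumes "y > 0" "c > 0"
  shows "(\<lambda>n. integral {0..c * real n} (t_integrand y)) \<longlonglongrightarrow> (LBINT u:{0..}. t_integrand y u)"
proof -
  have m: "t_integrand y \<in> borel_measurable (lebesgue_on S)" for S
    by (intro measurable_restrict_space1 measurable_completion) simp
  have a1: "t_integrand y absolutely_integrable_on {0..1}"
    by (rule bounded_borel_integrable[where K=2]) (use t_integrand_bound assms in auto)
  have a2: "t_integrand y absolutely_integrable_on {1..}"
  proof (rule measurable_bounded_by_integrable_imp_absolutely_integrable[OF m])
    have "((\<lambda>u::real. 1 / u ^ 2) has_integral 1 / (real (2 - 1) * 1 ^ (2 - 1))) {1..}"
      by (rule has_integral_inverse_power_to_inf) auto
    then show "(\<lambda>u. y\<^sup>2 * (1 / u ^ 2)) integrable_on {1..}"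
      using has_integral_mult_right by blast
    show "norm (t_integrand y u) \<le> y\<^sup>2 * (1 / u ^ 2)" if "u \<in> {1..}" for u
      using t_integrand_bound(2)[of y u] that assms by simp
  qed auto
  have "{0..1} \<union> {1..} = {0::real..}" by auto
  then have "t_integrand y absolutely_integrable_on {0..}"
    using set_integrable_Un[OF a1 a2] by simp
  then have si: "set_integrable lborel {0..} (t_integrand y)"
    unfolding set_integrable_def by (subst (asm) integrable_completion) simp_all
  have "((\<lambda>b. LBINT u:{0..b}. t_integrand y u) \<longlongrightarrow> (LBINT u:{0..}. t_integrand y u)) at_top"
    by (rule tendsto_set_lebesgue_integral_at_top[OF _ si]) auto
  moreover have "filterlim (\<lambda>n. c * real n) at_top sequentially"
    by (rule filterlim_tendsto_pos_mult_at_top[OF tendsto_const assms(2) filterlim_real_sequentially])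
  ultimately have "(\<lambda>n. LBINT u:{0..c * real n}. t_integrand y u) \<longlonglongrightarrow> (LBINT u:{0..}. t_integrand y u)"
    by (rule filterlim_compose)
  moreover have "(LBINT u:{0..b}. t_integrand y u) = integral {0..b} (t_integrand y)" for b
    by (rule set_borel_integral_eq_integral(2), rule set_integrable_subset[OF si]) auto
  ultimately show ?thesis by simp
qed

text \<open>
As the cut \<open>V = n\<close> tends to infinity, the part \<open>u \<le> x / n\<close> shrinks to nothing and so does the overlap. Since the combination does not
depend on the cut, the first part alone tends to its value.
\<close>

lemma hyp_part_limit:
  assumes "0 < s" "0 < t" "0 < x"
  shows "(\<lambda>n. hyp_part 0 x (real n) s t) \<longlonglongrightarrow> hyp_kernel 0 x (s * t)"
proof -
  have c3: "\<bar>cut_sine 0 s X\<bar> \<le> 2 * pi * s * X ^ 3" if "X \<ge> 0" for X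
  proof -
    have "\<bar>cut_sine 0 s X\<bar> = X\<^sup>2 * \<bar>unit_sine 1 0 (s * X)\<bar>" by (simp add: cut_sine_def abs_mult numeral_2_eq_2)
    also have "\<dots> \<le> X\<^sup>2 * (2 * pi * \<bar>s * X\<bar>)" by (intro mult_left_mono unit_sine_small) auto
    finally show ?thesis using that assms by (simp add: power2_eq_square power3_eq_cube abs_mult mult.assoc mult.left_commute)
  qed
  have inv: "(\<lambda>n. c / real n) \<longlonglongrightarrow> 0" for c using tendsto_mult_right_zero[OF lim_1_over_n, of c] by simp
  have 1: "(\<lambda>n. hyp_part 0 x (x / real n) t s) \<longlonglongrightarrow> 0"
  proof (rule Lim_null_comparison)
    show "eventually (\<lambda>n. norm (hyp_part 0 x (x / real n) t s) \<le> (x / (pi * t) * x) / real n) sequentially"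
    proof (rule always_eventually, rule allI)
      fix n
      have "norm (hyp_part 0 x (x / real n) t s) \<le> x ^ Suc 0 / (pi * \<bar>t\<bar>) * (x / real n - 0)"
        unfolding hyp_part_def by (rule norm_integral_le) (use hyp_part_integrand_bound[of t _ x 0 s] assms in auto)
      then show "norm (hyp_part 0 x (x / real n) t s) \<le> (x / (pi * t) * x) / real n" using assms by simp
    qed
  qed (rule inv)
  have 2: "(\<lambda>n. cut_sine 0 s (x / real n) * cut_sine 0 t (real n)) \<longlonglongrightarrow> 0"
  proof (rule Lim_null_comparison)
    show "eventually (\<lambda>n. norm (cut_sine 0 s (x / real n) * cut_sine 0 t (real n)) \<le> (2 * pi * s * x ^ 3 / (pi * t)) / real n) sequentially"
      using eventually_gt_at_top[of 0]
    proof eventually_elim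
      case (elim n)
      have "norm (cut_sine 0 s (x / real n) * cut_sine 0 t (real n)) \<le> (2 * pi * s * (x / real n) ^ 3) * (real n ^ Suc 0 / (pi * \<bar>t\<bar>))"
        unfolding real_norm_def abs_mult[of "cut_sine 0 s _"] using assms by (intro mult_mono c3 cut_sine_bound) auto
      also have "\<dots> = (2 * pi * s * x ^ 3 / (pi * t)) / (real n)\<^sup>2"
        using elim assms by (simp add: power3_eq_cube power2_eq_square)
      also have "\<dots> \<le> (2 * pi * s * x ^ 3 / (pi * t)) / real n"
      proof (rule divide_left_mono)
        have "1 \<le> real n" using elim by simp
        then show "real n \<le> (real n)\<^sup>2" by (simp add: power2_eq_square)
      qed (use elim assms in auto)
      finally show ?case .
    qed
  qed (rule inv)
  have "(\<lambda>n. hyp_kernel 0 x (s * t) - hyp_part 0 x (x / real n) t s + cut_sine 0 s (x / real n) * cut_sine 0 t (real n)) \<longlonglongrightarrow> hyp_kernel 0 x (s * t) - 0 + 0"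
    by (intro tendsto_intros 1 2)
  moreover have "eventually (\<lambda>n. hyp_kernel 0 x (s * t) - hyp_part 0 x (x / real n) t s + cut_sine 0 s (x / real n) * cut_sine 0 t (real n) = hyp_part 0 x (real n) s t) sequentially"
    using eventually_gt_at_top[of 0]
  proof eventually_elim
    case (elim n)
    have "hyp_int 0 x (real n) s t = hyp_kernel 0 x (s * t)" by (rule hyp_int_prod) (use elim assms in auto)
    then show ?case by (simp add: hyp_int_def)
  qed
  ultimately show ?thesis by (simp add: tendsto_cong)
qed

text \<open>
The substitution \<open>u = 2 \<pi> t v\<close> makes the argument \<open>y / u\<close> of the second Bessel function equal to \<open>2 \<pi> s x / v\<close>, independent of \<open>t\<close>.
\<close>

lemma T_quot_eq_hyp_kernel:
  assumes "0 < s" "0 < t" "0 < x"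
  shows "x * sqrt x / 4 * T_quot x s t = hyp_kernel 0 x (s * t)"
proof -
  define y where "y = 4 * pi\<^sup>2 * s * t * x"
  have y: "y > 0" using assms by (simp add: y_def)
  have c: "2 * pi * t > 0" using assms by simp
  have "integral {0..(2 * pi * t) * real n} (t_integrand y) = (4 * pi\<^sup>2 * s * t / x) * hyp_part 0 x (real n) s t" for n
  proof -
    have "integral {0..(2 * pi * t) * real n} (t_integrand y) = integral {0..(2 * pi * t) * real n / (2 * pi * t)} (\<lambda>v. (2 * pi * t) * t_integrand y ((2 * pi * t) * v))"
      by (rule integral_dilate[OF c bounded_borel_integrable'[where K=2]]) (use t_integrand_bound y in auto)
    also have "(2 * pi * t) * real n / (2 * pi * t) = real n" using assms by simp
    also have "(\<lambda>v. (2 * pi * t) * t_integrand y ((2 * pi * t) * v)) = (\<lambda>v. (4 * pi\<^sup>2 * s * t / x) * (v ^ Suc 0 * dsin 0 (2 * pi * t * v) * cut_sine 0 s (x / v)))"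
    proof
      fix v
      show "(2 * pi * t) * t_integrand y ((2 * pi * t) * v) = (4 * pi\<^sup>2 * s * t / x) * (v ^ Suc 0 * dsin 0 (2 * pi * t * v) * cut_sine 0 s (x / v))"
      proof (cases "v = 0")
        case True then show ?thesis by (simp add: t_integrand_def)
      next
        case False
        have e1: "y / ((2 * pi * t) * v) = 2 * pi * s * x / v" using False assms by (simp add: y_def power2_eq_square)
        have e2: "2 * pi * s * x / v / (2 * pi) = s * (x / v)" by simp
        have e3: "cut_sine 0 s (x / v) = (x / v)\<^sup>2 * unit_sine 1 0 (s * (x / v))" by (simp add: cut_sine_def numeral_2_eq_2)
        have "(2 * pi * t) * (S * (2 * pi * s * x / v * m)) = (4 * pi\<^sup>2 * s * t / x) * (v ^ Suc 0 * S * ((x / v)\<^sup>2 * m))" for S m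
          using False assms by (simp add: power2_eq_square)
        then show ?thesis unfolding t_integrand_def e1 e2 e3 dsin_0 .
      qed
    qed
    also have "integral {0..real n} \<dots> = (4 * pi\<^sup>2 * s * t / x) * hyp_part 0 x (real n) s t"
      unfolding hyp_part_def by (rule integral_mult_right)
    finally show ?thesis .
  qed
  then have "(\<lambda>n. (4 * pi\<^sup>2 * s * t / x) * hyp_part 0 x (real n) s t) \<longlonglongrightarrow> (LBINT u:{0..}. t_integrand y u)"
    using t_integrand_limit[OF y c] by simp
  moreover have "(\<lambda>n. (4 * pi\<^sup>2 * s * t / x) * hyp_part 0 x (real n) s t) \<longlonglongrightarrow> (4 * pi\<^sup>2 * s * t / x) * hyp_kernel 0 x (s * t)"
    by (intro tendsto_intros hyp_part_limit assms)
  ultimately have L: "(LBINT u:{0..}. t_integrand y u) = (4 * pi\<^sup>2 * s * t / x) * hyp_kernel 0 x (s * t)"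
    by (rule LIMSEQ_unique)
  have sy: "sqrt y = 2 * pi * (sqrt (s * t) * sqrt x)"
    by (simp add: y_def real_sqrt_mult)
  have st: "sqrt (s * t) * sqrt (s * t) = s * t" "sqrt x * sqrt x = x" using assms by auto
  have pos: "sqrt (s * t) > 0" "sqrt x > 0" using assms by auto
  have "x * sqrt x / 4 * T_quot x s t = x * sqrt x / 4 * (2 / (pi * (2 * pi * (sqrt (s * t) * sqrt x))) * ((4 * pi\<^sup>2 * s * t / x) * hyp_kernel 0 x (s * t)) / sqrt (s * t))"
    unfolding T_quot_def y_def[symmetric] T32_eq[OF y] L sy by (rule refl)
  also have "\<dots> = hyp_kernel 0 x (s * t)"
  proof -
    have "(r * r) * r / 4 * (2 / (pi * (2 * pi * (q * r))) * ((4 * pi\<^sup>2 * (q * q) / (r * r)) * h) / q) = h" if "q > 0" "r > 0" for q r h :: real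
      using that by (simp add: power2_eq_square)
    from this[OF pos] show ?thesis unfolding st by (simp add: mult.assoc)
  qed
  finally show ?thesis .
qed

section \<open>Termwise derivatives and the summation formula\<close>

lemma iterated_deriv_eq:
  fixes D :: "nat \<Rightarrow> real \<Rightarrow> real"
  assumes S: "open S" and f: "\<And>p. p \<in> S \<Longrightarrow> f p = D 0 p"
    and D: "\<And>j p. j < k \<Longrightarrow> p \<in> S \<Longrightarrow> (D j has_field_derivative D (Suc j) p) (at p)"
  shows "j \<le> k \<Longrightarrow> p \<in> S \<Longrightarrow> (deriv ^^ j) f p = D j p"
    and "j < k \<Longrightarrow> p \<in> S \<Longrightarrow> (deriv ^^ j) f field_differentiable at p"
proof -
  have eq: "\<forall>p\<in>S. (deriv ^^ j) f p = D j p" if "j \<le> k" for j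
    using that
  proof (induction j)
    case 0 then show ?case using f by simp
  next
    case (Suc j)
    show ?case
    proof
      fix p assume p: "p \<in> S"
      have "(D j has_field_derivative D (Suc j) p) (at p)" using D[of j p] Suc.prems p by simp
      then have "((deriv ^^ j) f has_field_derivative D (Suc j) p) (at p)"
        by (rule has_field_derivative_transform_within_open[OF _ S p]) (use Suc in auto)
      then show "(deriv ^^ Suc j) f p = D (Suc j) p" by (simp add: DERIV_imp_deriv)
    qed
  qed
  then show "j \<le> k \<Longrightarrow> p \<in> S \<Longrightarrow> (deriv ^^ j) f p = D j p" by blast
  assume j: "j < k" and p: "p \<in> S"
  have "((deriv ^^ j) f has_field_derivative D (Suc j) p) (at p)"
    by (rule has_field_derivative_transform_within_open[OF D[OF j p] S p]) (use eq j in auto)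
  then show "(deriv ^^ j) f field_differentiable at p" by (auto simp: field_differentiable_def)
qed

text \<open>
The derivatives are verified along explicit functions \<open>P j\<close> (after \<open>j\<close> derivatives in \<open>t\<close>) and \<open>Q j\<close> (after \<open>k\<close> derivatives in
\<open>t\<close> and \<open>j\<close> in \<open>s\<close>). Openness lets the equality of functions on \<open>A \<times> B\<close> pass to their derivatives.
\<close>

lemma mixed_deriv_tower:
  fixes P Q :: "nat \<Rightarrow> real \<Rightarrow> real \<Rightarrow> real"
  assumes "open A" "open B"
    and P0: "\<And>s t. s \<in> A \<Longrightarrow> t \<in> B \<Longrightarrow> F s t = P 0 s t"
    and dP: "\<And>j s t. j < k \<Longrightarrow> s \<in> A \<Longrightarrow> t \<in> B \<Longrightarrow> ((\<lambda>t. P j s t) has_field_derivative P (Suc j) s t) (at t)"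
    and Q0: "\<And>s t. s \<in> A \<Longrightarrow> t \<in> B \<Longrightarrow> P k s t = Q 0 s t"
    and dQ: "\<And>j s t. j < k \<Longrightarrow> s \<in> A \<Longrightarrow> t \<in> B \<Longrightarrow> ((\<lambda>s. Q j s t) has_field_derivative Q (Suc j) s t) (at s)"
  shows "mixed_deriv_exists_on k F A B"
    and "s \<in> A \<Longrightarrow> t \<in> B \<Longrightarrow> mixed_deriv k F s t = Q k s t"
proof -
  have t: "j \<le> k \<Longrightarrow> (deriv ^^ j) (\<lambda>t'. F s t') t = P j s t" "j < k \<Longrightarrow> (deriv ^^ j) (\<lambda>t'. F s t') field_differentiable at t"
    if "s \<in> A" "t \<in> B" for j s t
    using iterated_deriv_eq[of B "\<lambda>t'. F s t'" "\<lambda>j t. P j s t" k j t] assms(2) P0 dP that by auto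
  have s: "j \<le> k \<Longrightarrow> (deriv ^^ j) (\<lambda>s'. (deriv ^^ k) (\<lambda>t'. F s' t') t) s = Q j s t" "j < k \<Longrightarrow> (deriv ^^ j) (\<lambda>s'. (deriv ^^ k) (\<lambda>t'. F s' t') t) field_differentiable at s"
    if "s \<in> A" "t \<in> B" for j s t
    using iterated_deriv_eq[of A "\<lambda>s'. (deriv ^^ k) (\<lambda>t'. F s' t') t" "\<lambda>j s. Q j s t" k j s] assms(1) t Q0 dQ that by auto
  show "mixed_deriv_exists_on k F A B"
    unfolding mixed_deriv_exists_on_def using s t by blast
  show "s \<in> A \<Longrightarrow> t \<in> B \<Longrightarrow> mixed_deriv k F s t = Q k s t"
    unfolding mixed_deriv_def using s(1)[of s t k] by simp
qed

lemma lhs_index_finite: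
  "finite {(m, n). 1 \<le> m \<and> 1 \<le> n \<and> real (m * n) \<le> x}"
proof (rule finite_subset)
  show "{(m, n). 1 \<le> m \<and> 1 \<le> n \<and> real (m * n) \<le> x} \<subseteq> {..nat \<lfloor>x\<rfloor>} \<times> {..nat \<lfloor>x\<rfloor>}"
  proof safe
    fix m n :: nat assume mn: "1 \<le> m" "1 \<le> n" "real (m * n) \<le> x"
    have "m * n \<le> nat \<lfloor>x\<rfloor>" using mn(3) by linarith
    moreover have "m \<le> m * n" "n \<le> m * n" using mn by auto
    ultimately show "m \<le> nat \<lfloor>x\<rfloor>" "n \<le> nat \<lfloor>x\<rfloor>" by linarith+
  qed
qed simp

lemma scaled_dsin_deriv:
  "((\<lambda>t. a ^ j * dsin j (a * t)) has_real_derivative a ^ Suc j * dsin (Suc j) (a * t)) (at t)"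
  by (rule derivative_eq_intros refl | simp)+

lemma lhs_mixed_deriv:
  shows "mixed_deriv_exists_on k (lhs_sum x) {0<..<1} {0<..<1}"
    and "\<sigma> \<in> {0<..<1} \<Longrightarrow> \<theta> \<in> {0<..<1} \<Longrightarrow> mixed_deriv k (lhs_sum x) \<sigma> \<theta> = (4 * pi\<^sup>2) ^ k * primed_sum x (\<lambda>m n. coef k \<sigma> m * coef k \<theta> n)"
proof -
  let ?I = "{(m, n). 1 \<le> m \<and> 1 \<le> n \<and> real (m * n) \<le> x}"
  define w where "w = (\<lambda>(m, n). (if real (m * n) = x then 1 / 2 else 1) * (real m * real n))"
  define u where "u = (\<lambda>j (m::nat) s. (2 * pi * real m) ^ j * dsin j (2 * pi * real m * s))"
  define P where "P = (\<lambda>j s t. \<Sum>z\<in>?I. w z * (u 0 (fst z) s * u j (snd z) t))"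
  define Q where "Q = (\<lambda>j s t. \<Sum>z\<in>?I. w z * (u j (fst z) s * u k (snd z) t))"
  have du: "((\<lambda>s. u j m s) has_real_derivative u (Suc j) m s) (at s)" for j m s
    unfolding u_def by (rule scaled_dsin_deriv)
  have 0: "lhs_sum x s t = P 0 s t" for s t
    unfolding lhs_sum_def primed_sum_def P_def w_def u_def
    by (rule sum.cong) (auto simp: mult.assoc)
  have 1: "((\<lambda>t. P j s t) has_field_derivative P (Suc j) s t) (at t)" for j s t
    unfolding P_def by (intro DERIV_sum DERIV_cmult du)
  have 2: "P k s t = Q 0 s t" for s t unfolding P_def Q_def ..
  have 3: "((\<lambda>s. Q j s t) has_field_derivative Q (Suc j) s t) (at s)" for j s t
    unfolding Q_def by (intro DERIV_sum DERIV_cmult DERIV_cmult_right du)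
  show "mixed_deriv_exists_on k (lhs_sum x) {0<..<1} {0<..<1}"
    by (rule mixed_deriv_tower(1)[of _ _ _ P k Q]) (use 0 1 2 3 in auto)
  assume "\<sigma> \<in> {0<..<1}" "\<theta> \<in> {0<..<1}"
  then have "mixed_deriv k (lhs_sum x) \<sigma> \<theta> = Q k \<sigma> \<theta>"
    by (intro mixed_deriv_tower(2)[of "{0<..<1}" "{0<..<1}" _ P k Q]) (use 0 1 2 3 in auto)
  also have "\<dots> = (4 * pi\<^sup>2) ^ k * primed_sum x (\<lambda>m n. coef k \<sigma> m * coef k \<theta> n)"
    unfolding Q_def primed_sum_def sum_distrib_left
  proof (rule sum.cong)
    fix z assume "z \<in> ?I"
    obtain m n where z: "z = (m, n)" by (cases z)
    have p: "(2 * pi * real m) ^ k * (2 * pi * real n) ^ k = (4 * pi\<^sup>2) ^ k * (real m ^ k * real n ^ k)"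
      unfolding power_mult_distrib[symmetric] by (simp add: power2_eq_square algebra_simps)
    have "w (m, n) * (u k m \<sigma> * u k n \<theta>) = (if real (m * n) = x then 1 / 2 else 1) * (real m * real n) * (((2 * pi * real m) ^ k * (2 * pi * real n) ^ k) * (dsin k (2 * pi * real m * \<sigma>) * dsin k (2 * pi * real n * \<theta>)))"
      unfolding w_def u_def by simp
    also have "\<dots> = (4 * pi\<^sup>2) ^ k * ((if real (m * n) = x then 1 / 2 else 1) * (coef k \<sigma> m * coef k \<theta> n))"
      unfolding p coef_def by simp
    finally show "w z * (u k (fst z) \<sigma> * u k (snd z) \<theta>) = (4 * pi\<^sup>2) ^ k * (case z of (m, n) \<Rightarrow> (if real (m * n) = x then 1 / 2 else 1) * (coef k \<sigma> m * coef k \<theta> n))"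
      unfolding z by simp
  qed simp
  finally show "mixed_deriv k (lhs_sum x) \<sigma> \<theta> = (4 * pi\<^sup>2) ^ k * primed_sum x (\<lambda>m n. coef k \<sigma> m * coef k \<theta> n)" .
qed

lemma primed_sum_iterated:
  assumes "0 < x"
  shows "primed_sum x (\<lambda>m n. coef k \<sigma> m * coef k \<theta> n) = (\<Sum>n | 1 \<le> n \<and> real n \<le> x. coef k \<theta> n * half_sum k \<sigma> (x / real n))"
proof -
  let ?I = "{(m, n). 1 \<le> m \<and> 1 \<le> n \<and> real (m * n) \<le> x}"
  let ?N = "{n. 1 \<le> n \<and> real n \<le> x}"
  let ?M = "\<lambda>n. {m. 1 \<le> m \<and> real m \<le> x / real n}"
  let ?w = "\<lambda>m n. if real (m * n) = x then 1 / 2 else (1::real)"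
  have le: "real (m * n) \<le> x \<longleftrightarrow> real m \<le> x / real n" and eq: "real (m * n) = x \<longleftrightarrow> real m = x / real n" if "1 \<le> n" for m n
    using that by (auto simp: field_simps)
  have I: "?I = (\<lambda>(n, m). (m, n)) ` (SIGMA n:?N. ?M n)"
  proof safe
    fix m n :: nat assume mn: "1 \<le> m" "1 \<le> n" "real (m * n) \<le> x"
    have "real n \<le> real (m * n)" using mn by simp
    then have "real n \<le> x" using mn by linarith
    then show "(m, n) \<in> (\<lambda>(n, m). (m, n)) ` (SIGMA n:?N. ?M n)"
      using mn le[OF mn(2)] by (intro image_eqI[of _ _ "(n, m)"]) auto
  qed (use le in auto)
  have inj: "inj_on (\<lambda>(n, m). (m, n)) (SIGMA n:?N. ?M n)" by (auto simp: inj_on_def)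
  have fin: "finite (SIGMA n:?N. ?M n)"
    using lhs_index_finite[of x] finite_image_iff[OF inj] unfolding I by simp
  have finN: "finite ?N" by (rule finite_subset[of _ "{..nat \<lfloor>x\<rfloor>}"]) (auto simp: le_nat_floor)
  have finM: "finite (?M n)" for n by (rule finite_subset[of _ "{..nat \<lfloor>x / real n\<rfloor>}"]) (auto simp: le_nat_floor)
  have "primed_sum x (\<lambda>m n. coef k \<sigma> m * coef k \<theta> n) = (\<Sum>(n, m)\<in>(SIGMA n:?N. ?M n). ?w m n * (coef k \<sigma> m * coef k \<theta> n))"
    unfolding primed_sum_def I by (subst sum.reindex[OF inj]) (auto intro!: sum.cong)
  also have "\<dots> = (\<Sum>n\<in>?N. \<Sum>m\<in>?M n. ?w m n * (coef k \<sigma> m * coef k \<theta> n))"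
    by (rule sum.Sigma[symmetric]) (use finN finM in auto)
  also have "\<dots> = (\<Sum>n\<in>?N. coef k \<theta> n * half_sum k \<sigma> (x / real n))"
    unfolding half_sum_def sum_distrib_left
    by (intro sum.cong refl) (use eq in auto)
  finally show ?thesis .
qed

text \<open>
Differentiating \<open>f\<^sub>0 (a b)\<close> \<open>k\<close> times in \<open>b\<close> gives \<open>a\<^sup>k f\<^sub>0\<^sup>(\<^sup>k\<^sup>) (a b)\<close>. By the differential equation every derivative in \<open>a\<close>
then lowers the power of \<open>a\<close> by one and passes from \<open>f\<^sub>j\<close> to \<open>4 \<pi>\<^sup>2 f\<^sub>j\<^sub>+\<^sub>1\<close>, so that after \<open>k\<close> steps only \<open>f\<^sub>k\<close> is
left. The signs from \<open>1 - \<sigma>\<close> and \<open>1 - \<theta>\<close> are absorbed by the parity of the hyperbola integral.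
\<close>

lemma bracket_mixed_deriv:
  assumes x: "0 < x"
  shows "mixed_deriv_exists_on k (bracket x m n) {0<..<1} {0<..<1}"
    and "\<sigma> \<in> {0<..<1} \<Longrightarrow> \<theta> \<in> {0<..<1} \<Longrightarrow> x * sqrt x / 4 * mixed_deriv k (bracket x m n) \<sigma> \<theta> = (4 * pi\<^sup>2) ^ k *
      ((hyp_int k x (1 / 2) (real m + \<sigma>) (real n + \<theta>) + hyp_int k x (1 / 2) (real m + \<sigma>) (\<theta> - 1 - real n))
       + (hyp_int k x (1 / 2) (\<sigma> - 1 - real m) (real n + \<theta>) + hyp_int k x (1 / 2) (\<sigma> - 1 - real m) (\<theta> - 1 - real n)))"
proof -
  define c where "c = x * sqrt x / 4"
  have c: "c > 0" using x by (simp add: c_def)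
  obtain fd :: "nat \<Rightarrow> nat \<Rightarrow> real \<Rightarrow> real" where fd0: "\<And>k p. fd k 0 p = hyp_kernel k x p"
    and fd1: "\<And>k j p. p > 0 \<Longrightarrow> (fd k j has_real_derivative fd k (Suc j) p) (at p)"
    and fd2: "\<And>k j p. p > 0 \<Longrightarrow> real (Suc j) * fd k (Suc j) p + p * fd k (Suc (Suc j)) p = 4 * pi\<^sup>2 * fd (Suc k) j p"
    using hyp_kernel_smooth[OF x] by blast
  define U where "U = (\<lambda>j a b. a ^ j * fd 0 j (a * b))"
  define E where "E = (\<lambda>j a b. (4 * pi\<^sup>2) ^ j * (a ^ (k - j) * fd j (k - j) (a * b)))"
  have dU: "((\<lambda>b. U j a b) has_real_derivative U (Suc j) a b) (at b)" if "a > 0" "b > 0" for j a b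
  proof -
    have "((\<lambda>b. fd 0 j (a * b)) has_real_derivative fd 0 (Suc j) (a * b) * (a * 1)) (at b)"
      by (rule DERIV_chain2[OF fd1]) (use that in \<open>auto intro!: derivative_eq_intros\<close>)
    from DERIV_cmult[OF this, of "a ^ j"]
    have "((\<lambda>b. a ^ j * fd 0 j (a * b)) has_real_derivative a ^ j * (fd 0 (Suc j) (a * b) * (a * 1))) (at b)" .
    moreover have "a ^ j * (fd 0 (Suc j) (a * b) * (a * 1)) = a ^ Suc j * fd 0 (Suc j) (a * b)" by simp
    ultimately show ?thesis unfolding U_def by (simp only:)
  qed
  have dE: "((\<lambda>a. E j a b) has_real_derivative E (Suc j) a b) (at a)" if "a > 0" "b > 0" "j < k" for j a b
  proof -
    define i where "i = k - Suc j"
    have kj: "k - j = Suc i" "k - Suc j = i" using that by (auto simp: i_def)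
    have "((\<lambda>a. fd j (Suc i) (a * b)) has_real_derivative fd j (Suc (Suc i)) (a * b) * (1 * b)) (at a)"
      by (rule DERIV_chain2[OF fd1]) (use that in \<open>auto intro!: derivative_eq_intros\<close>)
    moreover have "((\<lambda>a. a ^ Suc i) has_real_derivative real (Suc i) * a ^ i) (at a)"
      using DERIV_pow[of "Suc i" a UNIV] by simp
    ultimately have "((\<lambda>a. a ^ Suc i * fd j (Suc i) (a * b)) has_real_derivative
        a ^ Suc i * (fd j (Suc (Suc i)) (a * b) * (1 * b)) + real (Suc i) * a ^ i * fd j (Suc i) (a * b)) (at a)"
      by (intro DERIV_mult')
    also have "a ^ Suc i * (fd j (Suc (Suc i)) (a * b) * (1 * b)) + real (Suc i) * a ^ i * fd j (Suc i) (a * b)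
       = a ^ i * (real (Suc i) * fd j (Suc i) (a * b) + a * b * fd j (Suc (Suc i)) (a * b))"
      by (simp add: algebra_simps)
    also have "\<dots> = a ^ i * (4 * pi\<^sup>2 * fd (Suc j) i (a * b))"
      by (subst fd2) (use that in auto)
    finally have "((\<lambda>a. a ^ Suc i * fd j (Suc i) (a * b)) has_real_derivative a ^ i * (4 * pi\<^sup>2 * fd (Suc j) i (a * b))) (at a)" .
    from DERIV_cmult[OF this, of "(4 * pi\<^sup>2) ^ j"] show ?thesis
      unfolding E_def kj by (simp add: mult.commute mult.left_commute)
  qed
  have dUp: "((\<lambda>t. U j a (real n + t)) has_real_derivative U (Suc j) a (real n + t)) (at t)" if "a > 0" "t \<in> {0<..<1}" for j a t
  proof -
    have "((\<lambda>t. U j a (real n + t)) has_real_derivative U (Suc j) a (real n + t) * (0 + 1)) (at t)"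
      by (rule DERIV_chain2[OF dU]) (use that in \<open>auto intro!: derivative_eq_intros\<close>)
    then show ?thesis by simp
  qed
  have dUm: "((\<lambda>t. U j a (real n + 1 - t)) has_real_derivative - U (Suc j) a (real n + 1 - t)) (at t)" if "a > 0" "t \<in> {0<..<1}" for j a t
  proof -
    have "((\<lambda>t. U j a (real n + 1 - t)) has_real_derivative U (Suc j) a (real n + 1 - t) * (0 - 1)) (at t)"
      by (rule DERIV_chain2[OF dU]) (use that in \<open>auto intro!: derivative_eq_intros\<close>)
    then show ?thesis by simp
  qed
  have dEp: "((\<lambda>s. E j (real m + s) b) has_real_derivative E (Suc j) (real m + s) b) (at s)" if "b > 0" "s \<in> {0<..<1}" "j < k" for j b s
  proof -
    have "((\<lambda>s. E j (real m + s) b) has_real_derivative E (Suc j) (real m + s) b * (0 + 1)) (at s)"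
      by (rule DERIV_chain2[OF dE]) (use that in \<open>auto intro!: derivative_eq_intros\<close>)
    then show ?thesis by simp
  qed
  have dEm: "((\<lambda>s. E j (real m + 1 - s) b) has_real_derivative - E (Suc j) (real m + 1 - s) b) (at s)" if "b > 0" "s \<in> {0<..<1}" "j < k" for j b s
  proof -
    have "((\<lambda>s. E j (real m + 1 - s) b) has_real_derivative E (Suc j) (real m + 1 - s) b * (0 - 1)) (at s)"
      by (rule DERIV_chain2[OF dE]) (use that in \<open>auto intro!: derivative_eq_intros\<close>)
    then show ?thesis by simp
  qed
  define P where "P = (\<lambda>j s t. (1 / c) * (U j (real m + s) (real n + t) - U j (real m + 1 - s) (real n + t)
      - (-1) ^ j * U j (real m + s) (real n + 1 - t) + (-1) ^ j * U j (real m + 1 - s) (real n + 1 - t)))"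
  define Q where "Q = (\<lambda>j s t. (1 / c) * (E j (real m + s) (real n + t) - (-1) ^ j * E j (real m + 1 - s) (real n + t)
      - (-1) ^ k * E j (real m + s) (real n + 1 - t) + (-1) ^ j * ((-1) ^ k * E j (real m + 1 - s) (real n + 1 - t))))"
  have 0: "bracket x m n s t = P 0 s t" if "s \<in> {0<..<1}" "t \<in> {0<..<1}" for s t
  proof -
    have T: "T_quot x a b = (1 / c) * U 0 a b" if "a > 0" "b > 0" for a b
      using T_quot_eq_hyp_kernel[OF that x] c by (simp add: U_def fd0 c_def[symmetric] field_simps)
    show ?thesis unfolding bracket_def P_def using that by (simp add: T algebra_simps)
  qed
  have 1: "((\<lambda>t. P j s t) has_field_derivative P (Suc j) s t) (at t)" if "s \<in> {0<..<1}" "t \<in> {0<..<1}" for j s t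
  proof -
    have "((\<lambda>t. P j s t) has_real_derivative (1 / c) * (U (Suc j) (real m + s) (real n + t) - U (Suc j) (real m + 1 - s) (real n + t)
      - (-1) ^ j * (- U (Suc j) (real m + s) (real n + 1 - t)) + (-1) ^ j * (- U (Suc j) (real m + 1 - s) (real n + 1 - t)))) (at t)"
      unfolding P_def by (intro DERIV_cmult DERIV_add DERIV_diff dUp dUm) (use that in auto)
    then show ?thesis unfolding P_def by simp
  qed
  have 2: "P k s t = Q 0 s t" for s t unfolding P_def Q_def U_def E_def by simp
  have 3: "((\<lambda>s. Q j s t) has_field_derivative Q (Suc j) s t) (at s)" if "s \<in> {0<..<1}" "t \<in> {0<..<1}" "j < k" for j s t
  proof -
    have "((\<lambda>s. Q j s t) has_real_derivative (1 / c) * (E (Suc j) (real m + s) (real n + t) - (-1) ^ j * (- E (Suc j) (real m + 1 - s) (real n + t))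
      - (-1) ^ k * E (Suc j) (real m + s) (real n + 1 - t) + (-1) ^ j * ((-1) ^ k * (- E (Suc j) (real m + 1 - s) (real n + 1 - t))))) (at s)"
      unfolding Q_def by (intro DERIV_cmult DERIV_add DERIV_diff dEp dEm) (use that in auto)
    then show ?thesis unfolding Q_def by simp
  qed
  show "mixed_deriv_exists_on k (bracket x m n) {0<..<1} {0<..<1}"
    by (rule mixed_deriv_tower(1)[of _ _ _ P k Q]) (use 0 1 2 3 in auto)
  assume st: "\<sigma> \<in> {0<..<1}" "\<theta> \<in> {0<..<1}"
  then have M: "mixed_deriv k (bracket x m n) \<sigma> \<theta> = Q k \<sigma> \<theta>"
    by (intro mixed_deriv_tower(2)[of "{0<..<1}" "{0<..<1}" _ P k Q]) (use 0 1 2 3 in auto)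
  have Ek: "E k a b = (4 * pi\<^sup>2) ^ k * hyp_int k x (1 / 2) a b" if "a > 0" "b > 0" for a b
    using hyp_int_prod[of "1 / 2" a b x k] that x by (simp add: E_def fd0)
  have hs: "hyp_int k x (1 / 2) (\<sigma> - 1 - real m) t = (-1) ^ Suc k * hyp_int k x (1 / 2) (real m + 1 - \<sigma>) t" for t
    using hyp_int_minus_s[of k x "1 / 2" "real m + 1 - \<sigma>" t] by (simp add: algebra_simps)
  have ht: "hyp_int k x (1 / 2) s (\<theta> - 1 - real n) = (-1) ^ Suc k * hyp_int k x (1 / 2) s (real n + 1 - \<theta>)" for s
    using hyp_int_minus_t[of k x "1 / 2" s "real n + 1 - \<theta>"] by (simp add: algebra_simps)
  have pos: "real m + \<sigma> > 0" "real n + \<theta> > 0" "real m + 1 - \<sigma> > 0" "real n + 1 - \<theta> > 0" using st by auto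
  have "c * Q k \<sigma> \<theta> = E k (real m + \<sigma>) (real n + \<theta>) - (-1) ^ k * E k (real m + 1 - \<sigma>) (real n + \<theta>)
      - (-1) ^ k * E k (real m + \<sigma>) (real n + 1 - \<theta>) + (-1) ^ k * ((-1) ^ k * E k (real m + 1 - \<sigma>) (real n + 1 - \<theta>))"
    unfolding Q_def using c by simp
  also have "\<dots> = (4 * pi\<^sup>2) ^ k *
      ((hyp_int k x (1 / 2) (real m + \<sigma>) (real n + \<theta>) + hyp_int k x (1 / 2) (real m + \<sigma>) (\<theta> - 1 - real n))
       + (hyp_int k x (1 / 2) (\<sigma> - 1 - real m) (real n + \<theta>) + hyp_int k x (1 / 2) (\<sigma> - 1 - real m) (\<theta> - 1 - real n)))"
    unfolding hs ht by (simp only: Ek[OF pos(1,2)] Ek[OF pos(3,2)] Ek[OF pos(1,4)] Ek[OF pos(3,4)] power_Suc) (simp add: algebra_simps)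
  finally show "x * sqrt x / 4 * mixed_deriv k (bracket x m n) \<sigma> \<theta> = (4 * pi\<^sup>2) ^ k *
      ((hyp_int k x (1 / 2) (real m + \<sigma>) (real n + \<theta>) + hyp_int k x (1 / 2) (real m + \<sigma>) (\<theta> - 1 - real n))
       + (hyp_int k x (1 / 2) (\<sigma> - 1 - real m) (real n + \<theta>) + hyp_int k x (1 / 2) (\<sigma> - 1 - real m) (\<theta> - 1 - real n)))"
    unfolding M c_def[symmetric] .
qed

theorem theorem2p5:
  fixes \<sigma> \<theta> x :: real and k :: nat
  assumes "\<sigma> \<in> {0<..<1}" and "\<theta> \<in> {0<..<1}" and "x > 0"
  shows "mixed_deriv_exists_on k (lhs_sum x) {0<..<1} {0<..<1} \<and>
         (\<forall>m n. mixed_deriv_exists_on k (bracket x m n) {0<..<1} {0<..<1}) \<and>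
         (\<forall>m. summable (\<lambda>n. mixed_deriv k (bracket x m n) \<sigma> \<theta>)) \<and>
         summable (\<lambda>m. \<Sum>n. mixed_deriv k (bracket x m n) \<sigma> \<theta>) \<and>
         mixed_deriv k (lhs_sum x) \<sigma> \<theta> =
           x * sqrt x / 4 * (\<Sum>m. \<Sum>n. mixed_deriv k (bracket x m n) \<sigma> \<theta>)"
proof -
  have \<theta>: "0 < \<theta>" "\<theta> < 1" using assms by auto
  define c where "c = x * sqrt x / 4"
  have c: "c \<noteq> 0" using assms by (simp add: c_def)
  define d where "d = (4 * pi\<^sup>2) ^ k / c"
  let ?M = "\<lambda>m n. mixed_deriv k (bracket x m n) \<sigma> \<theta>"
  let ?h = "\<lambda>s n. hyp_int k x (1 / 2) s (real n + \<theta>) + hyp_int k x (1 / 2) s (\<theta> - 1 - real n)"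
  let ?V = "inner_value k x \<theta>"
  have M: "?M m n = d * (?h (real m + \<sigma>) n + ?h (\<sigma> - 1 - real m) n)" for m n
    using bracket_mixed_deriv(2)[OF assms(3,1,2), of k m n] c unfolding c_def[symmetric] d_def
    by (simp add: field_simps)
  have inner: "?M m sums (d * (?V (real m + \<sigma>) + ?V (\<sigma> - 1 - real m)))" for m
  proof -
    have "?h (real m + \<sigma>) sums ?V (real m + \<sigma>)" "?h (\<sigma> - 1 - real m) sums ?V (\<sigma> - 1 - real m)"
      unfolding sums_def by (intro inner_limit; use assms \<theta> in auto)+
    then show ?thesis unfolding M by (intro sums_mult sums_add)
  qed
  define S where "S = (\<Sum>n | 1 \<le> n \<and> real n \<le> x. coef k \<theta> n * half_sum k \<sigma> (x / real n))"
  have "(\<lambda>m. ?V (real m + \<sigma>) + ?V (\<sigma> - 1 - real m)) sums S"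
    unfolding sums_def S_def by (rule outer_limit[OF assms(3) \<theta>])
  then have outer: "(\<lambda>m. \<Sum>n. ?M m n) sums (d * S)"
    unfolding sums_unique[OF inner, symmetric] by (rule sums_mult)
  have "mixed_deriv k (lhs_sum x) \<sigma> \<theta> = (4 * pi\<^sup>2) ^ k * S"
    unfolding S_def lhs_mixed_deriv(2)[OF assms(1,2)] primed_sum_iterated[OF assms(3)] ..
  also have "\<dots> = c * (\<Sum>m. \<Sum>n. ?M m n)"
    unfolding sums_unique[OF outer, symmetric] d_def using c by simp
  finally show ?thesis
    unfolding c_def
    using lhs_mixed_deriv(1) bracket_mixed_deriv(1)[OF assms(3)] sums_summable[OF inner] sums_summable[OF outer]
    by blast
qed

end
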